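(* For every nonnegative integer $n$, the number $c\phi_3(n)$ of $3$-colored generalized Frobenius partitions of $n$ satisfies \[ c\phi_3(45n+23)\equiv 0 \pmod{625}\qquad\text{and}\qquad c\phi_3(45n+41)\equiv 0\pmod{625}. \]
   Context: A generalized Frobenius partition of $n$ is a two-rowed array $\begin{pmatrix} a_1 & \cdots & a_k\\ b_1&\cdots& b_k\end{pmatrix}$ of nonnegative integers, each row non-increasing, with $n=\sum_{i=1}^k (a_i+b_i+1)$. A $3$-colored Frobenius partition is such an array whose entries are taken from $3$ distinct copies of the nonnegative integers distinguished by color, where each row is ordered first by size and then by color, and no two consecutive entries in a row are identical (same size and same color). $c\phi_3(n)$ denotes the number of $3$-colored Frobenius partitions of $n$. Let $p(n)$ be the ordinary partition function, with $p(\alpha)=0$ if $\alpha\notin\mathbb{Z}$. It is known (Kolitsch) that $\overline{c\phi_3}(n):=c\phi_3(n)-p(n/3)$ satisfies $\sum_{n\ge 0}\overline{c\phi_3}(n)q^n = 9q\prod_{n\ge1}\frac{(1-q^{9n})^3}{(1-q^{3n})(1-q^n)^3}$. *)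

theory Defs
  imports "HOL-Number_Theory.Cong"
begin

(* A pair (a, c) is the copy of the nonnegative integer a that has color c. *)
type_synonym colored_nat = "nat \<times> nat"

(* Comparison by size first and then by color. *)
definition colored_ge :: "colored_nat \<Rightarrow> colored_nat \<Rightarrow> bool" where
  "colored_ge x y \<longleftrightarrow> fst x > fst y \<or> (fst x = fst y \<and> snd x \<ge> snd y)"

definition colored_row :: "nat \<Rightarrow> colored_nat list \<Rightarrow> bool" where
  "colored_row k r \<longleftrightarrow> (\<forall>x\<in>set r. snd x < k) \<and> sorted_wrt colored_ge r \<and> distinct_adj r"

(* The array with no columns is admitted; it is the only one of weight 0. *)
definition colored_frobenius_partitions ::
    "nat \<Rightarrow> nat \<Rightarrow> (colored_nat list \<times> colored_nat list) set" where
  "colored_frobenius_partitions k n =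
     {(a, b). length a = length b \<and> colored_row k a \<and> colored_row k b \<and>
        n = (\<Sum>i<length a. fst (a ! i) + fst (b ! i) + 1)}"

definition cphi :: "nat \<Rightarrow> nat \<Rightarrow> nat" where
  "cphi k n = card (colored_frobenius_partitions k n)"

(* The cardinality above is a genuine count. *)
lemma finite_colored_frobenius_partitions: "finite (colored_frobenius_partitions k n)"
proof -
  let ?L = "{r. set r \<subseteq> {..n} \<times> {..<k} \<and> length r \<le> n}"
  have "colored_frobenius_partitions k n \<subseteq> ?L \<times> ?L"
  proof (clarify, goal_cases)
    case (1 a b)
    then have len: "length a = length b" and ra: "\<forall>x\<in>set a. snd x < k"
      and rb: "\<forall>x\<in>set b. snd x < k"
      and n: "n = (\<Sum>i<length a. fst (a ! i) + fst (b ! i) + 1)"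
      by (auto simp: colored_frobenius_partitions_def colored_row_def)
    have entry: "fst (a ! i) + fst (b ! i) + 1 \<le> n" if "i < length a" for i
      unfolding n using that by (intro member_le_sum) auto
    have "(\<Sum>i<length a. 1) \<le> n"
      unfolding n by (intro sum_mono) simp
    then have "length a \<le> n" by simp
    moreover have "fst x \<le> n" if "x \<in> set a" for x
      using that entry by (auto simp: in_set_conv_nth) (metis add_leD1 Suc_leD fst_conv)
    moreover have "fst x \<le> n" if "x \<in> set b" for x
      using that entry len by (auto simp: in_set_conv_nth) (metis add_leD2 Suc_leD fst_conv)
    ultimately show ?case using ra rb len by fastforce
  qed
  moreover have "finite ?L"
    by (rule finite_lists_length_le) simp
  ultimately show ?thesis
    by (meson finite_SigmaI finite_subset)
qed

end

theory Submission
  imports Defs Complex_Main "HOL-Computational_Algebra.Formal_Laurent_Series"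
    "HOL-Library.Disjoint_Sets" "HOL-Library.Product_Lexorder"
begin

text \<open>Let $E_N = \prod_n (1 - q^{Nn})$ and let $a$ be the theta series of the hexagonal lattice.
  By the Jacobi triple product the generating function of $c\phi_3$ is $a / E_1^3$, and two
  3-dissections based on $E_1^3 = E_3 a(q^3) - 3 q E_9^3$ lead to
  $16 E_1^{32} \sum c\phi_3(9n+5) q^n = 243 E_3^{15} X(q) (5 X(q) + 27 X(q^3))$
  with $X = a^4 + 216 a q E_3^9 / E_1^3$. Gluing four hexagonal lattices shows that $X$ is the theta
  series of the lattice $E_8$, and gluing two copies of $A_4$ shows that $X = B^2 + 250 B C + 3125 C^2$
  with $B = E_1^5 / E_5$ and $C = q E_5^5 / E_1$. As $B$ is 1 modulo 5, the two formulas for $X$ combine to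
  $\sum c\phi_3(9n+5) q^n = 486 E_{15}^3 E_1^3 / E_5^7$ modulo 625. By Jacobi's identity $E_1^3$ has no
  term $q^n$ with $n$ congruent to 2 or 4 modulo 5, and $9n + 5$ is then $45m + 23$ or $45m + 41$.\<close>

section \<open>Formal infinite products\<close>

text \<open>The 3-dissections produce series of level 3, whereas powers of 5 become visible only in
  B and C, which have level 5. The two worlds meet at level 1, where X is the Eisenstein series of
  weight 4. Comparing its expressions would classically use finite-dimensional spaces of modular
  forms; here each expression comes from an explicit bijection between lattices, so everything stays
  an identity of formal power series. No power of 5 divides the series of the cphi(9n+5) itself, so
  the exponent 4 in 625 has to come from isolating a factor E_1^3. This rests on a count of factors:
  E_1^-32 = E_1^3 / (E_5 B)^7 has seven B in the denominator, E_3^15 = (E_15 B(q^3))^3 supplies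
  three, and the two theta factors have leading terms of degree 2 each in B and B(q^3). If B(q^3)
  were B and C were 0, everything except E_1^3 would be a series in q^5; the remaining work is to
  show that the deviations cancel modulo 625.\<close>

definition fps_eq_below :: "nat \<Rightarrow> 'a::zero fps \<Rightarrow> 'a fps \<Rightarrow> bool" where
  "fps_eq_below n f g \<longleftrightarrow> (\<forall>i<n. f $ i = g $ i)"

lemma fps_eq_below_refl [simp]: "fps_eq_below n f f"
  by (simp add: fps_eq_below_def)

lemma fps_eq_below_sym: "fps_eq_below n f g \<Longrightarrow> fps_eq_below n g f"
  by (simp add: fps_eq_below_def)

lemma fps_eq_below_trans [trans]:
  "fps_eq_below n f g \<Longrightarrow> fps_eq_below n g h \<Longrightarrow> fps_eq_below n f h"
  by (simp add: fps_eq_below_def)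

lemma fps_eq_below_mono: "fps_eq_below n f g \<Longrightarrow> m \<le> n \<Longrightarrow> fps_eq_below m f g"
  by (simp add: fps_eq_below_def)

lemma fps_eq_below_mult:
  fixes f g f' g' :: "'a::comm_ring_1 fps"
  assumes "fps_eq_below n f f'" "fps_eq_below n g g'"
  shows "fps_eq_below n (f * g) (f' * g')"
  using assms by (auto simp: fps_eq_below_def fps_mult_nth intro!: sum.cong)

lemma fps_eq_below_prod:
  fixes f g :: "'b \<Rightarrow> 'a::comm_ring_1 fps"
  assumes "\<And>i. i \<in> A \<Longrightarrow> fps_eq_below n (f i) (g i)"
  shows "fps_eq_below n (prod f A) (prod g A)"
  using assms
proof (induction A rule: infinite_finite_induct)
  case (insert x A)
  then show ?case by (simp add: fps_eq_below_mult)
qed auto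

lemma fps_eq_below_cancel:
  fixes f g u :: "'a::comm_ring_1 fps"
  assumes "u $ 0 = 1" "fps_eq_below n (u * f) (u * g)"
  shows "fps_eq_below n f g"
  unfolding fps_eq_below_def
proof (intro allI impI)
  fix i assume "i < n"
  then show "f $ i = g $ i"
  proof (induction i rule: less_induct)
    case (less i)
    have eq: "(\<Sum>j=0..i. u $ j * f $ (i - j)) = (\<Sum>j=0..i. u $ j * g $ (i - j))"
      using assms(2) less.prems by (simp add: fps_eq_below_def fps_mult_nth)
    have "(\<Sum>j=1..i. u $ j * f $ (i - j)) = (\<Sum>j=1..i. u $ j * g $ (i - j))"
      using less by (intro sum.cong) auto
    with eq show ?case using assms(1) by (simp add: sum.atLeast_Suc_atMost)
  qed
qed

lemma fps_eqI_below: "(\<And>n. fps_eq_below n f g) \<Longrightarrow> f = g"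
  by (meson fps_ext fps_eq_below_def lessI)

text \<open>Factor \<open>n\<close> may differ from 1 only from q^n on, so coefficient
  \<open>n\<close> of the product is settled by the factors up to index \<open>n\<close>. This
  replaces convergence and makes sense over every commutative ring, in particular over Laurent
  series in z.\<close>

definition tame :: "(nat \<Rightarrow> 'a::comm_ring_1 fps) \<Rightarrow> bool" where
  "tame f \<longleftrightarrow> (\<forall>n. fps_eq_below n (f n) 1)"

definition fps_iprod :: "(nat \<Rightarrow> 'a::comm_ring_1 fps) \<Rightarrow> 'a fps" where
  "fps_iprod f = Abs_fps (\<lambda>n. (\<Prod>k\<le>n. f k) $ n)"

lemma prod_tame_extend:
  assumes "tame f"
  shows "fps_eq_below (Suc n) (\<Prod>k\<le>n + d. f k) (\<Prod>k\<le>n. f k)"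
proof (induction d)
  case (Suc d)
  have "fps_eq_below (Suc n) (f (Suc (n + d))) 1"
    using assms by (auto simp: tame_def intro: fps_eq_below_mono)
  from fps_eq_below_mult[OF Suc this] show ?case by (simp add: mult.commute)
qed simp

lemma fps_iprod_below:
  assumes "tame f" "n \<le> Suc m"
  shows "fps_eq_below n (fps_iprod f) (\<Prod>k\<le>m. f k)"
  unfolding fps_eq_below_def
proof (intro allI impI)
  fix i assume "i < n"
  then have "i \<le> m" using assms(2) by simp
  then show "fps_iprod f $ i = (\<Prod>k\<le>m. f k) $ i"
    using prod_tame_extend[OF assms(1), of i "m - i"] by (simp add: fps_iprod_def fps_eq_below_def)
qed

lemma fps_iprod_below_lessThan:
  assumes "tame f" "n \<le> m"
  shows "fps_eq_below n (fps_iprod f) (\<Prod>k<m. f k)"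
proof (cases m)
  case 0 then show ?thesis using assms by (simp add: fps_eq_below_def)
next
  case (Suc m') then show ?thesis using fps_iprod_below[of f n m'] assms by (simp add: lessThan_Suc_atMost)
qed

lemma tame_mult [intro]: "tame f \<Longrightarrow> tame g \<Longrightarrow> tame (\<lambda>n. f n * g n)"
  unfolding tame_def using fps_eq_below_mult by fastforce

lemma tame_prod: "(\<And>i. i \<in> A \<Longrightarrow> tame (f i)) \<Longrightarrow> tame (\<lambda>n. \<Prod>i\<in>A. f i n)"
  unfolding tame_def by (metis (mono_tags, lifting) fps_eq_below_prod prod.neutral_const)

lemma fps_iprod_mult:
  assumes "tame f" "tame g"
  shows "fps_iprod (\<lambda>n. f n * g n) = fps_iprod f * fps_iprod g"
proof (rule fps_eqI_below)
  fix n
  have "fps_eq_below n (fps_iprod (\<lambda>n. f n * g n)) ((\<Prod>k<n. f k) * (\<Prod>k<n. g k))"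
    using fps_iprod_below_lessThan[OF tame_mult[OF assms], of n n] by (simp add: prod.distrib)
  moreover have "fps_eq_below n ((\<Prod>k<n. f k) * (\<Prod>k<n. g k)) (fps_iprod f * fps_iprod g)"
    by (intro fps_eq_below_mult) (auto intro: fps_eq_below_sym fps_iprod_below_lessThan assms)
  ultimately show "fps_eq_below n (fps_iprod (\<lambda>n. f n * g n)) (fps_iprod f * fps_iprod g)"
    using fps_eq_below_trans by blast
qed

lemma fps_iprod_1 [simp]: "fps_iprod (\<lambda>n. 1) = 1"
  by (rule fps_eqI_below) (simp add: fps_eq_below_def fps_iprod_def)

lemma fps_iprod_prod:
  assumes "finite A" "\<And>i. i \<in> A \<Longrightarrow> tame (f i)"
  shows "fps_iprod (\<lambda>n. \<Prod>i\<in>A. f i n) = (\<Prod>i\<in>A. fps_iprod (f i))"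
  using assms
proof (induction A rule: finite_induct)
  case (insert x A)
  then show ?case by (simp add: fps_iprod_mult tame_prod)
qed simp

lemma tame_subseq:
  assumes "tame f" "\<And>n. n \<le> h n"
  shows "tame (\<lambda>n. f (h n))"
  using assms unfolding tame_def by (meson fps_eq_below_mono)

lemma fps_iprod_residues:
  assumes "tame f" "N > 0"
  shows "(\<Prod>j<N. fps_iprod (\<lambda>n. f (N * n + j))) = fps_iprod f"
proof (rule fps_eqI_below)
  fix n
  have t: "tame (\<lambda>n. f (N * n + j))" for j
    using assms(2) by (intro tame_subseq[OF assms(1)]) (simp add: trans_le_add1)
  have "fps_eq_below n (\<Prod>j<N. fps_iprod (\<lambda>n. f (N * n + j))) (\<Prod>j<N. \<Prod>k<n. f (N * k + j))"
    by (intro fps_eq_below_prod fps_iprod_below_lessThan t) auto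
  also have "(\<Prod>j<N. \<Prod>k<n. f (N * k + j)) = (\<Prod>k<n. \<Prod>j<N. f (N * k + j))"
    by (rule prod.swap)
  also have "\<dots> = (\<Prod>k<n. prod f {k * N..<k * N + N})"
  proof (rule prod.cong)
    fix k
    show "(\<Prod>j<N. f (N * k + j)) = prod f {k * N..<k * N + N}"
      using prod.shift_bounds_nat_ivl[of f 0 "k * N" N]
      by (simp add: atLeast0LessThan ac_simps)
  qed simp
  also have "\<dots> = prod f {..<n * N}" by (rule prod.nat_group)
  also have "fps_eq_below n (prod f {..<n * N}) (fps_iprod f)"
    using assms by (intro fps_eq_below_sym[OF fps_iprod_below_lessThan]) auto
  finally show "fps_eq_below n (\<Prod>j<N. fps_iprod (\<lambda>n. f (N * n + j))) (fps_iprod f)" .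
qed

definition euler :: "nat \<Rightarrow> 'a::comm_ring_1 fps" where
  "euler N = fps_iprod (\<lambda>n. 1 - fps_X ^ (N * Suc n))"

lemma tame_one_plus:
  assumes "\<And>n. n \<le> h n"
  shows "tame (\<lambda>n. 1 + fps_const (c n) * fps_X ^ h n)" "tame (\<lambda>n. 1 - fps_const (c n) * fps_X ^ h n)"
    "tame (\<lambda>n. 1 - fps_X ^ h n)"
proof -
  have "i < h n" if "i < n" for i n using assms[of n] that by simp
  then show "tame (\<lambda>n. 1 + fps_const (c n) * fps_X ^ h n)" "tame (\<lambda>n. 1 - fps_const (c n) * fps_X ^ h n)"
    "tame (\<lambda>n. 1 - fps_X ^ h n)"
    by (force simp: tame_def fps_eq_below_def)+
qed

lemma tame_euler: "N > 0 \<Longrightarrow> tame (\<lambda>n. 1 - fps_X ^ (N * Suc n))"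
  by (rule tame_one_plus) (cases N; simp)

lemma euler_nth_0 [simp]: "N > 0 \<Longrightarrow> euler N $ 0 = 1"
  by (simp add: euler_def fps_iprod_def)

section \<open>The Jacobi triple product\<close>

text \<open>The Gaussian binomial coefficient, given by a Pascal rule because the quotient formula
  would need division; \<open>qbinom_fact\<close> is that formula with denominators cleared.\<close>

fun qbinom :: "'a::comm_ring_1 \<Rightarrow> nat \<Rightarrow> nat \<Rightarrow> 'a" where
  "qbinom Q n 0 = 1"
| "qbinom Q 0 (Suc k) = 0"
| "qbinom Q (Suc n) (Suc k) = qbinom Q n k + Q ^ Suc k * qbinom Q n (Suc k)"

lemma qbinom_eq_0 [simp]: "n < k \<Longrightarrow> qbinom Q n k = 0"
  by (induction Q n k rule: qbinom.induct) auto

text \<open>The other Pascal rule. One more factor of either kind in the finite triple product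
  raises the upper index by 2, and the two rules are used once each for that.\<close>

lemma qbinom_Suc_Suc':
  "qbinom Q (Suc n) (Suc k) = Q ^ (n - k) * qbinom Q n k + qbinom Q n (Suc k)"
proof (induction n arbitrary: k)
  case 0 then show ?case by (cases k) auto
next
  case (Suc n)
  consider "k = 0" | "k > Suc n" | "k = Suc n" | k' where "k = Suc k'" "k' < n"
    by (metis less_Suc_eq linorder_cases not0_implies_Suc Suc_less_eq)
  then show ?case
  proof cases
    case 1
    have "Q * Q ^ n = Q ^ Suc n" by simp
    have "qbinom Q (Suc (Suc n)) (Suc 0) = 1 + Q * qbinom Q (Suc n) (Suc 0)" by simp
    also have "qbinom Q (Suc n) (Suc 0) = Q ^ n + qbinom Q n (Suc 0)" using Suc[of 0] by simp
    also have "1 + Q * (Q ^ n + qbinom Q n (Suc 0)) = Q ^ Suc n + (1 + Q * qbinom Q n (Suc 0))"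
      by (simp add: algebra_simps)
    also have "1 + Q * qbinom Q n (Suc 0) = qbinom Q (Suc n) (Suc 0)" by simp
    finally show ?thesis using 1 by simp
  next
    case 3
    have "qbinom Q (Suc (Suc n)) (Suc (Suc n)) = qbinom Q (Suc n) (Suc n)"
      by (subst qbinom.simps(3)) simp
    then show ?thesis using 3 by simp
  next
    case (4 k')
    have p: "Q ^ Suc (Suc k') * Q ^ (n - Suc k') = Q ^ (n - k') * Q ^ Suc k'"
      unfolding power_add[symmetric] using 4 by (intro arg_cong[where f = "\<lambda>e. Q ^ e"]) simp
    have "qbinom Q (Suc (Suc n)) (Suc (Suc k')) = qbinom Q (Suc n) (Suc k') + Q ^ Suc (Suc k') * qbinom Q (Suc n) (Suc (Suc k'))"
      by (rule qbinom.simps(3))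
    also have "\<dots> = (Q ^ (n - k') * qbinom Q n k' + qbinom Q n (Suc k'))
        + Q ^ Suc (Suc k') * (Q ^ (n - Suc k') * qbinom Q n (Suc k') + qbinom Q n (Suc (Suc k')))"
      by (simp only: Suc)
    also have "\<dots> = Q ^ (n - k') * qbinom Q n k' + (Q ^ Suc (Suc k') * Q ^ (n - Suc k')) * qbinom Q n (Suc k')
        + (qbinom Q n (Suc k') + Q ^ Suc (Suc k') * qbinom Q n (Suc (Suc k')))"
      by (simp only: algebra_simps)
    also have "\<dots> = Q ^ (n - k') * (qbinom Q n k' + Q ^ Suc k' * qbinom Q n (Suc k'))
        + (qbinom Q n (Suc k') + Q ^ Suc (Suc k') * qbinom Q n (Suc (Suc k')))"
      by (simp only: p algebra_simps)
    also have "\<dots> = Q ^ (n - k') * qbinom Q (Suc n) (Suc k') + qbinom Q (Suc n) (Suc (Suc k'))"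
      by (simp only: qbinom.simps(3))
    finally show ?thesis using 4 by simp
  qed auto
qed

lemma qbinom_fact:
  "k \<le> n \<Longrightarrow> qbinom Q n k * (\<Prod>i<k. 1 - Q ^ Suc i) * (\<Prod>i<n - k. 1 - Q ^ Suc i) = (\<Prod>i<n. 1 - Q ^ Suc i)"
proof (induction n arbitrary: k)
  case (Suc n)
  let ?F = "\<lambda>m. \<Prod>i<m. 1 - Q ^ Suc i"
  consider "k = 0" | "k = Suc n" | k' where "k = Suc k'" "k' < n"
    using Suc.prems by (metis le_SucE less_Suc_eq not0_implies_Suc not_less_eq order_le_imp_less_or_eq)
  then show ?case
  proof cases
    case 2
    have "qbinom Q (Suc n) (Suc n) = qbinom Q n n" by (subst qbinom.simps(3)) simp
    moreover have "qbinom Q n n * ?F n = ?F n" using Suc.IH[of n] by simp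
    ultimately show ?thesis using 2 by (simp add: mult.assoc[symmetric])
  next
    case (3 k')
    have d: "n - k' = Suc (n - Suc k')" using 3 by simp
    have "qbinom Q (Suc n) (Suc k') * ?F (Suc k') * ?F (n - k')
        = (qbinom Q n k' * ?F k' * ?F (n - k')) * (1 - Q ^ Suc k')
        + Q ^ Suc k' * (qbinom Q n (Suc k') * ?F (Suc k') * ?F (n - Suc k')) * (1 - Q ^ (n - k'))"
      unfolding qbinom.simps(3) d prod.lessThan_Suc by (simp only: algebra_simps d)
    also have "\<dots> = ?F n * (1 - Q ^ Suc k') + Q ^ Suc k' * ?F n * (1 - Q ^ (n - k'))"
      using 3 Suc.IH[of k'] Suc.IH[of "Suc k'"] by simp
    also have "\<dots> = ?F n * (1 - Q ^ Suc k' * Q ^ (n - k'))" by (simp only: algebra_simps mult_1)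
    also have "Q ^ Suc k' * Q ^ (n - k') = Q ^ Suc n"
      unfolding power_add[symmetric] using 3 by (intro arg_cong[where f = "\<lambda>e. Q ^ e"]) simp
    finally show ?thesis using 3 by simp
  qed auto
qed simp

text \<open>\<open>c k\<close> stands for y^k Q^(k(k-1)/2), which for negative \<open>k\<close>
  would need inverses. \<open>up\<close> and \<open>down\<close> are the multiplication rules of
  these monomials, with the power of \<open>Q\<close> placed on the side where its exponent is
  nonnegative.\<close>

lemma finite_jacobi_triple:
  fixes y y' Q :: "'a::comm_ring_1" and c :: "int \<Rightarrow> 'a"
  assumes Q: "y * y' = Q" and c0: "c 0 = 1"
    and up: "\<And>k m. nat \<bar>k\<bar> \<le> m \<Longrightarrow> c k * (y * Q ^ m) = c (k + 1) * Q ^ nat (int m - k)"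
    and down: "\<And>k m. nat \<bar>k\<bar> \<le> m \<Longrightarrow> c k * (y' * Q ^ m) = c (k - 1) * Q ^ nat (int m + k)"
  shows "(\<Prod>n<m. (1 + y * Q ^ n) * (1 + y' * Q ^ n)) = (\<Sum>i\<le>2 * m. qbinom Q (2 * m) i * c (int i - int m))"
proof (induction m)
  case 0 then show ?case by (simp add: c0)
next
  case (Suc m)
  let ?b = "qbinom Q (2 * m)"
  let ?c = "\<lambda>l. c (int l - int m - 1)"
  have "(y * y') * (Q ^ m * Q ^ m) = Q ^ Suc (2 * m)"
    by (simp add: Q mult_2 power_add)
  then have e: "(1 + y * Q ^ m) * (1 + y' * Q ^ m) = (1 + Q ^ Suc (2 * m)) + y * Q ^ m + y' * Q ^ m"
    by (simp add: algebra_simps)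
  have U: "(\<Sum>i\<le>2 * m. ?b i * c (int i - int m)) * (y * Q ^ m) = (\<Sum>i\<le>2 * m. Q ^ (2 * m - i) * ?b i * ?c (Suc (Suc i)))"
    unfolding sum_distrib_right
  proof (rule sum.cong)
    fix i assume "i \<in> {..2 * m}"
    then have "nat \<bar>int i - int m\<bar> \<le> m" "nat (int m - (int i - int m)) = 2 * m - i" by auto
    with up[of "int i - int m" m] show "?b i * c (int i - int m) * (y * Q ^ m) = Q ^ (2 * m - i) * ?b i * ?c (Suc (Suc i))"
      by (simp add: mult.assoc) (simp add: algebra_simps)
  qed simp
  have D: "(\<Sum>i\<le>2 * m. ?b i * c (int i - int m)) * (y' * Q ^ m) = (\<Sum>i\<le>2 * m. Q ^ i * ?b i * ?c i)"
    unfolding sum_distrib_right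
  proof (rule sum.cong)
    fix i assume "i \<in> {..2 * m}"
    then have "nat \<bar>int i - int m\<bar> \<le> m" "nat (int m + (int i - int m)) = i" by auto
    with down[of "int i - int m" m] show "?b i * c (int i - int m) * (y' * Q ^ m) = Q ^ i * ?b i * ?c i"
      by (simp add: mult.assoc)
  qed simp
  have M: "(\<Sum>i\<le>2 * m. ?b i * c (int i - int m)) * (1 + Q ^ Suc (2 * m)) = (\<Sum>i\<le>2 * m. (1 + Q ^ Suc (2 * m)) * ?b i * ?c (Suc i))"
    unfolding sum_distrib_right by (intro sum.cong) (simp_all add: mult.left_commute mult.commute)
  \<comment> \<open>Multiplication by y' Q^m, by 1 + Q^(2m+1) and by y Q^m moves a term by 0, 1 and
    2 places; the \<open>case\<close> expressions put 0 in the places left empty.\<close>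
  let ?s0 = "\<lambda>l. Q ^ l * ?b l * ?c l"
  let ?s1 = "\<lambda>l. (case l of 0 \<Rightarrow> 0 | Suc i \<Rightarrow> (1 + Q ^ Suc (2 * m)) * ?b i * ?c (Suc i))"
  let ?s2 = "\<lambda>l. (case l of 0 \<Rightarrow> 0 | Suc 0 \<Rightarrow> 0 | Suc (Suc i) \<Rightarrow> Q ^ (2 * m - i) * ?b i * ?c (Suc (Suc i)))"
  have S0: "(\<Sum>l\<le>Suc (Suc (2 * m)). ?s0 l) = (\<Sum>i\<le>2 * m. Q ^ i * ?b i * ?c i)"
    by simp
  have S1: "(\<Sum>l\<le>Suc (Suc (2 * m)). ?s1 l) = (\<Sum>i\<le>2 * m. (1 + Q ^ Suc (2 * m)) * ?b i * ?c (Suc i))"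
    by (subst sum.atMost_Suc_shift) simp
  have S2: "(\<Sum>l\<le>Suc (Suc (2 * m)). ?s2 l) = (\<Sum>i\<le>2 * m. Q ^ (2 * m - i) * ?b i * ?c (Suc (Suc i)))"
    by (subst sum.atMost_Suc_shift, subst sum.atMost_Suc_shift) simp
  have coeff: "qbinom Q (Suc (Suc (2 * m))) l * ?c l = ?s0 l + ?s1 l + ?s2 l" if "l \<le> Suc (Suc (2 * m))" for l
  proof -
    consider "l = 0" | "l = Suc 0" | i where "l = Suc (Suc i)" by (metis not0_implies_Suc)
    then show ?thesis
    proof cases
      case 2
      have "qbinom Q (Suc (Suc (2 * m))) (Suc 0) = 1 + Q * qbinom Q (Suc (2 * m)) (Suc 0)" by simp
      also have "qbinom Q (Suc (2 * m)) (Suc 0) = Q ^ (2 * m) + ?b (Suc 0)"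
        by (simp only: qbinom_Suc_Suc') simp
      finally show ?thesis using 2 by (simp add: algebra_simps)
    next
      case (3 i)
      have p: "Q ^ Suc (Suc i) * Q ^ (2 * m - Suc i) * ?b (Suc i) = Q ^ Suc (2 * m) * ?b (Suc i)"
      proof (cases "Suc i \<le> 2 * m")
        case True
        then have "Suc (Suc i) + (2 * m - Suc i) = Suc (2 * m)" by simp
        then show ?thesis by (simp only: power_add[symmetric])
      next
        case False then show ?thesis by simp
      qed
      have "qbinom Q (Suc (Suc (2 * m))) l = qbinom Q (Suc (2 * m)) (Suc i) + Q ^ Suc (Suc i) * qbinom Q (Suc (2 * m)) (Suc (Suc i))"
        unfolding 3 by (rule qbinom.simps(3))
      also have "\<dots> = Q ^ (2 * m - i) * ?b i + ?b (Suc i) + Q ^ Suc (Suc i) * (Q ^ (2 * m - Suc i) * ?b (Suc i) + ?b (Suc (Suc i)))"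
        by (simp only: qbinom_Suc_Suc')
      also have "\<dots> = Q ^ (2 * m - i) * ?b i + ?b (Suc i) + Q ^ Suc (Suc i) * Q ^ (2 * m - Suc i) * ?b (Suc i) + Q ^ Suc (Suc i) * ?b (Suc (Suc i))"
        by (simp only: algebra_simps)
      also have "\<dots> = Q ^ (2 * m - i) * ?b i + ?b (Suc i) + Q ^ Suc (2 * m) * ?b (Suc i) + Q ^ Suc (Suc i) * ?b (Suc (Suc i))"
        by (simp only: p)
      finally show ?thesis using 3 by (simp add: algebra_simps)
    qed simp
  qed
  have "(\<Prod>n<Suc m. (1 + y * Q ^ n) * (1 + y' * Q ^ n)) =
      (\<Sum>i\<le>2 * m. ?b i * c (int i - int m)) * ((1 + y * Q ^ m) * (1 + y' * Q ^ m))"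
    by (simp only: prod.lessThan_Suc Suc)
  also have "\<dots> = (\<Sum>l\<le>Suc (Suc (2 * m)). ?s0 l) + (\<Sum>l\<le>Suc (Suc (2 * m)). ?s1 l) + (\<Sum>l\<le>Suc (Suc (2 * m)). ?s2 l)"
    unfolding e S0 S1 S2 U[symmetric] D[symmetric] M[symmetric] by (simp only: distrib_left add.commute add.left_commute)
  also have "\<dots> = (\<Sum>l\<le>Suc (Suc (2 * m)). qbinom Q (Suc (Suc (2 * m))) l * ?c l)"
    unfolding sum.distrib[symmetric] using coeff by (intro sum.cong) auto
  finally show ?case by (simp add: algebra_simps)
qed

text \<open>The series of all w(s) q^N(s). An infinite fibre of \<open>N\<close> would silently
  contribute 0, which is why the rules for products and partitions of \<open>S\<close> assume
  \<open>finfib\<close>.\<close>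

definition lsum :: "'b set \<Rightarrow> ('b \<Rightarrow> nat) \<Rightarrow> ('b \<Rightarrow> 'a::comm_monoid_add) \<Rightarrow> 'a fps" where
  "lsum S N w = Abs_fps (\<lambda>n. \<Sum>s\<in>{s\<in>S. N s = n}. w s)"

definition tri :: "int \<Rightarrow> int" where
  "tri k = k * (k - 1) div 2"

lemma two_tri: "2 * tri k = k * (k - 1)"
  unfolding tri_def by simp

lemma tri_plus_1: "tri (k + 1) = tri k + k"
proof -
  have "2 * tri (k + 1) = 2 * (tri k + k)"
    using two_tri[of "k + 1"] two_tri[of k] by (simp add: algebra_simps)
  then show ?thesis by simp
qed

lemma tri_nonneg: "tri k \<ge> 0"
proof -
  have "k * (k - 1) \<ge> 0" by (cases "k \<le> 0") (auto intro: mult_nonneg_nonneg mult_nonpos_nonpos)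
  then show ?thesis unfolding tri_def by simp
qed

text \<open>The exponent $N k(k-1)/2 + ak$ is nonnegative whenever $a \<le> N$.\<close>

definition jexp :: "nat \<Rightarrow> nat \<Rightarrow> int \<Rightarrow> nat" where
  "jexp N a k = nat (int N * tri k + int a * k)"

lemma int_jexp:
  assumes "a \<le> N"
  shows "int (jexp N a k) = int N * tri k + int a * k"
proof -
  have "0 \<le> int N * tri k + int a * k"
  proof (cases "k \<ge> 0")
    case True then show ?thesis using tri_nonneg[of k] by simp
  next
    case False
    then have "int a * k \<ge> int N * k" using assms by (intro mult_right_mono_neg) auto
    moreover have "int N * tri k + int N * k = int N * tri (k + 1)" by (simp add: tri_plus_1 distrib_left)
    moreover have "int N * tri (k + 1) \<ge> 0" using tri_nonneg[of "k + 1"] by simp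
    ultimately show ?thesis by linarith
  qed
  then show ?thesis by (simp add: jexp_def)
qed

text \<open>\<open>tri k\<close> is at least k - 1, and for negative \<open>k\<close> the worst case
  a = N merely shifts \<open>k\<close> to k + 1. The bound makes the fibres of \<open>jexp\<close>
  finite.\<close>

lemma abs_le_jexp:
  assumes "a \<le> N" "N > 0"
  shows "\<bar>k\<bar> \<le> int (jexp N a k) + 1"
proof (cases "k \<ge> 0")
  case True
  have "tri (k - 2 + 1) = tri (k - 2) + (k - 2)" "tri (k - 1 + 1) = tri (k - 1) + (k - 1)"
    by (rule tri_plus_1)+
  moreover have "tri (k - 2 + 1) \<ge> 0" by (rule tri_nonneg)
  ultimately have "tri k \<ge> k - 1" by simp
  moreover have "int N * tri k \<ge> 1 * tri k" using assms tri_nonneg[of k] by (intro mult_right_mono) auto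
  moreover have "int a * k \<ge> 0" using True by simp
  ultimately show ?thesis using True int_jexp[OF assms(1), of k] by linarith
next
  case False
  then have "int a * k \<ge> int N * k" using assms by (intro mult_right_mono_neg) auto
  moreover have "int N * tri k + int N * k = int N * tri (k + 1)" by (simp add: tri_plus_1 distrib_left)
  moreover have "int N * tri (k + 1) \<ge> 1 * tri (k + 1)" using assms tri_nonneg[of "k + 1"] by (intro mult_right_mono) auto
  moreover have "tri (k + 1 + 1) = tri (k + 1) + (k + 1)" by (rule tri_plus_1)
  moreover have "tri (k + 1 + 1) \<ge> 0" by (rule tri_nonneg)
  ultimately show ?thesis using False int_jexp[OF assms(1), of k] by linarith
qed

lemma euler_below:
  assumes "N > 0" "n \<le> Suc m"
  shows "fps_eq_below n (euler N) (\<Prod>i<m. 1 - (fps_X ^ N) ^ Suc i)"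
proof -
  have "fps_eq_below (Suc m) (euler N :: 'a fps) (\<Prod>i<Suc m. 1 - fps_X ^ (N * Suc i))"
    unfolding euler_def by (rule fps_iprod_below_lessThan[OF tame_euler[OF assms(1)]]) simp
  moreover have "fps_eq_below (Suc m) (1 - fps_X ^ (N * Suc m) :: 'a fps) 1"
  proof -
    have "m < N * Suc m" using assms(1) by (cases N) auto
    then have "i < N * Suc m" if "i < Suc m" for i using that by linarith
    then show ?thesis by (force simp: fps_eq_below_def)
  qed
  then have "fps_eq_below (Suc m) ((\<Prod>i<m. 1 - fps_X ^ (N * Suc i)) * (1 - fps_X ^ (N * Suc m) :: 'a fps)) ((\<Prod>i<m. 1 - fps_X ^ (N * Suc i)) * 1)"
    by (intro fps_eq_below_mult) auto
  ultimately have "fps_eq_below (Suc m) (euler N :: 'a fps) (\<Prod>i<m. 1 - fps_X ^ (N * Suc i))"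
    using fps_eq_below_trans by (fastforce simp del: mult_Suc_right)
  then show ?thesis
    using assms(2) fps_eq_below_mono by (fastforce simp: power_mult[symmetric] simp del: mult_Suc_right power_Suc)
qed

text \<open>For \<open>i\<close> near the middle the Gaussian binomial tends to the inverse of
  \<open>euler N\<close>: in \<open>qbinom_fact\<close> all three partial products agree with
  \<open>euler N\<close> to the order of the shortest, and one factor cancels.\<close>

lemma euler_qbinom_below:
  assumes "N > 0" "i \<le> 2 * m" "n \<le> Suc m - nat \<bar>int i - int m\<bar>"
  shows "fps_eq_below n (euler N * qbinom (fps_X ^ N) (2 * m) i) (1 :: 'a::comm_ring_1 fps)"
proof -
  let ?E = "euler N :: 'a fps" and ?b = "qbinom (fps_X ^ N) (2 * m) i :: 'a fps"
  let ?F = "\<lambda>j. \<Prod>l<j. 1 - (fps_X ^ N) ^ Suc l :: 'a fps"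
  have "n \<le> Suc i" "n \<le> Suc (2 * m - i)" "n \<le> Suc (2 * m)" using assms(2,3) by linarith+
  note below = this[THEN euler_below[OF assms(1), where 'a = 'a]]
  have "fps_eq_below n (?b * ?E * ?E) (?b * ?F i * ?F (2 * m - i))"
    by (intro fps_eq_below_mult below fps_eq_below_refl)
  also have "?b * ?F i * ?F (2 * m - i) = ?F (2 * m)" by (rule qbinom_fact[OF assms(2)])
  also have "fps_eq_below n (?F (2 * m)) ?E" by (rule fps_eq_below_sym[OF below(3)])
  finally have "fps_eq_below n (?E * (?E * ?b)) (?E * 1)" by (simp add: ac_simps)
  with fps_eq_below_cancel[of ?E] show ?thesis using assms(1) by simp
qed

text \<open>\<open>w\<close> is the character k -> z^k, so z may be a sign, a constant times a
  Laurent variable, or a binomial series, with its inverse supplied by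
  \<open>w (-1)\<close>.\<close>

theorem jacobi_triple_product:
  fixes w :: "int \<Rightarrow> 'a::comm_ring_1"
  assumes w0: "w 0 = 1" and wadd: "\<And>j k. w (j + k) = w j * w k" and N: "N > 0" and ab: "a + b = N"
  shows "euler N * fps_iprod (\<lambda>n. (1 + fps_const (w 1) * fps_X ^ (a + N * n)) * (1 + fps_const (w (-1)) * fps_X ^ (b + N * n)))
    = lsum UNIV (jexp N a) w"
proof (rule fps_ext)
  fix n :: nat
  \<comment> \<open>Only indices with |k| \<le> n + 1 \<le> \<open>l\<close> reach coefficient
    \<open>n\<close>, and for those the Gaussian binomial is already accurate to the order
    needed.\<close>
  define l where "l = 2 * n + 1"
  let ?Q = "fps_X ^ N :: 'a fps"
  let ?y = "fps_const (w 1) * fps_X ^ a" and ?y' = "fps_const (w (-1)) * fps_X ^ b"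
  let ?c = "\<lambda>k. fps_const (w k) * fps_X ^ jexp N a k"
  have aN: "a \<le> N" using ab by simp
  have w1: "w 1 * w (-1) = 1" using wadd[of 1 "-1"] w0 by simp
  have mono: "fps_const u * fps_X ^ i * (fps_const v * fps_X ^ j * ?Q ^ m) = fps_const (u * v) * fps_X ^ (i + j + N * m)" for u v i j m
    by (simp add: power_add power_mult ac_simps fps_const_mult[symmetric] del: fps_const_mult)
  have mono2: "fps_const u * fps_X ^ i * ?Q ^ m = fps_const u * fps_X ^ (i + N * m)" for u i m
    by (simp add: power_add power_mult ac_simps)
  have fin: "(\<Prod>n<l. (1 + ?y * ?Q ^ n) * (1 + ?y' * ?Q ^ n)) = (\<Sum>i\<le>2 * l. qbinom ?Q (2 * l) i * ?c (int i - int l))"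
  proof (rule finite_jacobi_triple)
    have "?y * ?y' = fps_const (w 1 * w (-1)) * fps_X ^ (a + b)"
      by (simp add: power_add ac_simps fps_const_mult[symmetric] del: fps_const_mult)
    then show "?y * ?y' = ?Q" by (simp add: w1 ab)
    show "?c 0 = 1" by (simp add: w0 jexp_def tri_def)
  next
    fix k m assume "nat \<bar>k\<bar> \<le> m"
    then have k: "\<bar>k\<bar> \<le> int m" by simp
    have e: "int N * int (nat (int m - k)) = int N * (int m - k)" "int N * int (nat (int m + k)) = int N * (int m + k)"
      using k by auto
    have "int (jexp N a k + a + N * m) = int (jexp N a (k + 1) + N * nat (int m - k))"
      unfolding of_nat_add of_nat_mult e int_jexp[OF aN] tri_plus_1 by (simp add: algebra_simps)
    then have "jexp N a k + a + N * m = jexp N a (k + 1) + N * nat (int m - k)" by linarith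
    then show "?c k * (?y * ?Q ^ m) = ?c (k + 1) * ?Q ^ nat (int m - k)"
      unfolding mono unfolding mono2 by (simp only: wadd)
    have t: "tri k = tri (k - 1) + (k - 1)" using tri_plus_1[of "k - 1"] by simp
    have "int b = int N - int a" using ab by simp
    then have "int (jexp N a k + b + N * m) = int (jexp N a (k - 1) + N * nat (int m + k))"
      unfolding of_nat_add of_nat_mult e int_jexp[OF aN] t by (simp add: algebra_simps)
    then have "jexp N a k + b + N * m = jexp N a (k - 1) + N * nat (int m + k)" by linarith
    then show "?c k * (?y' * ?Q ^ m) = ?c (k - 1) * ?Q ^ nat (int m + k)"
      unfolding mono unfolding mono2 using wadd[of k "-1"] by (simp only: diff_conv_add_uminus)
  qed
  let ?f = "\<lambda>n. (1 + fps_const (w 1) * fps_X ^ (a + N * n)) * (1 + fps_const (w (-1)) * fps_X ^ (b + N * n))"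
  have le: "n \<le> a + N * n" "n \<le> b + N * n" for n using N by (simp_all add: trans_le_add2)
  have tame: "tame ?f" by (intro tame_mult tame_one_plus le)
  have "fps_eq_below (Suc n) (euler N * fps_iprod ?f) (euler N * (\<Prod>n<l. ?f n))"
    by (intro fps_eq_below_mult fps_iprod_below_lessThan tame) (auto simp: l_def)
  also have "(\<Prod>n<l. ?f n) = (\<Prod>n<l. (1 + ?y * ?Q ^ n) * (1 + ?y' * ?Q ^ n))"
    by (simp add: power_add power_mult mult.assoc)
  also note fin
  finally have "(euler N * fps_iprod ?f) $ n = (\<Sum>i\<le>2 * l. euler N * qbinom ?Q (2 * l) i * ?c (int i - int l)) $ n"
    by (simp add: fps_eq_below_def sum_distrib_left mult.assoc)
  also have "\<dots> = (\<Sum>i\<le>2 * l. if jexp N a (int i - int l) = n then w (int i - int l) else 0)"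
    unfolding fps_sum_nth
  proof (rule sum.cong)
    fix i assume i: "i \<in> {..2 * l}"
    define k where "k = int i - int l"
    let ?e = "jexp N a k"
    have nth: "(g * (fps_const (w k) * fps_X ^ ?e)) $ n = (if n < ?e then 0 else w k * g $ (n - ?e))" for g :: "'a fps"
      by (simp add: fps_X_power_mult_right_nth mult.assoc[symmetric] mult.commute[of _ "fps_const (w k)"])
    have ke: "\<bar>k\<bar> \<le> int ?e + 1" using abs_le_jexp[OF aN N] .
    have "(euler N * qbinom ?Q (2 * l) i) $ (n - ?e) = (1 :: 'a fps) $ (n - ?e)" if "?e \<le> n"
    proof -
      have "fps_eq_below (Suc (n - ?e)) (euler N * qbinom ?Q (2 * l) i) (1 :: 'a fps)"
        using i ke that unfolding k_def by (intro euler_qbinom_below N) (auto simp: l_def)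
      then show ?thesis by (simp add: fps_eq_below_def)
    qed
    then show "(euler N * qbinom ?Q (2 * l) i * ?c (int i - int l)) $ n = (if jexp N a (int i - int l) = n then w (int i - int l) else 0)"
      unfolding k_def[symmetric] nth by auto
  qed simp
  also have "\<dots> = (\<Sum>i\<in>{i\<in>{..2 * l}. jexp N a (int i - int l) = n}. w (int i - int l))"
    by (subst sum.inter_filter) auto
  also have "\<dots> = (\<Sum>k\<in>{k. jexp N a k = n}. w k)"
  proof (rule sum.reindex_bij_betw[where h = "\<lambda>i. int i - int l" and g = w])
    show "bij_betw (\<lambda>i. int i - int l) {i\<in>{..2 * l}. jexp N a (int i - int l) = n} {k. jexp N a k = n}"
    proof (rule bij_betw_byWitness[where f' = "\<lambda>k. nat (k + int l)"])
      have "0 \<le> k + int l \<and> k + int l \<le> 2 * int l" if "jexp N a k = n" for k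
        using abs_le_jexp[OF aN N, of k] that unfolding l_def by auto
      then show "\<forall>k\<in>{k. jexp N a k = n}. int (nat (k + int l)) - int l = k"
        "(\<lambda>k. nat (k + int l)) ` {k. jexp N a k = n} \<subseteq> {i\<in>{..2 * l}. jexp N a (int i - int l) = n}"
        by (auto simp: nat_le_iff)
    qed auto
  qed
  finally show "(euler N * fps_iprod ?f) $ n = lsum UNIV (jexp N a) w $ n"
    by (simp add: lsum_def)
qed

section \<open>Theta series as formal power series\<close>

definition fps_map :: "('a::zero \<Rightarrow> 'b::zero) \<Rightarrow> 'a fps \<Rightarrow> 'b fps" where
  "fps_map h f = Abs_fps (\<lambda>n. h (f $ n))"

lemma fps_map_nth [simp]: "fps_map h f $ n = h (f $ n)"
  by (simp add: fps_map_def)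

text \<open>Used for three maps: integers into the complex numbers, where roots of unity exist;
  constants into Laurent series; and the constant term of an inner power series.\<close>

locale cring_hom =
  fixes h :: "'a::comm_ring_1 \<Rightarrow> 'b::comm_ring_1"
  assumes hom_add: "h (x + y) = h x + h y" and hom_mult: "h (x * y) = h x * h y" and hom_1 [simp]: "h 1 = 1"
begin

lemma hom_0 [simp]: "h 0 = 0"
  using hom_add[of 0 0] by simp

lemma hom_minus: "h (x - y) = h x - h y"
  using hom_add[of "x - y" y] by simp

lemma hom_sum: "h (sum f A) = (\<Sum>x\<in>A. h (f x))"
  by (induction A rule: infinite_finite_induct) (auto simp: hom_add)

lemma map_mult: "fps_map h (f * g) = fps_map h f * fps_map h g"
  by (rule fps_ext) (simp add: fps_mult_nth hom_sum hom_mult)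

lemma map_add: "fps_map h (f + g) = fps_map h f + fps_map h g"
  by (rule fps_ext) (simp add: hom_add)

lemma map_minus: "fps_map h (f - g) = fps_map h f - fps_map h g"
  by (rule fps_ext) (simp add: hom_minus)

lemma map_1 [simp]: "fps_map h 1 = 1"
  by (rule fps_ext) simp

lemma map_X [simp]: "fps_map h fps_X = fps_X"
  by (rule fps_ext) (simp add: fps_X_def)

lemma map_power: "fps_map h (f ^ n) = fps_map h f ^ n"
  by (induction n) (simp_all add: map_mult)

lemma map_prod: "fps_map h (prod f A) = (\<Prod>x\<in>A. fps_map h (f x))"
  by (induction A rule: infinite_finite_induct) (auto simp: map_mult)

lemma map_of_nat: "fps_map h (of_nat n) = of_nat n"
  by (induction n) (auto simp: map_add fps_eq_iff)

lemma map_numeral: "fps_map h (numeral n) = numeral n"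
  using map_of_nat[of "numeral n"] by simp

lemma map_iprod: "fps_map h (fps_iprod f) = fps_iprod (\<lambda>n. fps_map h (f n))"
  by (rule fps_ext) (simp add: fps_iprod_def map_prod[symmetric])

lemma map_euler [simp]: "fps_map h (euler N) = euler N"
  by (simp add: euler_def map_iprod map_minus map_power map_mult)

lemma map_lsum: "fps_map h (lsum S N w) = lsum S N (\<lambda>s. h (w s))"
  by (rule fps_ext) (simp add: lsum_def hom_sum)

end

interpretation of_int_hom: cring_hom "of_int :: int \<Rightarrow> complex"
  by unfold_locales auto

lemma fps_map_of_int_inj: "fps_map (of_int :: int \<Rightarrow> complex) f = fps_map of_int g \<Longrightarrow> f = g"
  by (simp add: fps_eq_iff)

interpretation fls_const_hom: cring_hom "fls_const :: 'a::comm_ring_1 \<Rightarrow> 'a fls"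
  by unfold_locales (auto simp: fls_plus_const)

section \<open>Series indexed by sets with finite fibres\<close>

definition finfib :: "'b set \<Rightarrow> ('b \<Rightarrow> nat) \<Rightarrow> bool" where
  "finfib S N \<longleftrightarrow> (\<forall>n. finite {s\<in>S. N s = n})"

lemma finfib_subset: "finfib T N \<Longrightarrow> S \<subseteq> T \<Longrightarrow> finfib S N"
  unfolding finfib_def by (blast intro: finite_subset[of "{s \<in> S. N s = _}" "{s \<in> T. N s = _}"])

lemma lsum_reindex:
  assumes "bij_betw h S T" "\<And>s. s \<in> S \<Longrightarrow> M (h s) = N s" "\<And>s. s \<in> S \<Longrightarrow> v (h s) = w s"
  shows "lsum S N w = lsum T M v"
proof (rule fps_ext)
  fix n
  have "bij_betw h {s\<in>S. N s = n} {t\<in>T. M t = n}"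
    using assms(1,2) unfolding bij_betw_def by (auto intro: inj_on_subset)
  from sum.reindex_bij_betw[OF this, of v] assms(3) show "lsum S N w $ n = lsum T M v $ n"
    by (simp add: lsum_def)
qed

lemma lsum_cong: "S = T \<Longrightarrow> (\<And>s. s \<in> T \<Longrightarrow> N s = M s) \<Longrightarrow> (\<And>s. s \<in> T \<Longrightarrow> w s = v s) \<Longrightarrow> lsum S N w = lsum T M v"
  by (rule lsum_reindex[where h = id]) auto

lemma finfib_times:
  assumes "finfib S N" "finfib T M"
  shows "finfib (S \<times> T) (\<lambda>(s, t). N s + M t)"
  unfolding finfib_def
proof
  fix n
  have "{p \<in> S \<times> T. (case p of (s, t) \<Rightarrow> N s + M t) = n} \<subseteq> (\<Union>i\<le>n. {s\<in>S. N s = i} \<times> {t\<in>T. M t = n - i})"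
    by auto
  moreover have "finite (\<Union>i\<le>n. {s\<in>S. N s = i} \<times> {t\<in>T. M t = n - i})"
    using assms by (auto simp: finfib_def)
  ultimately show "finite {p \<in> S \<times> T. (case p of (s, t) \<Rightarrow> N s + M t) = n}" by (rule finite_subset)
qed

lemma lsum_mult:
  fixes w :: "'b \<Rightarrow> 'a::comm_ring_1"
  assumes "finfib S N" "finfib T M"
  shows "lsum S N w * lsum T M v = lsum (S \<times> T) (\<lambda>(s, t). N s + M t) (\<lambda>(s, t). w s * v t)"
proof (rule fps_ext)
  fix n
  let ?A = "\<lambda>i. {s\<in>S. N s = i} \<times> {t\<in>T. M t = n - i}"
  have "(lsum S N w * lsum T M v) $ n = (\<Sum>i=0..n. \<Sum>(s, t)\<in>?A i. w s * v t)"
    by (simp add: fps_mult_nth lsum_def sum_product sum.cartesian_product)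
  also have "\<dots> = (\<Sum>(s, t)\<in>(\<Union>i\<in>{0..n}. ?A i). w s * v t)"
    using assms by (subst sum.UNION_disjoint) (auto simp: finfib_def)
  also have "(\<Union>i\<in>{0..n}. ?A i) = {p \<in> S \<times> T. (case p of (s, t) \<Rightarrow> N s + M t) = n}" by auto
  finally show "(lsum S N w * lsum T M v) $ n = lsum (S \<times> T) (\<lambda>(s, t). N s + M t) (\<lambda>(s, t). w s * v t) $ n"
    by (simp add: lsum_def)
qed

lemma lsum_UNION:
  assumes "finite I" "disjoint_family_on S I" "\<And>i. i \<in> I \<Longrightarrow> finfib (S i) N"
  shows "lsum (\<Union>i\<in>I. S i) N w = (\<Sum>i\<in>I. lsum (S i) N w)"
proof (rule fps_ext)
  fix n
  have "{s \<in> (\<Union>i\<in>I. S i). N s = n} = (\<Union>i\<in>I. {s\<in>S i. N s = n})" by auto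
  moreover have "sum w (\<Union>i\<in>I. {s\<in>S i. N s = n}) = (\<Sum>i\<in>I. sum w {s\<in>S i. N s = n})"
    using assms by (intro sum.UNION_disjoint) (auto simp: finfib_def disjoint_family_on_def)
  ultimately show "lsum (\<Union>i\<in>I. S i) N w $ n = (\<Sum>i\<in>I. lsum (S i) N w) $ n"
    by (simp add: lsum_def fps_sum_nth)
qed

lemma lsum_cmult: "fps_const c * lsum S N w = lsum S N (\<lambda>s. c * w s :: 'a::comm_ring_1)"
  by (rule fps_ext) (simp add: lsum_def sum_distrib_left)

lemma lsum_shift: "fps_X ^ d * lsum S N w = lsum S (\<lambda>s. N s + d) (w :: _ \<Rightarrow> 'a::comm_ring_1)"
proof (rule fps_ext)
  fix n
  have "{s \<in> S. N s + d = n} = (if n < d then {} else {s\<in>S. N s = n - d})" by auto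
  then show "(fps_X ^ d * lsum S N w) $ n = lsum S (\<lambda>s. N s + d) w $ n"
    by (simp add: lsum_def fps_X_power_mult_nth)
qed

section \<open>The substitution of q^N for q\<close>

definition fps_stretch :: "nat \<Rightarrow> 'a::idom fps \<Rightarrow> 'a fps" where
  "fps_stretch N f = f oo fps_X ^ N"

lemma fps_stretch_nth:
  assumes "N > 0"
  shows "fps_stretch N f $ n = (if N dvd n then f $ (n div N) else 0)"
proof -
  have "fps_stretch N f $ n = (\<Sum>i=0..n. if i * N = n then f $ i else 0)"
    unfolding fps_stretch_def fps_compose_nth
    by (intro sum.cong) (auto simp: power_mult[symmetric] mult.commute)
  also have "\<dots> = (\<Sum>i\<in>{i\<in>{0..n}. i * N = n}. f $ i)" by (rule sum.inter_filter[symmetric]) simp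
  also have "{i\<in>{0..n}. i * N = n} = (if N dvd n then {n div N} else {})"
    using assms by (auto simp: div_le_dividend)
  finally show ?thesis by simp
qed

lemma fps_stretch_mult: "N > 0 \<Longrightarrow> fps_stretch N (f * g) = fps_stretch N f * fps_stretch N g"
  by (simp add: fps_stretch_def fps_compose_mult_distrib)

lemma fps_stretch_add: "fps_stretch N (f + g) = fps_stretch N f + fps_stretch N g"
  by (simp add: fps_stretch_def fps_compose_add_distrib)

lemma fps_stretch_diff: "fps_stretch N (f - g) = fps_stretch N f - fps_stretch N g"
  by (simp add: fps_stretch_def fps_compose_sub_distrib)

lemma fps_stretch_1 [simp]: "fps_stretch N 1 = 1"
  by (simp add: fps_stretch_def)

lemma fps_stretch_power: "N > 0 \<Longrightarrow> fps_stretch N (f ^ n) = fps_stretch N f ^ n"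
  by (induction n) (simp_all add: fps_stretch_mult)

lemma fps_stretch_numeral: "fps_stretch N (numeral n) = numeral n"
  by (simp add: fps_stretch_def numeral_fps_const)

lemma fps_stretch_X: "N > 0 \<Longrightarrow> fps_stretch N fps_X = fps_X ^ N"
  by (simp add: fps_stretch_def)

lemma fps_stretch_inj: 
  assumes "N > 0" "fps_stretch N f = fps_stretch N g"
  shows "f = g"
proof (rule fps_ext)
  fix n
  have "fps_stretch N f $ (N * n) = fps_stretch N g $ (N * n)" using assms(2) by simp
  then show "f $ n = g $ n" using assms(1) by (simp add: fps_stretch_nth)
qed

lemma fps_stretch_prod: "N > 0 \<Longrightarrow> fps_stretch N (prod f A) = (\<Prod>x\<in>A. fps_stretch N (f x))"
  by (induction A rule: infinite_finite_induct) (auto simp: fps_stretch_mult)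

lemma fps_stretch_euler:
  assumes "N > 0" "M > 0"
  shows "fps_stretch N (euler M) = euler (N * M)"
proof (rule fps_eqI_below)
  fix n
  have "fps_eq_below n (euler M :: 'a fps) (\<Prod>k<n. 1 - fps_X ^ (M * Suc k))"
    unfolding euler_def by (intro fps_iprod_below_lessThan tame_euler assms) simp
  then have "fps_eq_below n (fps_stretch N (euler M :: 'a fps)) (fps_stretch N (\<Prod>k<n. 1 - fps_X ^ (M * Suc k)))"
    unfolding fps_eq_below_def fps_stretch_nth[OF assms(1)]
    by (auto intro: le_less_trans[OF div_le_dividend])
  also have "fps_stretch N (\<Prod>k<n. 1 - fps_X ^ (M * Suc k) :: 'a fps) = (\<Prod>k<n. 1 - fps_X ^ (N * M * Suc k))"
    using assms by (simp add: fps_stretch_prod fps_stretch_diff fps_stretch_power fps_stretch_X power_mult[symmetric] mult.assoc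
        del: mult_Suc_right)
  also have "fps_eq_below n (\<Prod>k<n. 1 - fps_X ^ (N * M * Suc k)) (euler (N * M) :: 'a fps)"
    unfolding euler_def using assms by (intro fps_eq_below_sym[OF fps_iprod_below_lessThan] tame_euler) auto
  finally show "fps_eq_below n (fps_stretch N (euler M :: 'a fps)) (euler (N * M))" .
qed

lemma lsum_stretch:
  assumes "M > 0"
  shows "fps_stretch M (lsum S N w) = lsum S (\<lambda>s. M * N s) w"
proof (rule fps_ext)
  fix n
  have "{s \<in> S. M * N s = n} = (if M dvd n then {s\<in>S. N s = n div M} else {})"
    using assms by auto
  then show "fps_stretch M (lsum S N w) $ n = lsum S (\<lambda>s. M * N s) w $ n"
    by (simp add: fps_stretch_nth[OF assms] lsum_def)
qed

text \<open>Sums graded by an auxiliary Laurent variable $z$, from which the coefficient of $z^0$ is extracted.\<close>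

definition zsum :: "'b set \<Rightarrow> ('b \<Rightarrow> nat) \<Rightarrow> ('b \<Rightarrow> 'a::comm_ring_1) \<Rightarrow> ('b \<Rightarrow> int) \<Rightarrow> 'a fls fps" where
  "zsum S N c g = lsum S N (\<lambda>s. fls_const (c s) * fls_X_intpow (g s))"

definition ztop :: "'a::comm_ring_1 fls fps \<Rightarrow> 'a fps" where
  "ztop F = fps_map (\<lambda>x. fls_nth x 0) F"

lemma zmono_mult:
  "(fls_const a * fls_X_intpow i) * (fls_const b * fls_X_intpow j) = fls_const (a * b :: 'a::comm_ring_1) * fls_X_intpow (i + j)"
proof -
  have "(fls_const a * fls_X_intpow i) * (fls_const b * fls_X_intpow j)
      = (fls_const a * fls_const b) * (fls_X_intpow i * fls_X_intpow j)"
    by (simp only: ac_simps)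
  also have "\<dots> = fls_const (a * b) * fls_X_intpow (i + j)"
    by (simp only: fls_const_mult_const fls_X_intpow_times_fls_X_intpow)
  finally show ?thesis .
qed

lemma zsum_mult:
  assumes "finfib S N" "finfib T M"
  shows "zsum S N c g * zsum T M d k = zsum (S \<times> T) (\<lambda>(s, t). N s + M t) (\<lambda>(s, t). c s * d t) (\<lambda>(s, t). g s + k t)"
  unfolding zsum_def lsum_mult[OF assms] by (intro lsum_cong refl) (simp add: case_prod_beta zmono_mult)

lemma ztop_const_mult: "ztop (fps_map fls_const f * F) = f * ztop F"
  by (rule fps_ext) (simp add: ztop_def fps_mult_nth fls_nth_sum)

lemma ztop_euler_mult: "ztop (euler N * F) = euler N * ztop F"
  using ztop_const_mult[of "euler N" F] by simp

lemma ztop_euler_power_mult: "ztop (euler N ^ m * F) = euler N ^ m * ztop F"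
  by (induction m) (simp_all add: ztop_euler_mult mult.assoc)

lemma ztop_zsum:
  assumes "finfib S N"
  shows "ztop (zsum S N c g) = lsum {s\<in>S. g s = 0} N c"
proof (rule fps_ext)
  fix n
  have "ztop (zsum S N c g) $ n = (\<Sum>s\<in>{s\<in>S. N s = n}. if g s = 0 then c s else 0)"
    by (auto simp: ztop_def zsum_def lsum_def fls_nth_sum intro!: sum.cong)
  also have "\<dots> = (\<Sum>s\<in>{s\<in>{s\<in>S. N s = n}. g s = 0}. c s)"
    using assms by (intro sum.inter_filter[symmetric]) (auto simp: finfib_def)
  also have "{s\<in>{s\<in>S. N s = n}. g s = 0} = {s\<in>{s\<in>S. g s = 0}. N s = n}" by auto
  finally show "ztop (zsum S N c g) $ n = lsum {s\<in>S. g s = 0} N c $ n" by (simp add: lsum_def)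
qed

lemma finfib_jexp: "a \<le> N \<Longrightarrow> N > 0 \<Longrightarrow> finfib UNIV (jexp N a)"
  unfolding finfib_def
proof
  fix n assume aN: "a \<le> N" "N > 0"
  have "{k \<in> UNIV. jexp N a k = n} \<subseteq> {- int n - 1..int n + 1}"
  proof
    fix k assume "k \<in> {k \<in> UNIV. jexp N a k = n}"
    then show "k \<in> {- int n - 1..int n + 1}" using abs_le_jexp[OF aN, of k] by (simp add: abs_le_iff)
  qed
  then show "finite {k \<in> UNIV. jexp N a k = n}" by (rule finite_subset) simp
qed

text \<open>Vanishing of the total degree in z leaves the integer triples with sum 0, that is, the
  lattice A_2; the first coordinate is then eliminated.\<close>

lemma ztop_prod3:
  assumes "finfib UNIV N0" "finfib UNIV N1" "finfib UNIV N2"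
  shows "ztop (zsum UNIV N0 c0 (\<lambda>k. k) * (zsum UNIV N1 c1 (\<lambda>k. k) * zsum UNIV N2 c2 (\<lambda>k. k)))
    = lsum UNIV (\<lambda>(m, n). N0 (- m - n) + (N1 m + N2 n)) (\<lambda>(m, n). c0 (- m - n) * (c1 m * c2 n))"
proof -
  have "ztop (zsum UNIV N0 c0 (\<lambda>k. k) * (zsum UNIV N1 c1 (\<lambda>k. k) * zsum UNIV N2 c2 (\<lambda>k. k)))
     = lsum {(k, m, n). k + (m + n) = 0} (\<lambda>(k, m, n). N0 k + (N1 m + N2 n)) (\<lambda>(k, m, n). c0 k * (c1 m * c2 n))"
    by (simp add: zsum_mult ztop_zsum finfib_times[where S = UNIV and T = UNIV, simplified] assms)
       (rule lsum_cong; auto)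
  also have "\<dots> = lsum UNIV (\<lambda>(m, n). N0 (- m - n) + (N1 m + N2 n)) (\<lambda>(m, n). c0 (- m - n) * (c1 m * c2 n))"
    by (rule sym, rule lsum_reindex[where h = "\<lambda>(m, n). (- m - n, m, n)"])
       (auto intro!: bij_betw_byWitness[where f' = snd])
  finally show ?thesis .
qed

lemma ztop_prod5:
  assumes "finfib UNIV N0" "finfib UNIV N1" "finfib UNIV N2" "finfib UNIV N3" "finfib UNIV N4"
  shows "ztop (zsum UNIV N0 c0 (\<lambda>k. k) * (zsum UNIV N1 c1 (\<lambda>k. k) * (zsum UNIV N2 c2 (\<lambda>k. k)
      * (zsum UNIV N3 c3 (\<lambda>k. k) * zsum UNIV N4 c4 (\<lambda>k. k)))))
    = lsum UNIV (\<lambda>(p, q, r, s). N0 (- p - q - r - s) + (N1 p + (N2 q + (N3 r + N4 s))))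
        (\<lambda>(p, q, r, s). c0 (- p - q - r - s) * (c1 p * (c2 q * (c3 r * c4 s))))"
proof -
  have "ztop (zsum UNIV N0 c0 (\<lambda>k. k) * (zsum UNIV N1 c1 (\<lambda>k. k) * (zsum UNIV N2 c2 (\<lambda>k. k)
      * (zsum UNIV N3 c3 (\<lambda>k. k) * zsum UNIV N4 c4 (\<lambda>k. k)))))
     = lsum {(k, p, q, r, s). k + (p + (q + (r + s))) = 0} (\<lambda>(k, p, q, r, s). N0 k + (N1 p + (N2 q + (N3 r + N4 s))))
         (\<lambda>(k, p, q, r, s). c0 k * (c1 p * (c2 q * (c3 r * c4 s))))"
    by (simp add: zsum_mult ztop_zsum finfib_times[where S = UNIV and T = UNIV, simplified] assms)
       (rule lsum_cong; auto)
  also have "\<dots> = lsum UNIV (\<lambda>(p, q, r, s). N0 (- p - q - r - s) + (N1 p + (N2 q + (N3 r + N4 s))))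
        (\<lambda>(p, q, r, s). c0 (- p - q - r - s) * (c1 p * (c2 q * (c3 r * c4 s))))"
    by (rule sym, rule lsum_reindex[where h = "\<lambda>(p, q, r, s). (- p - q - r - s, p, q, r, s)"])
       (auto intro!: bij_betw_byWitness[where f' = snd])
  finally show ?thesis .
qed

section \<open>Theta series of the root lattices $A_2$ and $A_4$\<close>

lemma zsum_jacobi:
  fixes c :: "int \<Rightarrow> 'a::comm_ring_1"
  assumes "c 0 = 1" "\<And>j k. c (j + k) = c j * c k" "N > 0" "a + b = N"
  shows "zsum UNIV (jexp N a) c (\<lambda>k. d * k) =
    euler N * (fps_iprod (\<lambda>n. 1 + fps_const (fls_const (c 1) * fls_X_intpow d) * fps_X ^ (a + N * n))
             * fps_iprod (\<lambda>n. 1 + fps_const (fls_const (c (-1)) * fls_X_intpow (- d)) * fps_X ^ (b + N * n)))"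
proof -
  let ?w = "\<lambda>k. fls_const (c k) * fls_X_intpow (d * k) :: 'a fls"
  have "?w (j + k) = ?w j * ?w k" for j k
    unfolding zmono_mult assms(2) by (simp add: algebra_simps)
  moreover have "?w 0 = 1" using assms(1) by simp
  moreover have "tame (\<lambda>n. 1 + fps_const u * fps_X ^ (i + N * n))" for u :: "'a fls" and i
    using assms(3) by (intro tame_one_plus) (simp add: trans_le_add2)
  ultimately show ?thesis
    using jacobi_triple_product[of ?w N a b] assms(3,4)
    by (simp add: zsum_def fps_iprod_mult)
qed

lemma ztop_zsum_mult_index:
  assumes "a \<le> N" "N > 0" "d \<noteq> 0" "c 0 = 1"
  shows "ztop (zsum UNIV (jexp N a) c (\<lambda>k. d * k)) = 1"
proof -
  have "ztop (zsum UNIV (jexp N a) c (\<lambda>k. d * k)) = lsum {k. d * k = 0} (jexp N a) c"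
    using ztop_zsum[OF finfib_jexp[OF assms(1,2)], of c "\<lambda>k. d * k"] by simp
  also have "{k. d * k = 0} = {0}" using assms(3) by auto
  also have "lsum {0} (jexp N a) c = 1"
  proof (rule fps_ext)
    fix n
    have "{s\<in>{0}. jexp N a s = n} = (if n = 0 then {0} else {})" by (auto simp: jexp_def tri_def)
    then show "lsum {0} (jexp N a) c $ n = 1 $ n" by (simp add: lsum_def assms(4))
  qed
  finally show ?thesis .
qed

text \<open>The factors at zeta^j z multiply to 1 + z^N q^(N e), the sign being right because
  \<open>N\<close> is odd, so the product of the \<open>N\<close> theta series is a single theta
  series in z^N, whose constant term in z is 1. The constant term of the left side is a character
  sum over integer vectors with sum 0. \<open>P'\<close> serves the factors with the inverse of
  z.\<close>

lemma theta_root_product: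
  fixes z :: complex
  assumes "odd N" "z \<noteq> 0"
    and P: "\<And>u v :: complex fls fps. (\<Prod>j<N. u - fps_const (fls_const z) ^ j * v) = u ^ N - v ^ N"
    and P': "\<And>u v :: complex fls fps. (\<Prod>j<N. u - fps_const (fls_const (inverse z)) ^ j * v) = u ^ N - v ^ N"
  shows "euler N * ztop (\<Prod>j<N. zsum UNIV (jexp 1 1) (\<lambda>k. z powi (int j * k)) (\<lambda>k. k)) = euler 1 ^ N"
proof -
  have N: "N > 0" using assms(1) by (cases N) auto
  let ?Z = "fls_X_intpow :: int \<Rightarrow> complex fls"
  let ?A = "\<lambda>j n. 1 + fps_const (fls_const (z powi (int j * 1)) * ?Z 1) * fps_X ^ (1 + 1 * n)"
  let ?B = "\<lambda>j n. 1 + fps_const (fls_const (z powi (int j * (-1))) * ?Z (-1)) * fps_X ^ (0 + 1 * n)"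
  let ?E = "euler 1 :: complex fls fps"
  have step: "(\<Prod>j<N. 1 + fps_const (fls_const (y ^ j) * Y) * fps_X ^ e) = 1 + fps_const (Y ^ N) * fps_X ^ (N * e)"
    if "\<And>u v :: complex fls fps. (\<Prod>j<N. u - fps_const (fls_const y) ^ j * v) = u ^ N - v ^ N" for y Y e
  proof -
    have "(\<Prod>j<N. 1 + fps_const (fls_const (y ^ j) * Y) * fps_X ^ e)
        = (\<Prod>j<N. 1 - fps_const (fls_const y) ^ j * (- (fps_const Y * fps_X ^ e)))"
      by (intro prod.cong refl)
        (simp add: fls_const_power fps_const_power fps_const_mult[symmetric] mult.assoc del: fps_const_mult)
    also have "\<dots> = 1 ^ N - (- (fps_const Y * fps_X ^ e)) ^ N" by (rule that)
    also have "\<dots> = 1 + fps_const (Y ^ N) * fps_X ^ (N * e)"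
      using assms(1) by (simp add: power_mult_distrib power_mult[symmetric] mult.commute)
    finally show ?thesis .
  qed
  have tA: "tame (?A j)" and tB: "tame (?B j)" for j by (rule tame_one_plus; simp)+
  have "(\<Prod>j<N. zsum UNIV (jexp 1 1) (\<lambda>k. z powi (int j * k)) (\<lambda>k. k)) = (\<Prod>j<N. ?E * (fps_iprod (?A j) * fps_iprod (?B j)))"
    using assms(2) zsum_jacobi[where N = 1 and a = 1 and b = 0 and d = 1 and c = "\<lambda>k. z powi (int _ * k)"]
    by (intro prod.cong refl) (simp add: power_int_add ring_distribs)
  also have "\<dots> = ?E ^ N * (fps_iprod (\<lambda>n. \<Prod>j<N. ?A j n) * fps_iprod (\<lambda>n. \<Prod>j<N. ?B j n))"
    by (simp add: prod.distrib fps_iprod_prod tA[simplified] tB[simplified])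
  also have "(\<lambda>n. \<Prod>j<N. ?A j n) = (\<lambda>n. 1 + fps_const (fls_const 1 * ?Z (int N)) * fps_X ^ (N + N * n))"
  proof
    fix n
    show "(\<Prod>j<N. ?A j n) = 1 + fps_const (fls_const 1 * ?Z (int N)) * fps_X ^ (N + N * n)"
      using step[OF P, of "?Z 1" "Suc n"] by (simp add: fls_X_intpow_power)
  qed
  also have "(\<lambda>n. \<Prod>j<N. ?B j n) = (\<lambda>n. 1 + fps_const (fls_const 1 * ?Z (- int N)) * fps_X ^ (0 + N * n))"
  proof -
    have "z powi (int j * (-1)) = inverse z ^ j" for j
      by (simp add: power_int_minus power_inverse)
    moreover have "?Z (-1) ^ N = ?Z (- int N)" using fls_X_intpow_power[of "-1" N, where 'a = complex] by simp
    ultimately show ?thesis using step[OF P', of "?Z (-1)"] by simp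
  qed
  finally have eq: "euler N * (\<Prod>j<N. zsum UNIV (jexp 1 1) (\<lambda>k. z powi (int j * k)) (\<lambda>k. k))
      = ?E ^ N * zsum UNIV (jexp N N) (\<lambda>k. 1) (\<lambda>k. int N * k)"
    using zsum_jacobi[where N = N and a = N and b = 0 and d = "int N" and c = "\<lambda>k. 1 :: complex"] N
    by (simp add: ac_simps)
  show ?thesis
    using arg_cong[OF eq, of ztop] N
    by (simp add: ztop_euler_mult ztop_euler_power_mult ztop_zsum_mult_index)
qed

text \<open>Theta series shifted by 1/N, ..., N/N interleave: every exponent occurs in exactly one
  of them, so their product is one theta series of modulus 1. The result is E_N^N / E_1, the
  generating function of N-core partitions.\<close>

lemma theta_core_product:
  assumes N: "N > 0"
  shows "euler 1 * ztop (\<Prod>j<N. zsum UNIV (jexp N (Suc j)) (\<lambda>k. 1 :: 'a::idom) (\<lambda>k. k)) = euler N ^ N"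
proof -
  let ?Z = "fls_X_intpow :: int \<Rightarrow> 'a fls"
  let ?A = "\<lambda>n. 1 + fps_const (?Z 1) * fps_X ^ Suc n :: 'a fls fps"
  let ?B = "\<lambda>n. 1 + fps_const (?Z (-1)) * fps_X ^ n :: 'a fls fps"
  have tA: "tame ?A" and tB: "tame ?B" by (rule tame_one_plus; simp)+
  have "(\<Prod>j<N. zsum UNIV (jexp N (Suc j)) (\<lambda>k. 1 :: 'a) (\<lambda>k. k))
      = (\<Prod>j<N. euler N * (fps_iprod (\<lambda>n. ?A (N * n + j)) * fps_iprod (\<lambda>n. ?B (N * n + (N - Suc j)))))"
  proof (rule prod.cong)
    fix j assume "j \<in> {..<N}"
    then have "Suc j + (N - Suc j) = N" by simp
    from zsum_jacobi[where c = "\<lambda>k. 1 :: 'a" and d = 1, OF _ _ N this]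
    show "zsum UNIV (jexp N (Suc j)) (\<lambda>k. 1 :: 'a) (\<lambda>k. k)
      = euler N * (fps_iprod (\<lambda>n. ?A (N * n + j)) * fps_iprod (\<lambda>n. ?B (N * n + (N - Suc j))))"
      by (simp add: ac_simps)
  qed simp
  also have "\<dots> = euler N ^ N * ((\<Prod>j<N. fps_iprod (\<lambda>n. ?A (N * n + j))) * (\<Prod>j<N. fps_iprod (\<lambda>n. ?B (N * n + (N - Suc j)))))"
    by (simp add: prod.distrib)
  also have "(\<Prod>j<N. fps_iprod (\<lambda>n. ?B (N * n + (N - Suc j)))) = (\<Prod>j<N. fps_iprod (\<lambda>n. ?B (N * n + j)))"
    by (rule prod.nat_diff_reindex)
  also have "\<dots> = fps_iprod ?B" by (rule fps_iprod_residues[OF tB N])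
  also have "(\<Prod>j<N. fps_iprod (\<lambda>n. ?A (N * n + j))) = fps_iprod ?A" by (rule fps_iprod_residues[OF tA N])
  finally have "euler 1 * (\<Prod>j<N. zsum UNIV (jexp N (Suc j)) (\<lambda>k. 1 :: 'a) (\<lambda>k. k))
      = euler N ^ N * zsum UNIV (jexp 1 1) (\<lambda>k. 1) (\<lambda>k. 1 * k)"
    using zsum_jacobi[where N = 1 and a = 1 and b = 0 and d = 1 and c = "\<lambda>k. 1 :: 'a"]
    by (simp add: ac_simps)
  from arg_cong[OF this, of ztop] show ?thesis
    by (simp add: ztop_euler_mult ztop_euler_power_mult ztop_zsum_mult_index del: mult_1)
qed

text \<open>Half the norm on the root lattices $A_2$ and $A_4$ (vectors of integers with sum zero, the
  first coordinate being dropped), and five halves of the norm on the dual of $A_4$ (integer vectors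
  modulo the constant ones, normalised to have first coordinate zero).\<close>

definition hex_form :: "int \<times> int \<Rightarrow> nat" where
  "hex_form = (\<lambda>(m, n). nat (m\<^sup>2 + m * n + n\<^sup>2))"

text \<open>The hexagonal norm recentred at a hole: it is the norm of (m + 1/3, n + 1/3) minus
  1/3.\<close>

definition hex_shift_form :: "int \<times> int \<Rightarrow> nat" where
  "hex_shift_form = (\<lambda>(m, n). nat (m\<^sup>2 + m * n + n\<^sup>2 + m + n))"

definition a4_form :: "int \<times> int \<times> int \<times> int \<Rightarrow> int" where
  "a4_form = (\<lambda>(p, q, r, s). p\<^sup>2 + q\<^sup>2 + r\<^sup>2 + s\<^sup>2 + p * q + p * r + p * s + q * r + q * s + r * s)"

definition a4_dual :: "int \<times> int \<times> int \<times> int \<Rightarrow> int" where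
  "a4_dual = (\<lambda>(p, q, r, s). 2 * (p\<^sup>2 + q\<^sup>2 + r\<^sup>2 + s\<^sup>2) - p * q - p * r - p * s - q * r - q * s - r * s)"

lemma jexp_1_1_sum: "int (jexp 1 1 k) = tri k + k"
  by (simp add: int_jexp)

lemma hex_form_jexp: "jexp 1 1 (- m - n) + (jexp 1 1 m + jexp 1 1 n) = hex_form (m, n)"
proof -
  have "2 * int (jexp 1 1 (- m - n) + (jexp 1 1 m + jexp 1 1 n)) = 2 * (m\<^sup>2 + m * n + n\<^sup>2)"
    unfolding of_nat_add jexp_1_1_sum ring_distribs two_tri by (simp add: algebra_simps power2_eq_square)
  then show ?thesis by (simp add: hex_form_def)
qed

lemma af_jexp: "jexp 1 1 (- p - q - r - s) + (jexp 1 1 p + (jexp 1 1 q + (jexp 1 1 r + jexp 1 1 s))) = nat (a4_form (p, q, r, s))"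
proof -
  have "2 * int (jexp 1 1 (- p - q - r - s) + (jexp 1 1 p + (jexp 1 1 q + (jexp 1 1 r + jexp 1 1 s)))) = 2 * a4_form (p, q, r, s)"
    unfolding of_nat_add jexp_1_1_sum ring_distribs two_tri a4_form_def by (simp add: algebra_simps power2_eq_square)
  then show ?thesis by simp
qed

lemma hex_core_jexp: "jexp 3 1 (- m - n) + (jexp 3 2 m + jexp 3 3 n) = nat (3 * (m\<^sup>2 + m * n + n\<^sup>2) + m + 2 * n)"
proof -
  have "2 * int (jexp 3 1 (- m - n) + (jexp 3 2 m + jexp 3 3 n)) = 2 * (3 * (m\<^sup>2 + m * n + n\<^sup>2) + m + 2 * n)"
    using two_tri[of "- m - n"] two_tri[of m] two_tri[of n]
    by (simp add: int_jexp algebra_simps power2_eq_square)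
  then show ?thesis by simp
qed

lemma af_core_int: "int (jexp 5 1 (- p - q - r - s) + (jexp 5 2 p + (jexp 5 3 q + (jexp 5 4 r + jexp 5 5 s))))
    = 5 * a4_form (p, q, r, s) + p + 2 * q + 3 * r + 4 * s"
proof -
  have "2 * int (jexp 5 1 (- p - q - r - s) + (jexp 5 2 p + (jexp 5 3 q + (jexp 5 4 r + jexp 5 5 s))))
      = 2 * (5 * a4_form (p, q, r, s) + p + 2 * q + 3 * r + 4 * s)"
    using two_tri[of "- p - q - r - s"] two_tri[of p] two_tri[of q] two_tri[of r] two_tri[of s]
    by (simp add: int_jexp a4_form_def algebra_simps power2_eq_square)
  then show ?thesis by simp
qed

lemma af_core_pos: "5 * a4_form (p, q, r, s) + p + 2 * q + 3 * r + 4 * s \<ge> 0"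
  unfolding af_core_int[symmetric] by simp

lemma af_core_jexp: "jexp 5 1 (- p - q - r - s) + (jexp 5 2 p + (jexp 5 3 q + (jexp 5 4 r + jexp 5 5 s)))
   = nat (5 * a4_form (p, q, r, s) + p + 2 * q + 3 * r + 4 * s)"
  unfolding af_core_int[symmetric] by simp

lemma powi_eq_mod:
  fixes z :: complex
  assumes "z ^ N = 1" "N > 0" "[j = k] (mod int N)"
  shows "z powi j = z powi k"
proof -
  have z0: "z \<noteq> 0" using assms(1,2) by (auto simp: power_0_left)
  obtain d where "j = k + int N * d" using assms(3) by (metis cong_iff_lin cong_sym)
  moreover have "z powi (int N * d) = 1" using assms(1) by (simp add: power_int_mult)
  ultimately show ?thesis using z0 by (simp add: power_int_add)
qed

lemma exists_cube_root: obtains z :: complex where "1 + z + z\<^sup>2 = 0"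
proof
  show "1 + Complex (-1/2) (sqrt 3 / 2) + (Complex (-1/2) (sqrt 3 / 2))\<^sup>2 = 0"
    by (simp add: complex_eq_iff power2_eq_square)
qed

lemma exists_fifth_root: obtains z :: complex where "1 + z + z\<^sup>2 + z ^ 3 + z ^ 4 = 0"
proof
  let ?z = "cis (2 * pi / 5)"
  have "?z ^ 5 = 1" by (simp add: DeMoivre)
  then have "(?z - 1) * (1 + ?z + ?z\<^sup>2 + ?z ^ 3 + ?z ^ 4) = 0" by algebra
  moreover have "?z \<noteq> 1"
  proof
    assume "?z = 1"
    then have "cos (2 * pi / 5) = 1" by (simp add: complex_eq_iff)
    moreover have "cos (2 * pi / 5) < cos 0" by (rule cos_monotone_0_pi) auto
    ultimately show False by simp
  qed
  ultimately show "1 + ?z + ?z\<^sup>2 + ?z ^ 3 + ?z ^ 4 = 0" by simp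
qed

lemma const_root_rel:
  "fps_const (fls_const (1 + z + z\<^sup>2)) = 1 + fps_const (fls_const z) + (fps_const (fls_const z))\<^sup>2"
  "fps_const (fls_const (1 + y + y\<^sup>2 + y ^ 3 + y ^ 4)) = 1 + fps_const (fls_const y) + (fps_const (fls_const y))\<^sup>2
     + (fps_const (fls_const y)) ^ 3 + (fps_const (fls_const y)) ^ 4"
  for z y :: complex
  by (simp_all only: fls_plus_const[symmetric] fls_const_power fps_const_power[symmetric] fps_const_add[symmetric] fls_const_1 fps_const_1_eq_1)

lemma prod_cube_roots:
  fixes z u v :: "'a::idom"
  assumes "1 + z + z\<^sup>2 = 0"
  shows "(\<Prod>j<3. u - z ^ j * v) = u ^ 3 - v ^ 3"
proof -
  have "(u - v) * (u - z * v) * (u - z\<^sup>2 * v) = u ^ 3 - v ^ 3" using assms by algebra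
  then show ?thesis by (simp add: numeral_3_eq_3 power2_eq_square)
qed

lemma prod_fifth_roots:
  fixes z u v :: "'a::idom"
  assumes "1 + z + z\<^sup>2 + z ^ 3 + z ^ 4 = 0"
  shows "(\<Prod>j<5. u - z ^ j * v) = u ^ 5 - v ^ 5"
proof -
  have "(u - v) * (u - z * v) * (u - z\<^sup>2 * v) * (u - z ^ 3 * v) * (u - z ^ 4 * v) = u ^ 5 - v ^ 5"
    using assms by algebra
  moreover have "{..<5::nat} = {0, 1, 2, 3, 4}" by auto
  ultimately show ?thesis by (simp add: mult.assoc)
qed

lemma cube_root_facts:
  fixes z :: "'a::field"
  assumes "1 + z + z\<^sup>2 = 0"
  shows "z ^ 3 = 1" "z \<noteq> 0" "1 + inverse z + (inverse z)\<^sup>2 = 0"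
proof -
  show c: "z ^ 3 = 1" using assms by algebra
  then show "z \<noteq> 0" by auto
  have "z * z\<^sup>2 = 1" using c by (simp add: numeral_3_eq_3 power2_eq_square)
  then have "inverse z = z\<^sup>2" by (rule inverse_unique)
  then show "1 + inverse z + (inverse z)\<^sup>2 = 0" using assms c by algebra
qed

lemma fifth_root_facts:
  fixes z :: "'a::field"
  assumes "1 + z + z\<^sup>2 + z ^ 3 + z ^ 4 = 0"
  shows "z ^ 5 = 1" "z \<noteq> 0" "1 + inverse z + (inverse z)\<^sup>2 + (inverse z) ^ 3 + (inverse z) ^ 4 = 0"
proof -
  show c: "z ^ 5 = 1" using assms by algebra
  then show "z \<noteq> 0" by auto
  have "z * z ^ 4 = z ^ 5" by (simp flip: power_Suc)
  then have "z * z ^ 4 = 1" using c by simp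
  then have "inverse z = z ^ 4" by (rule inverse_unique)
  then show "1 + inverse z + (inverse z)\<^sup>2 + (inverse z) ^ 3 + (inverse z) ^ 4 = 0" using assms c by algebra
qed

lemma hex_root:
  fixes z :: complex
  assumes "1 + z + z\<^sup>2 = 0"
  shows "euler 3 * lsum UNIV hex_form (\<lambda>(m, n). z powi (m + 2 * n)) = euler 1 ^ 3"
proof -
  note f = cube_root_facts[OF assms]
  have r: "1 + fps_const (fls_const y) + (fps_const (fls_const y))\<^sup>2 = 0" if "1 + y + y\<^sup>2 = 0" for y :: complex
    using const_root_rel(1)[of y] that by simp
  let ?t = "\<lambda>j. zsum UNIV (jexp 1 1) (\<lambda>k. z powi (int j * k)) (\<lambda>k. k)"
  have "euler 3 * ztop (\<Prod>j<3. ?t j) = euler 1 ^ 3"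
    using prod_cube_roots[OF r] assms f by (intro theta_root_product) auto
  also have "(\<Prod>j<3. ?t j) = ?t 0 * (?t 1 * ?t 2)"
    by (simp add: numeral_3_eq_3 numeral_2_eq_2 mult.assoc)
  also have "ztop \<dots> = lsum UNIV hex_form (\<lambda>(m, n). z powi (m + 2 * n))"
    using f(2) by (subst ztop_prod3)
      (auto intro!: finfib_jexp lsum_cong simp: hex_form_jexp[simplified] power_int_add)
  finally show ?thesis .
qed

lemma af_root:
  fixes z :: complex
  assumes "1 + z + z\<^sup>2 + z ^ 3 + z ^ 4 = 0"
  shows "euler 5 * lsum UNIV (nat \<circ> a4_form) (\<lambda>(p, q, r, s). z powi (p + 2 * q + 3 * r + 4 * s)) = euler 1 ^ 5"
proof -
  note f = fifth_root_facts[OF assms]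
  have r: "1 + fps_const (fls_const y) + (fps_const (fls_const y))\<^sup>2 + (fps_const (fls_const y)) ^ 3 + (fps_const (fls_const y)) ^ 4 = 0"
    if "1 + y + y\<^sup>2 + y ^ 3 + y ^ 4 = 0" for y :: complex
    using const_root_rel(2)[of y] that by simp
  let ?t = "\<lambda>j. zsum UNIV (jexp 1 1) (\<lambda>k. z powi (int j * k)) (\<lambda>k. k)"
  have "euler 5 * ztop (\<Prod>j<5. ?t j) = euler 1 ^ 5"
    using prod_fifth_roots[OF r] assms f by (intro theta_root_product) auto
  also have "(\<Prod>j<5. ?t j) = ?t 0 * (?t 1 * (?t 2 * (?t 3 * ?t 4)))"
  proof -
    have "{..<5::nat} = {0, 1, 2, 3, 4}" by auto
    then show ?thesis by simp
  qed
  also have "ztop \<dots> = lsum UNIV (nat \<circ> a4_form) (\<lambda>(p, q, r, s). z powi (p + 2 * q + 3 * r + 4 * s))"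
    using f(2) by (subst ztop_prod5)
      (auto intro!: finfib_jexp lsum_cong simp: af_jexp[simplified] power_int_add)
  finally show ?thesis .
qed

lemma hex_core:
  "euler 1 * lsum UNIV (\<lambda>(m, n). nat (3 * (m\<^sup>2 + m * n + n\<^sup>2) + m + 2 * n)) (\<lambda>_. 1 :: 'a::idom) = euler 3 ^ 3"
proof -
  let ?t = "\<lambda>j. zsum UNIV (jexp 3 (Suc j)) (\<lambda>k. 1 :: 'a) (\<lambda>k. k)"
  have "euler 1 * ztop (\<Prod>j<3. ?t j) = euler 3 ^ 3" by (rule theta_core_product) simp
  also have "(\<Prod>j<3. ?t j) = ?t 0 * (?t 1 * ?t 2)"
    by (simp add: numeral_3_eq_3 numeral_2_eq_2 mult.assoc)
  also have "ztop \<dots> = lsum UNIV (\<lambda>(m, n). nat (3 * (m\<^sup>2 + m * n + n\<^sup>2) + m + 2 * n)) (\<lambda>_. 1)"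
    using hex_core_jexp by (subst ztop_prod3)
      (auto intro!: finfib_jexp lsum_cong simp: numeral_3_eq_3 numeral_2_eq_2)
  finally show ?thesis .
qed

lemma af_core:
  "euler 1 * lsum UNIV (\<lambda>(p, q, r, s). nat (5 * a4_form (p, q, r, s) + p + 2 * q + 3 * r + 4 * s)) (\<lambda>_. 1 :: 'a::idom) = euler 5 ^ 5"
proof -
  let ?t = "\<lambda>j. zsum UNIV (jexp 5 (Suc j)) (\<lambda>k. 1 :: 'a) (\<lambda>k. k)"
  have "euler 1 * ztop (\<Prod>j<5. ?t j) = euler 5 ^ 5" by (rule theta_core_product) simp
  also have "(\<Prod>j<5. ?t j) = zsum UNIV (jexp 5 1) (\<lambda>k. 1) (\<lambda>k. k) * (zsum UNIV (jexp 5 2) (\<lambda>k. 1) (\<lambda>k. k)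
    * (zsum UNIV (jexp 5 3) (\<lambda>k. 1) (\<lambda>k. k) * (zsum UNIV (jexp 5 4) (\<lambda>k. 1) (\<lambda>k. k) * zsum UNIV (jexp 5 5) (\<lambda>k. 1) (\<lambda>k. k))))"
  proof -
    have "{..<5::nat} = {0, 1, 2, 3, 4}" by auto
    then show ?thesis by (simp add: eval_nat_numeral)
  qed
  also have "ztop \<dots> = lsum UNIV (\<lambda>(p, q, r, s). nat (5 * a4_form (p, q, r, s) + p + 2 * q + 3 * r + 4 * s)) (\<lambda>_. 1)"
    by (subst ztop_prod5) (auto intro!: finfib_jexp lsum_cong simp: af_core_jexp[simplified])
  finally show ?thesis .
qed

section \<open>Theta series of A_2 split modulo 3\<close>

abbreviation lcount :: "'b set \<Rightarrow> ('b \<Rightarrow> nat) \<Rightarrow> int fps" where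
  "lcount S N \<equiv> lsum S N (\<lambda>_. 1)"

lemma lcount_reindex:
  assumes "bij_betw h S T" "\<And>s. s \<in> S \<Longrightarrow> M (h s) = N s"
  shows "lcount S N = lcount T M"
  using assms by (intro lsum_reindex[where h = h]) auto

lemma lsum_by_class:
  assumes "finfib S N" "finite I" "\<And>s. s \<in> S \<Longrightarrow> c s \<in> I"
  shows "lsum S N w = (\<Sum>k\<in>I. lsum {s\<in>S. c s = k} N w)"
proof -
  have "S = (\<Union>k\<in>I. {s\<in>S. c s = k})" using assms(3) by auto
  then have "lsum S N w = lsum (\<Union>k\<in>I. {s\<in>S. c s = k}) N w" by simp
  also have "\<dots> = (\<Sum>k\<in>I. lsum {s\<in>S. c s = k} N w)"
    using assms by (intro lsum_UNION) (auto simp: disjoint_family_on_def intro: finfib_subset)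
  finally show ?thesis .
qed

lemma mod_linear:
  fixes x y z c m :: int
  assumes "x = c * y + m * z"
  shows "x mod m = c * (y mod m) mod m"
  unfolding assms by (simp add: mod_mult_right_eq)

lemma abs_le_square: "\<bar>x :: int\<bar> \<le> x\<^sup>2"
proof (cases "x = 0")
  case False
  then have "\<bar>x\<bar> * 1 \<le> \<bar>x\<bar> * \<bar>x\<bar>" by (intro mult_left_mono) auto
  then show ?thesis by (simp add: power2_eq_square)
qed simp

lemma finfib_hex_form: "finfib UNIV hex_form"
  unfolding finfib_def
proof
  fix k
  have "{p \<in> UNIV. hex_form p = k} \<subseteq> {- 4 * int k..4 * int k} \<times> {- 4 * int k..4 * int k}"
  proof
    fix p assume "p \<in> {p \<in> UNIV. hex_form p = k}"
    then obtain m n where p: "p = (m, n)" and k: "nat (m\<^sup>2 + m * n + n\<^sup>2) = k"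
      by (cases p) (auto simp: hex_form_def)
    have sq: "4 * (m\<^sup>2 + m * n + n\<^sup>2) = (2 * m + n)\<^sup>2 + 3 * n\<^sup>2" "4 * (m\<^sup>2 + m * n + n\<^sup>2) = (m + 2 * n)\<^sup>2 + 3 * m\<^sup>2"
      by (simp_all add: algebra_simps power2_eq_square)
    have "m\<^sup>2 + m * n + n\<^sup>2 \<le> int k" using k by auto
    with sq have "(2 * m + n)\<^sup>2 + 3 * n\<^sup>2 \<le> 4 * int k" "(m + 2 * n)\<^sup>2 + 3 * m\<^sup>2 \<le> 4 * int k"
      by auto
    then have "3 * n\<^sup>2 \<le> 4 * int k" "3 * m\<^sup>2 \<le> 4 * int k"
      using zero_le_power2[of "2 * m + n"] zero_le_power2[of "m + 2 * n"] by (linarith, linarith)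
    then have "3 * \<bar>m\<bar> \<le> 4 * int k" "3 * \<bar>n\<bar> \<le> 4 * int k"
      using abs_le_square[of m] abs_le_square[of n] by auto
    then show "p \<in> {- 4 * int k..4 * int k} \<times> {- 4 * int k..4 * int k}" unfolding p by auto
  qed
  then show "finite {p \<in> UNIV. hex_form p = k}" by (rule finite_subset) simp
qed

lemma finfib_box4:
  assumes "\<And>p q r s. 2 * f (p, q, r, s) \<ge> p\<^sup>2 + q\<^sup>2 + r\<^sup>2 + s\<^sup>2"
  shows "finfib UNIV (nat \<circ> (f :: int \<times> int \<times> int \<times> int \<Rightarrow> int))"
  unfolding finfib_def
proof
  fix k
  let ?I = "{- 2 * int k..2 * int k}"
  have "{v \<in> UNIV. (nat \<circ> f) v = k} \<subseteq> ?I \<times> ?I \<times> ?I \<times> ?I"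
  proof
    fix v assume "v \<in> {v \<in> UNIV. (nat \<circ> f) v = k}"
    then obtain p q r s where v: "v = (p, q, r, s)" and k: "nat (f (p, q, r, s)) = k"
      by (cases v) auto
    have "f (p, q, r, s) \<le> int k" using k by auto
    then have "p\<^sup>2 + q\<^sup>2 + r\<^sup>2 + s\<^sup>2 \<le> 2 * int k" using assms[of p q r s] by auto
    then have "\<bar>p\<bar> \<le> 2 * int k" "\<bar>q\<bar> \<le> 2 * int k" "\<bar>r\<bar> \<le> 2 * int k" "\<bar>s\<bar> \<le> 2 * int k"
      using abs_le_square[of p] abs_le_square[of q] abs_le_square[of r] abs_le_square[of s] by auto
    then show "v \<in> ?I \<times> ?I \<times> ?I \<times> ?I" unfolding v by auto
  qed
  then show "finite {v \<in> UNIV. (nat \<circ> f) v = k}" by (rule finite_subset) simp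
qed

lemma finfib_af: "finfib UNIV (nat \<circ> a4_form)"
proof (rule finfib_box4)
  fix p q r s
  have "2 * a4_form (p, q, r, s) = p\<^sup>2 + q\<^sup>2 + r\<^sup>2 + s\<^sup>2 + (p + q + r + s)\<^sup>2"
    by (simp add: a4_form_def algebra_simps power2_eq_square)
  then show "2 * a4_form (p, q, r, s) \<ge> p\<^sup>2 + q\<^sup>2 + r\<^sup>2 + s\<^sup>2" by simp
qed

lemma finfib_adual: "finfib UNIV (nat \<circ> a4_dual)"
proof (rule finfib_box4)
  fix p q r s
  have "2 * a4_dual (p, q, r, s) = p\<^sup>2 + q\<^sup>2 + r\<^sup>2 + s\<^sup>2 + ((p - q)\<^sup>2 + (p - r)\<^sup>2 + (p - s)\<^sup>2 + (q - r)\<^sup>2 + (q - s)\<^sup>2 + (r - s)\<^sup>2)"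
    by (simp add: a4_dual_def algebra_simps power2_eq_square)
  moreover have "(p - q)\<^sup>2 + (p - r)\<^sup>2 + (p - s)\<^sup>2 + (q - r)\<^sup>2 + (q - s)\<^sup>2 + (r - s)\<^sup>2 \<ge> 0" by simp
  ultimately show "2 * a4_dual (p, q, r, s) \<ge> p\<^sup>2 + q\<^sup>2 + r\<^sup>2 + s\<^sup>2" by linarith
qed

text \<open>Since m^2 + mn + n^2 is (m - n)^2 modulo 3, splitting by this residue is also the
  3-dissection of the theta series; since m + 2n is m - n modulo 3, it is the residue on which the
  character in \<open>hex_root\<close> depends.\<close>

definition hex_coset :: "int \<Rightarrow> (int \<times> int) set" where
  "hex_coset k = {(m, n). (m - n) mod 3 = k}"

definition hex_theta :: "int fps" where "hex_theta = lcount UNIV hex_form"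
definition hex_class :: "int \<Rightarrow> int fps" where "hex_class k = lcount (hex_coset k) hex_form"

lemma hex_class_2: "hex_class 2 = hex_class 1"
  unfolding hex_class_def
proof (rule lcount_reindex[where h = "\<lambda>(m, n). (n, m)"])
  show "bij_betw (\<lambda>(m, n). (n, m)) (hex_coset 2) (hex_coset 1)"
    by (rule bij_betw_byWitness[where f' = "\<lambda>(m, n). (n, m)"]; auto simp: hex_coset_def; presburger)
qed (auto simp: hex_form_def algebra_simps)

lemma three_classes: "(k :: int) mod 3 \<in> {0, 1, 2}"
  by simp presburger

lemma hex_theta_split: "hex_theta = hex_class 0 + 2 * hex_class 1"
proof -
  have "hex_theta = (\<Sum>k\<in>{0, 1, 2}. lcount {p\<in>UNIV. (\<lambda>(m, n). (m - n) mod 3) p = k} hex_form)"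
    unfolding hex_theta_def by (rule lsum_by_class[OF finfib_hex_form]) (use three_classes in auto)
  also have "\<dots> = (\<Sum>k\<in>{0, 1, 2}. hex_class k)"
    by (simp add: hex_class_def hex_coset_def case_prod_unfold)
  finally show ?thesis by (simp add: hex_class_2)
qed

text \<open>Up to a reflection the map is multiplication by the square root of -3 in the Eisenstein
  integers, which triples the norm.\<close>

lemma hex_class_0: "hex_class 0 = fps_stretch 3 hex_theta"
proof -
  have "fps_stretch 3 hex_theta = lcount UNIV (\<lambda>s. 3 * hex_form s)"
    by (simp add: hex_theta_def lsum_stretch)
  also have "\<dots> = hex_class 0" unfolding hex_class_def
  proof (rule lcount_reindex[where h = "\<lambda>(k, j). (k + 2 * j, k - j)"])
    show "bij_betw (\<lambda>(k :: int, j). (k + 2 * j, k - j)) UNIV (hex_coset 0)"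
      by (rule bij_betw_byWitness[where f' = "\<lambda>(m, n). (n + (m - n) div 3, (m - n) div 3)"]; auto simp: hex_coset_def; presburger)
    fix p :: "int \<times> int"
    obtain k j where p: "p = (k, j)" by force
    have "(k + 2 * j)\<^sup>2 + (k + 2 * j) * (k - j) + (k - j)\<^sup>2 = 3 * (k\<^sup>2 + k * j + j\<^sup>2)"
      by (simp add: algebra_simps power2_eq_square)
    then show "hex_form (case p of (k, j) \<Rightarrow> (k + 2 * j, k - j)) = 3 * hex_form p"
      unfolding p hex_form_def by (simp add: nat_mult_distrib)
  qed
  finally show ?thesis ..
qed

lemma hexg_pos: "m\<^sup>2 + m * n + n\<^sup>2 + m + n \<ge> (0 :: int)"
proof -
  have "0 \<le> (m + n + 1)\<^sup>2 + m\<^sup>2 + n\<^sup>2" by simp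
  also have "\<dots> = 2 * (m\<^sup>2 + m * n + n\<^sup>2 + m + n) + 1" by (simp add: algebra_simps power2_eq_square)
  finally have "0 \<le> 2 * E + 1" if "E = m\<^sup>2 + m * n + n\<^sup>2 + m + n" for E using that by simp
  then have "0 \<le> E" if "E = m\<^sup>2 + m * n + n\<^sup>2 + m + n" for E using that by fastforce
  then show ?thesis by simp
qed

lemma hex_class_1_hexg: "hex_class 1 = fps_X * fps_stretch 3 (lcount UNIV hex_shift_form)"
proof -
  have "fps_X * fps_stretch 3 (lcount UNIV hex_shift_form) = lcount UNIV (\<lambda>s. 3 * hex_shift_form s + 1)"
    using lsum_shift[of 1 UNIV "\<lambda>s. 3 * hex_shift_form s" "\<lambda>_. 1 :: int"] by (simp add: lsum_stretch)
  also have "\<dots> = hex_class 1" unfolding hex_class_def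
  proof (rule lcount_reindex[where h = "\<lambda>(k, j). (k + 2 * j + 1, k - j)"])
    show "bij_betw (\<lambda>(k :: int, j). (k + 2 * j + 1, k - j)) UNIV (hex_coset 1)"
      by (rule bij_betw_byWitness[where f' = "\<lambda>(m, n). (n + (m - n) div 3, (m - n) div 3)"]; auto simp: hex_coset_def; presburger)
    fix p :: "int \<times> int"
    obtain k j where p: "p = (k, j)" by force
    have "(k + 2 * j + 1)\<^sup>2 + (k + 2 * j + 1) * (k - j) + (k - j)\<^sup>2 = 3 * (k\<^sup>2 + k * j + j\<^sup>2 + k + j) + 1"
      by (simp add: algebra_simps power2_eq_square)
    then show "hex_form (case p of (k, j) \<Rightarrow> (k + 2 * j + 1, k - j)) = 3 * hex_shift_form p + 1"
      unfolding p hex_form_def hex_shift_form_def using hexg_pos[of k j] by (simp add: nat_add_distrib nat_mult_distrib)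
  qed
  finally show ?thesis ..
qed

lemma finfib_hexg: "finfib UNIV hex_shift_form"
proof -
  have inj: "inj (\<lambda>(k :: int, j :: int). (k + 2 * j + 1, k - j))" by (auto intro!: injI)
  show ?thesis unfolding finfib_def
  proof
    fix n
    have "(\<lambda>(k :: int, j :: int). (k + 2 * j + 1, k - j)) ` {p \<in> UNIV. hex_shift_form p = n} \<subseteq> {p \<in> UNIV. hex_form p = 3 * n + 1}"
    proof clarify
      fix k j
      assume "n = hex_shift_form (k, j)"
      moreover have "(k + 2 * j + 1)\<^sup>2 + (k + 2 * j + 1) * (k - j) + (k - j)\<^sup>2 = 3 * (k\<^sup>2 + k * j + j\<^sup>2 + k + j) + 1"
        by (simp add: algebra_simps power2_eq_square)
      ultimately show "(k + 2 * j + 1, k - j) \<in> UNIV \<and> hex_form (k + 2 * j + 1, k - j) = 3 * hex_shift_form (k, j) + 1"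
        unfolding hex_form_def hex_shift_form_def using hexg_pos[of k j] by (simp add: nat_add_distrib nat_mult_distrib)
    qed
    moreover have "finite {p \<in> UNIV. hex_form p = 3 * n + 1}" using finfib_hex_form unfolding finfib_def by blast
    ultimately have "finite ((\<lambda>(k :: int, j :: int). (k + 2 * j + 1, k - j)) ` {p \<in> UNIV. hex_shift_form p = n})"
      by (rule finite_subset)
    then show "finite {p \<in> UNIV. hex_shift_form p = n}"
      by (rule finite_imageD) (rule inj_on_subset[OF inj subset_UNIV])
  qed
qed

text \<open>The symmetries of the triangle around the hole at (-1/3, -1/3) preserve the shifted form
  and permute the three classes, hence the factor 3. The class 0 carries the 3-core form.\<close>

lemma hexg_core: "lcount UNIV hex_shift_form = 3 * lcount UNIV (\<lambda>(m, n). nat (3 * (m\<^sup>2 + m * n + n\<^sup>2) + m + 2 * n))"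
proof -
  let ?K = "lcount UNIV (\<lambda>(m, n). nat (3 * (m\<^sup>2 + m * n + n\<^sup>2) + m + 2 * n))"
  let ?C = "\<lambda>k. lcount (hex_coset k) hex_shift_form"
  have "lcount UNIV hex_shift_form = (\<Sum>k\<in>{0, 1, 2}. lcount {p\<in>UNIV. (\<lambda>(m, n). (m - n) mod 3) p = k} hex_shift_form)"
    by (rule lsum_by_class[OF finfib_hexg]) (use three_classes in auto)
  also have "\<dots> = (\<Sum>k\<in>{0, 1, 2}. ?C k)"
    by (simp add: hex_coset_def case_prod_unfold)
  finally have split: "lcount UNIV hex_shift_form = ?C 0 + ?C 1 + ?C 2" by simp
  have C0: "?K = ?C 0"
  proof (rule lcount_reindex[where h = "\<lambda>(j, k). (k - j + 3 * j, k - j)"])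
    show "bij_betw (\<lambda>(j :: int, k). (k - j + 3 * j, k - j)) UNIV (hex_coset 0)"
      by (rule bij_betw_byWitness[where f' = "\<lambda>(m, n). ((m - n) div 3, n + (m - n) div 3)"]; auto simp: hex_coset_def; presburger)
  qed (auto simp: hex_shift_form_def algebra_simps power2_eq_square)
  have C1: "?K = ?C 1"
  proof (rule lcount_reindex[where h = "\<lambda>(j, k). (k - j, - j - 2 * k - 1)"])
    show "bij_betw (\<lambda>(j :: int, k). (k - j, - j - 2 * k - 1)) UNIV (hex_coset 1)"
      by (rule bij_betw_byWitness[where f' = "\<lambda>(m, n). ((m - n) div 3 - m, (m - n) div 3)"]; auto simp: hex_coset_def; presburger)
  qed (auto simp: hex_shift_form_def algebra_simps power2_eq_square)
  have C2: "?C 1 = ?C 2"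
  proof (rule lcount_reindex[where h = "\<lambda>(m, n). (n, m)"])
    show "bij_betw (\<lambda>(m, n). (n, m)) (hex_coset 1) (hex_coset 2)"
      by (rule bij_betw_byWitness[where f' = "\<lambda>(m, n). (n, m)"]; auto simp: hex_coset_def; presburger)
  qed (auto simp: hex_shift_form_def algebra_simps)
  show ?thesis using split C0 C1 C2 by simp
qed

text \<open>In the Borweins' notation this class is c(q^3), so that a(q) = a(q^3) + 2
  c(q^3).\<close>

lemma hex_class_1: "euler 3 * hex_class 1 = 3 * fps_X * euler 9 ^ 3"
proof -
  have "euler 1 * lcount UNIV hex_shift_form = 3 * euler 3 ^ 3"
    using hex_core[where 'a = int] unfolding hexg_core by (simp add: mult.left_commute)
  from arg_cong[OF this, of "fps_stretch 3"]
  have "euler 3 * fps_stretch 3 (lcount UNIV hex_shift_form) = 3 * euler 9 ^ 3"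
    by (simp add: fps_stretch_mult fps_stretch_power fps_stretch_euler fps_stretch_numeral)
  then show ?thesis unfolding hex_class_1_hexg by (simp add: mult.left_commute mult.assoc)
qed

text \<open>A point of class \<open>k\<close> gets the weight zeta^k. The classes 1 and 2 have equal
  series and zeta + zeta^2 = -1, so the character sum is the difference, which
  \<open>hex_root\<close> evaluates as the Borweins' b = E_1^3 / E_3.\<close>

lemma hex_class_diff: "euler 3 * (hex_class 0 - hex_class 1) = euler 1 ^ 3"
proof -
  obtain z :: complex where z: "1 + z + z\<^sup>2 = 0" by (rule exists_cube_root)
  note f = cube_root_facts[OF z]
  let ?w = "\<lambda>(m, n). z powi (m + 2 * n)"
  have "lsum UNIV hex_form ?w = (\<Sum>k\<in>{0, 1, 2}. lsum {p\<in>UNIV. (\<lambda>(m, n). (m - n) mod 3) p = k} hex_form ?w)"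
    by (rule lsum_by_class[OF finfib_hex_form]) (use three_classes in auto)
  also have "\<dots> = (\<Sum>k\<in>{0, 1, 2}. fps_const (z powi k) * fps_map of_int (hex_class k))"
  proof (rule sum.cong)
    fix k :: int assume k: "k \<in> {0, 1, 2}"
    have "z powi (m + 2 * n) = z powi k" if "(m - n) mod 3 = k" for m n
    proof (rule powi_eq_mod[OF f(1)])
      have "(m + 2 * n) mod 3 = k mod 3" using mod_linear[of "m + 2 * n" 1 "m - n" 3 n] that by simp
      then show "[m + 2 * n = k] (mod int 3)" by (simp add: cong_def)
    qed simp
    then show "lsum {p\<in>UNIV. (\<lambda>(m, n). (m - n) mod 3) p = k} hex_form ?w = fps_const (z powi k) * fps_map of_int (hex_class k)"
      unfolding hex_class_def of_int_hom.map_lsum lsum_cmult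
      by (intro lsum_cong) (auto simp: hex_coset_def)
  qed simp
  also have "\<dots> = fps_map of_int (hex_class 0) + fps_const (z + z\<^sup>2) * fps_map of_int (hex_class 1)"
    by (simp add: hex_class_2 distrib_right fps_const_add[symmetric] del: fps_const_add)
  also have "z + z\<^sup>2 = -1" using z by (simp add: add.assoc add_eq_0_iff)
  also have "fps_map of_int (hex_class 0) + fps_const (-1) * fps_map of_int (hex_class 1) = fps_map (of_int :: int \<Rightarrow> complex) (hex_class 0 - hex_class 1)"
    by (rule fps_ext) simp
  finally have "fps_map (of_int :: int \<Rightarrow> complex) (euler 3 * (hex_class 0 - hex_class 1)) = fps_map of_int (euler 1 ^ 3)"
    using hex_root[OF z] by (simp add: of_int_hom.map_mult of_int_hom.map_power)
  then show ?thesis by (rule fps_map_of_int_inj)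
qed

section \<open>Theta series of A_4 and of its dual, split modulo 5\<close>

definition a4_coset :: "int \<Rightarrow> (int \<times> int \<times> int \<times> int) set" where
  "a4_coset k = {(p, q, r, s). (p + 2 * q + 3 * r + 4 * s) mod 5 = k}"

text \<open>The class in the quotient of the dual by A_4, a cyclic group of order 5. As
  \<open>a4_dual\<close> is 2 (p + q + r + s)^2 modulo 5, the classes 0, \<plusminus>1 and
  \<plusminus>2 carry the exponents 0, 2 and 3 modulo 5: the split into them is a
  5-dissection.\<close>

definition a4_dual_coset :: "int \<Rightarrow> (int \<times> int \<times> int \<times> int) set" where
  "a4_dual_coset k = {(p, q, r, s). (p + q + r + s) mod 5 = k}"

definition a4_class :: "int \<Rightarrow> int fps" where "a4_class k = lcount (a4_coset k) (nat \<circ> a4_form)"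
definition a4_dual_class :: "int \<Rightarrow> int fps" where "a4_dual_class k = lcount (a4_dual_coset k) (nat \<circ> a4_dual)"

lemma five_classes: "(k :: int) mod 5 \<in> {0, 1, 2, 3, 4}"
  by simp presburger

lemma mod_decomp:
  fixes x m k :: int
  assumes "x mod m = k"
  obtains u where "x = m * u + k"
  using assms mult_div_mod_eq[of m x] by metis

text \<open>Moving coordinate x_i to place 2i modulo 5 keeps the norm and doubles the sum of all i
  x_i. As 2 generates the units modulo 5, the four nonzero classes have the same series.\<close>

lemma af_class_double:
  assumes "k \<in> {0, 1, 2, 3, 4}"
  shows "a4_class k = a4_class (2 * k mod 5)"
  unfolding a4_class_def
proof (rule lcount_reindex[where h = "\<lambda>(p, q, r, s). (r, p, s, q)"])
  show "bij_betw (\<lambda>(p, q, r, s). (r, p, s, q)) (a4_coset k) (a4_coset (2 * k mod 5))"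
  proof (rule bij_betw_byWitness[where f' = "\<lambda>(p, q, r, s). (q, s, p, r)"])
    show "(\<lambda>(p, q, r, s). (r, p, s, q)) ` a4_coset k \<subseteq> a4_coset (2 * k mod 5)"
    proof (rule image_subsetI)
      fix v assume "v \<in> a4_coset k"
      then obtain p q r s where v: "v = (p, q, r, s)" and m: "(p + 2 * q + 3 * r + 4 * s) mod 5 = k"
        by (auto simp: a4_coset_def)
      have "(r + 2 * p + 3 * s + 4 * q) mod 5 = 2 * ((p + 2 * q + 3 * r + 4 * s) mod 5) mod 5"
        by (rule mod_linear[where z = "- r - s"]) simp
      also have "\<dots> = 2 * k mod 5" unfolding m using assms by auto
      finally show "(case v of (p, q, r, s) \<Rightarrow> (r, p, s, q)) \<in> a4_coset (2 * k mod 5)"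
        unfolding v a4_coset_def prod.case mem_Collect_eq .
    qed
    show "(\<lambda>(p, q, r, s). (q, s, p, r)) ` a4_coset (2 * k mod 5) \<subseteq> a4_coset k"
    proof (rule image_subsetI)
      fix v assume "v \<in> a4_coset (2 * k mod 5)"
      then obtain p q r s where v: "v = (p, q, r, s)" and m: "(p + 2 * q + 3 * r + 4 * s) mod 5 = 2 * k mod 5"
        by (auto simp: a4_coset_def)
      have "(q + 2 * s + 3 * p + 4 * r) mod 5 = 3 * ((p + 2 * q + 3 * r + 4 * s) mod 5) mod 5"
        by (rule mod_linear[where z = "- q - r - 2 * s"]) simp
      also have "\<dots> = k" unfolding m using assms by auto
      finally show "(case v of (p, q, r, s) \<Rightarrow> (q, s, p, r)) \<in> a4_coset k"
        unfolding v a4_coset_def prod.case mem_Collect_eq .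
    qed
  qed auto
qed (auto simp: a4_form_def algebra_simps)

lemma af_classes: "a4_class 2 = a4_class 1" "a4_class 4 = a4_class 1" "a4_class 3 = a4_class 1"
  using af_class_double[of 1] af_class_double[of 2] af_class_double[of 4] by simp_all

lemma dual_class_neg:
  assumes "k \<in> {1, 2, 3, 4}"
  shows "a4_dual_class k = a4_dual_class (5 - k)"
  unfolding a4_dual_class_def
proof (rule lcount_reindex[where h = "\<lambda>(p, q, r, s). (- p, - q, - r, - s)"])
  show "bij_betw (\<lambda>(p, q, r, s). (- p, - q, - r, - s)) (a4_dual_coset k) (a4_dual_coset (5 - k))"
  proof (rule bij_betw_byWitness[where f' = "\<lambda>(p, q, r, s). (- p, - q, - r, - s)"])
    show "(\<lambda>(p, q, r, s). (- p, - q, - r, - s)) ` a4_dual_coset k \<subseteq> a4_dual_coset (5 - k)"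
    proof (rule image_subsetI)
      fix v assume "v \<in> a4_dual_coset k"
      then obtain p q r s where v: "v = (p, q, r, s)" and m: "(p + q + r + s) mod 5 = k"
        by (auto simp: a4_dual_coset_def)
      have "(- p + - q + - r + - s) mod 5 = (- 1) * ((p + q + r + s) mod 5) mod 5"
        by (rule mod_linear[where z = "0"]) simp
      also have "\<dots> = 5 - k" unfolding m using assms by auto
      finally show "(case v of (p, q, r, s) \<Rightarrow> (- p, - q, - r, - s)) \<in> a4_dual_coset (5 - k)"
        unfolding v a4_dual_coset_def prod.case mem_Collect_eq .
    qed
    show "(\<lambda>(p, q, r, s). (- p, - q, - r, - s)) ` a4_dual_coset (5 - k) \<subseteq> a4_dual_coset k"
    proof (rule image_subsetI)
      fix v assume "v \<in> a4_dual_coset (5 - k)"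
      then obtain p q r s where v: "v = (p, q, r, s)" and m: "(p + q + r + s) mod 5 = 5 - k"
        by (auto simp: a4_dual_coset_def)
      have "(- p + - q + - r + - s) mod 5 = (- 1) * ((p + q + r + s) mod 5) mod 5"
        by (rule mod_linear[where z = "0"]) simp
      also have "\<dots> = k" unfolding m using assms by auto
      finally show "(case v of (p, q, r, s) \<Rightarrow> (- p, - q, - r, - s)) \<in> a4_dual_coset k"
        unfolding v a4_dual_coset_def prod.case mem_Collect_eq .
    qed
  qed auto
qed (auto simp: a4_dual_def algebra_simps)

lemma dual_classes: "a4_dual_class 4 = a4_dual_class 1" "a4_dual_class 3 = a4_dual_class 2"
  using dual_class_neg[of 1] dual_class_neg[of 2] by simp_all

lemma af_split: "lcount UNIV (nat \<circ> a4_form) = a4_class 0 + 4 * a4_class 1"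
proof -
  have "lcount UNIV (nat \<circ> a4_form) = (\<Sum>k\<in>{0, 1, 2, 3, 4}. lcount {v\<in>UNIV. (\<lambda>(p, q, r, s). (p + 2 * q + 3 * r + 4 * s) mod 5) v = k} (nat \<circ> a4_form))"
    by (rule lsum_by_class[OF finfib_af]) (use five_classes in auto)
  also have "\<dots> = (\<Sum>k\<in>{0, 1, 2, 3, 4}. a4_class k)"
    by (simp add: a4_class_def a4_coset_def case_prod_unfold)
  finally show ?thesis by (simp add: af_classes)
qed

lemma dual_split: "lcount UNIV (nat \<circ> a4_dual) = a4_dual_class 0 + 2 * a4_dual_class 1 + 2 * a4_dual_class 2"
proof -
  have "lcount UNIV (nat \<circ> a4_dual) = (\<Sum>k\<in>{0, 1, 2, 3, 4}. lcount {v\<in>UNIV. (\<lambda>(p, q, r, s). (p + q + r + s) mod 5) v = k} (nat \<circ> a4_dual))"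
    by (rule lsum_by_class[OF finfib_adual]) (use five_classes in auto)
  also have "\<dots> = (\<Sum>k\<in>{0, 1, 2, 3, 4}. a4_dual_class k)"
    by (simp add: a4_dual_class_def a4_dual_coset_def case_prod_unfold)
  finally show ?thesis by (simp add: dual_classes)
qed

text \<open>As for A_2: the four nonzero classes agree, and the nontrivial powers of zeta sum to
  -1.\<close>

lemma af_class_diff: "euler 5 * (a4_class 0 - a4_class 1) = euler 1 ^ 5"
proof -
  obtain z :: complex where z: "1 + z + z\<^sup>2 + z ^ 3 + z ^ 4 = 0" by (rule exists_fifth_root)
  note f = fifth_root_facts[OF z]
  let ?w = "\<lambda>(p, q, r, s). z powi (p + 2 * q + 3 * r + 4 * s)"
  have "lsum UNIV (nat \<circ> a4_form) ?w = (\<Sum>k\<in>{0, 1, 2, 3, 4}. lsum {v\<in>UNIV. (\<lambda>(p, q, r, s). (p + 2 * q + 3 * r + 4 * s) mod 5) v = k} (nat \<circ> a4_form) ?w)"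
    by (rule lsum_by_class[OF finfib_af]) (use five_classes in auto)
  also have "\<dots> = (\<Sum>k\<in>{0, 1, 2, 3, 4}. fps_const (z powi k) * fps_map of_int (a4_class k))"
  proof (rule sum.cong)
    fix k :: int assume k: "k \<in> {0, 1, 2, 3, 4}"
    have "z powi (p + 2 * q + 3 * r + 4 * s) = z powi k" if "(p + 2 * q + 3 * r + 4 * s) mod 5 = k" for p q r s
    proof (rule powi_eq_mod[OF f(1)])
      show "[p + 2 * q + 3 * r + 4 * s = k] (mod int 5)" using that by (auto simp: cong_def)
    qed simp
    then show "lsum {v\<in>UNIV. (\<lambda>(p, q, r, s). (p + 2 * q + 3 * r + 4 * s) mod 5) v = k} (nat \<circ> a4_form) ?w
       = fps_const (z powi k) * fps_map of_int (a4_class k)"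
      unfolding a4_class_def of_int_hom.map_lsum lsum_cmult
      by (intro lsum_cong) (auto simp: a4_coset_def)
  qed simp
  also have "\<dots> = fps_map of_int (a4_class 0) + fps_const (z + z\<^sup>2 + z ^ 3 + z ^ 4) * fps_map of_int (a4_class 1)"
    by (simp add: af_classes distrib_right fps_const_add[symmetric] del: fps_const_add)
  also have "z + z\<^sup>2 + z ^ 3 + z ^ 4 = -1" using z by (simp add: add.assoc add_eq_0_iff)
  also have "fps_map of_int (a4_class 0) + fps_const (-1) * fps_map of_int (a4_class 1) = fps_map (of_int :: int \<Rightarrow> complex) (a4_class 0 - a4_class 1)"
    by (rule fps_ext) simp
  finally have "fps_map (of_int :: int \<Rightarrow> complex) (euler 5 * (a4_class 0 - a4_class 1)) = fps_map of_int (euler 1 ^ 5)"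
    using af_root[OF z] by (simp add: comp_def of_int_hom.map_mult of_int_hom.map_power)
  then show ?thesis by (rule fps_map_of_int_inj)
qed

text \<open>The circulant matrix $C$ with first row $(1, -1, -1, 1, 0)$ satisfies $C C^T = 5 I - J$, so up
  to scaling it is an isometry on the vectors with coordinate sum $0$.  It identifies a sublattice of
  the root lattice $A_4$ with the rescaled dual lattice.\<close>

lemma af_class_0: "lcount UNIV (nat \<circ> a4_dual) = a4_class 0"
  unfolding a4_class_def
proof (rule lcount_reindex[where h = "\<lambda>(a, b, c, d). (a - b - c + d, b - c - d, c - d + a, d - a + b)"])
  let ?h = "\<lambda>(a :: int, b, c, d). (a - b - c + d, b - c - d, c - d + a, d - a + b)"
  show "bij_betw ?h UNIV (a4_coset 0)"
  proof (rule bij_betw_imageI)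
    show "inj ?h" by (rule injI) auto
    have "v \<in> range ?h" if "v \<in> a4_coset 0" for v
    proof -
      obtain p q r s where v: "v = (p, q, r, s)" by (cases v)
      have m: "(p + 2 * q + 3 * r + 4 * s) mod 5 = 0" using that v by (simp add: a4_coset_def)
      then obtain u where "p + 2 * q + 3 * r + 4 * s = 5 * u + 0" by (rule mod_decomp)
      then have p: "p = 5 * u - 2 * q - 3 * r - 4 * s" by simp
      have "v = ?h (3 * u - q - r - 2 * s, u, r + s - u, 2 * u - q - r - s)" unfolding v p by simp
      then show ?thesis by blast
    qed
    moreover have "range ?h \<subseteq> a4_coset 0" by (auto simp: a4_coset_def)
    ultimately show "range ?h = a4_coset 0" by blast
  qed
qed (auto simp: a4_form_def a4_dual_def algebra_simps power2_eq_square)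

text \<open>The class 0 is A_4 itself inside its dual. The map subtracts the eliminated coordinate -
  p - q - r - s from the other four, which normalises the representative; the factor 5 is the
  scaling in \<open>a4_dual\<close>.\<close>

lemma dual_class_0: "a4_dual_class 0 = fps_stretch 5 (lcount UNIV (nat \<circ> a4_form))"
proof -
  have "fps_stretch 5 (lcount UNIV (nat \<circ> a4_form)) = lcount UNIV (\<lambda>s. 5 * (nat \<circ> a4_form) s)"
    by (simp add: lsum_stretch)
  also have "\<dots> = a4_dual_class 0" unfolding a4_dual_class_def
  proof (rule lcount_reindex[where h = "\<lambda>(p, q, r, s). (2 * p + q + r + s, p + 2 * q + r + s, p + q + 2 * r + s, p + q + r + 2 * s)"])
    let ?h = "\<lambda>(p :: int, q, r, s). (2 * p + q + r + s, p + 2 * q + r + s, p + q + 2 * r + s, p + q + r + 2 * s)"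
    show "bij_betw ?h UNIV (a4_dual_coset 0)"
    proof (rule bij_betw_imageI)
      show "inj ?h" by (rule injI) auto
      have "v \<in> range ?h" if "v \<in> a4_dual_coset 0" for v
      proof -
        obtain a b c d where v: "v = (a, b, c, d)" by (cases v)
        have "(a + b + c + d) mod 5 = 0" using that v by (simp add: a4_dual_coset_def)
        then obtain u where "a + b + c + d = 5 * u + 0" by (rule mod_decomp)
        then have a: "a = 5 * u - b - c - d" by simp
        have "v = ?h (a - u, b - u, c - u, d - u)" unfolding v a by simp
        then show ?thesis by blast
      qed
      moreover have "(2 * p + q + r + s + (p + 2 * q + r + s) + (p + q + 2 * r + s) + (p + q + r + 2 * s)) mod 5 = 0" for p q r s :: int
        using mod_linear[of "2 * p + q + r + s + (p + 2 * q + r + s) + (p + q + 2 * r + s) + (p + q + r + 2 * s)" 0 0 5 "p + q + r + s"] by simp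
      then have "range ?h \<subseteq> a4_dual_coset 0" by (auto simp: a4_dual_coset_def simp del: mod_add_self1 mod_add_self2)
      ultimately show "range ?h = a4_dual_coset 0" by blast
    qed
    fix v :: "int \<times> int \<times> int \<times> int"
    obtain p q r s where v: "v = (p, q, r, s)" by (cases v)
    have "a4_dual (?h v) = 5 * a4_form v"
      unfolding v by (simp add: a4_form_def a4_dual_def algebra_simps power2_eq_square)
    then show "(nat \<circ> a4_dual) (?h v) = 5 * (nat \<circ> a4_form) v" by (simp add: nat_mult_distrib)
  qed
  finally show ?thesis ..
qed

text \<open>A second linear residue cuts class 2 into five parts. Cyclic rotation of the five
  coordinates keeps the class, because modulo 5 it changes the weighted sum by the coordinate sum 0,
  and it raises the second residue by 2 * 2 = 4. So the five parts have equal series, and one of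
  them carries the 5-core form.\<close>

lemma af_class_2_core:
  "a4_class 2 = 5 * fps_X * lcount UNIV (\<lambda>(p, q, r, s). nat (5 * a4_form (p, q, r, s) + p + 2 * q + 3 * r + 4 * s))"
proof -
  let ?K = "\<lambda>(p, q, r, s). nat (5 * a4_form (p, q, r, s) + p + 2 * q + 3 * r + 4 * s)"
  let ?t = "\<lambda>(p, q, r, s). (- p - 2 * r - 2 * s) mod 5 :: int"
  let ?D = "\<lambda>k. lcount {v \<in> a4_coset 2. ?t v = k} (nat \<circ> a4_form)"
  have "a4_class 2 = (\<Sum>k\<in>{0, 1, 2, 3, 4}. ?D k)"
    unfolding a4_class_def
    by (rule lsum_by_class) (use five_classes finfib_subset[OF finfib_af] in auto)
  moreover have shift: "?D k = ?D ((k + 4) mod 5)" if "k \<in> {0, 1, 2, 3, 4}" for k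
  proof (rule lcount_reindex[where h = "\<lambda>(p, q, r, s). (- p - q - r - s, p, q, r)"])
    show "bij_betw (\<lambda>(p, q, r, s). (- p - q - r - s, p, q, r)) {v \<in> a4_coset 2. ?t v = k} {v \<in> a4_coset 2. ?t v = (k + 4) mod 5}"
    proof (rule bij_betw_byWitness[where f' = "\<lambda>(p, q, r, s). (q, r, s, - p - q - r - s)"])
      have fwd: "(- p - q - r - s, p, q, r) \<in> a4_coset 2 \<and> ?t (- p - q - r - s, p, q, r) = (?t (p, q, r, s) + 4) mod 5"
        if "(p, q, r, s) \<in> a4_coset 2" for p q r s
      proof -
        have m: "(p + 2 * q + 3 * r + 4 * s) mod 5 = 2" using that by (simp add: a4_coset_def)
        have e: "(- p - q - r - s) + 2 * p + 3 * q + 4 * r = (p + 2 * q + 3 * r + 4 * s) + 5 * (- s)"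
          "- (- p - q - r - s) - 2 * q - 2 * r = ((- p - 2 * r - 2 * s) + 2 * (p + 2 * q + 3 * r + 4 * s)) + 5 * (- q - r - s)"
          by simp_all
        have "((- p - q - r - s) + 2 * p + 3 * q + 4 * r) mod 5 = 2"
          unfolding e mod_mult_self2 by (rule m)
        moreover have "(- (- p - q - r - s) - 2 * q - 2 * r) mod 5 = ((- p - 2 * r - 2 * s) + 2 * (p + 2 * q + 3 * r + 4 * s)) mod 5"
          unfolding e mod_mult_self2 ..
        moreover have "\<dots> = ((- p - 2 * r - 2 * s) mod 5 + 2 * ((p + 2 * q + 3 * r + 4 * s) mod 5) mod 5) mod 5"
          by (simp only: mod_add_eq mod_mult_right_eq)
        ultimately show ?thesis unfolding m a4_coset_def by (simp only: prod.case mem_Collect_eq) simp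
      qed
      have bwd: "(q, r, s, - p - q - r - s) \<in> a4_coset 2" if "(p, q, r, s) \<in> a4_coset 2" for p q r s
      proof -
        have e: "q + 2 * r + 3 * s + 4 * (- p - q - r - s) = (p + 2 * q + 3 * r + 4 * s) + 5 * (- p - q - r - s)" by simp
        have "(q + 2 * r + 3 * s + 4 * (- p - q - r - s)) mod 5 = (p + 2 * q + 3 * r + 4 * s) mod 5"
          unfolding e mod_mult_self2 ..
        then show ?thesis using that unfolding a4_coset_def by (simp only: prod.case mem_Collect_eq)
      qed
      have inj4: "a = k" if "(a + 4) mod 5 = (k + 4) mod 5" "a \<in> {0, 1, 2, 3, 4}" for a :: int
        using that \<open>k \<in> {0, 1, 2, 3, 4}\<close> by auto
      show "(\<lambda>(p, q, r, s). (- p - q - r - s, p, q, r)) ` {v \<in> a4_coset 2. ?t v = k} \<subseteq> {v \<in> a4_coset 2. ?t v = (k + 4) mod 5}"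
        using fwd by (auto simp del: minus_diff_eq)
      show "(\<lambda>(p, q, r, s). (q, r, s, - p - q - r - s)) ` {v \<in> a4_coset 2. ?t v = (k + 4) mod 5} \<subseteq> {v \<in> a4_coset 2. ?t v = k}"
      proof
        fix x assume "x \<in> (\<lambda>(p, q, r, s). (q, r, s, - p - q - r - s)) ` {v \<in> a4_coset 2. ?t v = (k + 4) mod 5}"
        then obtain p q r s where x: "x = (q, r, s, - p - q - r - s)" and v: "(p, q, r, s) \<in> a4_coset 2"
          and t: "(- p - 2 * r - 2 * s) mod 5 = (k + 4) mod 5" by auto
        note w = bwd[OF v]
        have "?t (p, q, r, s) = (?t (q, r, s, - p - q - r - s) + 4) mod 5"
          using fwd[OF w] by simp
        then have "?t (q, r, s, - p - q - r - s) = k" using t five_classes by (intro inj4) auto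
        with w show "x \<in> {v \<in> a4_coset 2. ?t v = k}" unfolding x by blast
      qed
    qed auto
  qed (auto simp: a4_form_def algebra_simps power2_eq_square)
  have base: "fps_X * lcount UNIV ?K = ?D 3"
  proof -
    \<comment> \<open>The linear part is a similarity of A_4 that multiplies norms by 5. With this
      translation the image has second residue 3, which is why that part is the one
      compared.\<close>
    let ?h = "\<lambda>(a, b, c, d). (a - b - c + d, - a - 2 * c - 2 * d - 1, 2 * a + b + 2 * c, 2 * b + c + 2 * d + 1) :: int \<times> int \<times> int \<times> int"
    have norm: "a4_form (?h (a, b, c, d)) = 5 * a4_form (a, b, c, d) + a + 2 * b + 3 * c + 4 * d + 1" for a b c d
      by (simp add: a4_form_def algebra_simps power2_eq_square)
    have "fps_X * lcount UNIV ?K = lcount UNIV (\<lambda>v. ?K v + 1)"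
      using lsum_shift[of 1 UNIV ?K "\<lambda>_. 1 :: int"] by simp
    also have "\<dots> = ?D 3"
    proof (rule lcount_reindex[where h = ?h])
      show "bij_betw ?h UNIV {v \<in> a4_coset 2. ?t v = 3}"
      proof (rule bij_betw_imageI)
        show "inj ?h" by (rule injI) auto
        have "v \<in> range ?h" if "v \<in> a4_coset 2" "?t v = 3" for v
        proof -
          obtain p q r s where v: "v = (p, q, r, s)" by (cases v)
          have m: "(p + 2 * q + 3 * r + 4 * s) mod 5 = 2" "(- p - 2 * r - 2 * s) mod 5 = 3"
            using that v by (simp_all add: a4_coset_def)
          from m(1) obtain u where u: "p + 2 * q + 3 * r + 4 * s = 5 * u + 2" by (rule mod_decomp)
          from m(2) obtain w where w: "- p - 2 * r - 2 * s = 5 * w + 3" by (rule mod_decomp)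
          have r: "r = 5 * (u + w + 1) - 2 * q - 2 * s" using u w by simp
          have p: "p = 4 * q + 2 * s - 10 * u - 15 * w - 13" using w unfolding r by simp
          have "v = ?h (q - 2 * u - 4 * w - 3, u + w + 1, 4 * u + 6 * w + 5 - 2 * q - s, q + s - 3 * u - 4 * w - 4)"
            unfolding v p r by simp
          then show ?thesis by blast
        qed
        moreover have "?h (a, b, c, d) \<in> {v \<in> a4_coset 2. ?t v = 3}" for a b c d
        proof -
          have "a - b - c + d + 2 * (- a - 2 * c - 2 * d - 1) + 3 * (2 * a + b + 2 * c) + 4 * (2 * b + c + 2 * d + 1) = 1 * 2 + 5 * (a + 2 * b + c + d)"
            "- (a - b - c + d) - 2 * (2 * a + b + 2 * c) - 2 * (2 * b + c + 2 * d + 1) = 1 * 3 + 5 * (- a - b - c - d - 1)"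
            by simp_all
          from this[THEN mod_linear] show ?thesis by (simp only: a4_coset_def mem_Collect_eq prod.case) simp
        qed
        then have "range ?h \<subseteq> {v \<in> a4_coset 2. ?t v = 3}" by auto
        ultimately show "range ?h = {v \<in> a4_coset 2. ?t v = 3}" by blast
      qed
      fix v :: "int \<times> int \<times> int \<times> int"
      obtain a b c d where v: "v = (a, b, c, d)" by (cases v)
      show "(nat \<circ> a4_form) (?h v) = ?K v + 1"
        using norm[of a b c d] af_core_pos[of a b c d] unfolding v by (simp add: nat_add_distrib)
    qed
    finally show ?thesis .
  qed
  ultimately show ?thesis
    using shift[of 3] shift[of 2] shift[of 1] shift[of 0] by (simp add: mult.assoc)
qed

lemma af_class_1: "euler 1 * a4_class 1 = 5 * fps_X * euler 5 ^ 5"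
proof -
  have "euler 1 * a4_class 1 = 5 * fps_X * (euler 1 * lcount UNIV (\<lambda>(p, q, r, s). nat (5 * a4_form (p, q, r, s) + p + 2 * q + 3 * r + 4 * s)))"
    using af_class_2_core by (simp add: af_classes mult.left_commute)
  then show ?thesis by (simp only: af_core)
qed

section \<open>Two gluings of the lattice $E_8$\<close>

text \<open>Half the norm on $E_8$, realised as the vectors of $(Z^5 + k/5) \<times> (Z^5 - 2k/5)$ whose two
  components have sum zero.  One coordinate of the first component is normalised to be the fractional
  shift alone, and the fifth coordinate of the second one is determined by the others.\<close>

definition e8_form :: "(int \<times> int \<times> int \<times> int) \<times> (int \<times> int \<times> int \<times> int) \<Rightarrow> int" where
  "e8_form = (\<lambda>((a, b, c, d), (p, q, r, s)).
     2 * (a\<^sup>2 + b\<^sup>2 + c\<^sup>2 + d\<^sup>2) + 3 * (a * b + a * c + a * d + b * c + b * d + c * d)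
     + 2 * (a + b + c + d) * (p + q + r + s) + a4_form (p, q, r, s))"

definition e8_theta :: "int fps" where "e8_theta = lcount UNIV (nat \<circ> e8_form)"

lemma adual_nonneg: "a4_dual v \<ge> 0"
proof -
  obtain p q r s where v: "v = (p, q, r, s)" by (cases v)
  have "2 * a4_dual (p, q, r, s) = p\<^sup>2 + q\<^sup>2 + r\<^sup>2 + s\<^sup>2 + ((p - q)\<^sup>2 + (p - r)\<^sup>2 + (p - s)\<^sup>2 + (q - r)\<^sup>2 + (q - s)\<^sup>2 + (r - s)\<^sup>2)"
    by (simp add: a4_dual_def algebra_simps power2_eq_square)
  also have "\<dots> \<ge> 0" by simp
  finally show ?thesis unfolding v by simp
qed

lemma int_hex_form: "int (hex_form (m, n)) = m\<^sup>2 + m * n + n\<^sup>2"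
proof -
  have "2 * (m\<^sup>2 + m * n + n\<^sup>2) = (m + n)\<^sup>2 + m\<^sup>2 + n\<^sup>2" by (simp add: algebra_simps power2_eq_square)
  also have "\<dots> \<ge> 0" by simp
  finally show ?thesis by (simp add: hex_form_def)
qed

definition e8_pair :: "(int \<times> int \<times> int \<times> int) \<times> (int \<times> int \<times> int \<times> int) \<Rightarrow> (int \<times> int \<times> int \<times> int) \<times> (int \<times> int \<times> int \<times> int)" where
  "e8_pair = (\<lambda>((a, b, c, d), (p, q, r, s)). ((a, b, c, d),
     (2 * (a + b + c + d) + 2 * p + q + r + s, 2 * (a + b + c + d) + p + 2 * q + r + s,
      2 * (a + b + c + d) + p + q + 2 * r + s, 2 * (a + b + c + d) + p + q + r + 2 * s)))"

text \<open>The glue code is generated by (1, -2) over the integers modulo 5. Glue norms are 2 (x^2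
  + y^2) modulo 5 and 1 + 4 = 5, so the code is isotropic.\<close>

definition dualset :: "((int \<times> int \<times> int \<times> int) \<times> (int \<times> int \<times> int \<times> int)) set" where
  "dualset = {((a, b, c, d), (p, q, r, s)). 5 dvd (p + q + r + s) + 2 * (a + b + c + d)}"

lemma e8_dual_glue: "bij_betw e8_pair UNIV dualset"
proof (rule bij_betw_imageI)
  show "inj e8_pair" by (rule injI) (auto simp: e8_pair_def)
  have "v \<in> range e8_pair" if "v \<in> dualset" for v
  proof -
    obtain a b c d p q r s where v: "v = ((a, b, c, d), (p, q, r, s))" by (metis surj_pair)
    have "5 dvd (p + q + r + s) + 2 * (a + b + c + d)" using that v by (simp add: dualset_def)
    then obtain w where "(p + q + r + s) + 2 * (a + b + c + d) = 5 * w" by (elim dvdE)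
    then have p: "p = 5 * w - q - r - s - 2 * (a + b + c + d)" by simp
    have "v = e8_pair ((a, b, c, d), (p - w, q - w, r - w, s - w))"
      unfolding v p e8_pair_def by simp
    then show ?thesis by blast
  qed
  moreover have "e8_pair x \<in> dualset" for x
  proof -
    obtain a b c d p q r s where x: "x = ((a, b, c, d), (p, q, r, s))" by (metis surj_pair)
    have "(2 * (a + b + c + d) + 2 * p + q + r + s) + (2 * (a + b + c + d) + p + 2 * q + r + s)
      + (2 * (a + b + c + d) + p + q + 2 * r + s) + (2 * (a + b + c + d) + p + q + r + 2 * s) + 2 * (a + b + c + d)
      = 5 * (2 * (a + b + c + d) + p + q + r + s)" by simp
    then show ?thesis unfolding x dualset_def e8_pair_def prod.case mem_Collect_eq by (metis dvd_triv_left)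
  qed
  ultimately show "range e8_pair = dualset" by blast
qed

lemma dual_glue_mod5:
  fixes x y :: int
  shows "5 dvd y + 2 * x \<longleftrightarrow> (x mod 5, y mod 5) \<in> {(0, 0), (1, 3), (2, 1), (3, 4), (4, 2)}"
proof -
  have "(y + 2 * x) mod 5 = (y mod 5 + 2 * (x mod 5)) mod 5"
    by (intro mod_add_cong mod_mult_cong) simp_all
  then have e: "5 dvd y + 2 * x \<longleftrightarrow> (y mod 5 + 2 * (x mod 5)) mod 5 = 0"
    by (simp only: dvd_eq_mod_eq_0)
  have "(v + 2 * u) mod 5 = 0 \<longleftrightarrow> (u, v) \<in> {(0, 0), (1, 3), (2, 1), (3, 4), (4, 2)}"
    if "u \<in> {0, 1, 2, 3, 4}" "v \<in> {0, 1, 2, 3, 4}" for u v :: int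
    using that by (elim insertE emptyE) simp_all
  note k = this[OF five_classes five_classes]
  show ?thesis unfolding e k ..
qed

text \<open>Each of the four nonzero codewords pairs a class \<plusminus>1 with a class
  \<plusminus>2, so all of them contribute the same product.\<close>

lemma e8_dual: "fps_stretch 5 e8_theta = a4_dual_class 0 ^ 2 + 4 * a4_dual_class 1 * a4_dual_class 2"
proof -
  let ?N = "\<lambda>(d, e). (nat \<circ> a4_dual) d + (nat \<circ> a4_dual) e"
  let ?I = "{(0, 0), (1, 3), (2, 1), (3, 4), (4, 2)} :: (int \<times> int) set"
  have fin: "finfib (a4_dual_coset k) (nat \<circ> a4_dual)" for k by (rule finfib_subset[OF finfib_adual]) simp
  have "fps_stretch 5 e8_theta = lcount UNIV (\<lambda>s. 5 * (nat \<circ> e8_form) s)"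
    by (simp add: e8_theta_def lsum_stretch)
  also have "\<dots> = lcount dualset ?N"
  proof (rule lcount_reindex[OF e8_dual_glue])
    fix x :: "(int \<times> int \<times> int \<times> int) \<times> (int \<times> int \<times> int \<times> int)"
    obtain a b c d p q r s where x: "x = ((a, b, c, d), (p, q, r, s))" by (metis surj_pair)
    have "a4_dual (fst (e8_pair x)) + a4_dual (snd (e8_pair x)) = 5 * e8_form x"
      unfolding x e8_pair_def prod.case fst_conv snd_conv
      by (simp add: a4_dual_def e8_form_def a4_form_def algebra_simps power2_eq_square)
    then have "nat (a4_dual (fst (e8_pair x)) + a4_dual (snd (e8_pair x))) = 5 * nat (e8_form x)"
      by (simp add: nat_mult_distrib)
    then show "?N (e8_pair x) = 5 * (nat \<circ> e8_form) x"
      using adual_nonneg by (simp add: case_prod_beta nat_add_distrib)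
  qed
  also have "dualset = (\<Union>(k, l)\<in>?I. a4_dual_coset k \<times> a4_dual_coset l)"
    unfolding dualset_def dual_glue_mod5 by (auto simp: a4_dual_coset_def)
  also have "lcount \<dots> ?N = (\<Sum>i\<in>?I. lcount (case i of (k, l) \<Rightarrow> a4_dual_coset k \<times> a4_dual_coset l) ?N)"
  proof (rule lsum_UNION)
    show "disjoint_family_on (\<lambda>(k, l). a4_dual_coset k \<times> a4_dual_coset l) ?I"
      unfolding disjoint_family_on_def by (auto simp: a4_dual_coset_def)
    show "finfib (case i of (k, l) \<Rightarrow> a4_dual_coset k \<times> a4_dual_coset l) ?N" for i
      using finfib_times[OF fin fin] by (cases i) (simp only: prod.case)
  qed simp
  also have "\<dots> = (\<Sum>(k, l)\<in>?I. a4_dual_class k * a4_dual_class l)"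
    unfolding a4_dual_class_def lsum_mult[OF fin fin] by (intro sum.cong) (auto intro: lsum_cong)
  also have "\<dots> = a4_dual_class 0 ^ 2 + 4 * a4_dual_class 1 * a4_dual_class 2"
    by (simp add: dual_classes power2_eq_square algebra_simps)
  finally show ?thesis .
qed

text \<open>The self-dual ternary code of length 4 and dimension 2. Its eight nonzero words all have
  weight 3, which is the shape of the term with coefficient 8 in
  \<open>e8_hexagonal\<close>.\<close>

definition tetracode :: "(int \<times> int \<times> int \<times> int) set" where
  "tetracode = {(0, 0, 0, 0), (0, 1, 1, 1), (0, 2, 2, 2), (1, 0, 2, 1), (1, 1, 0, 2), (1, 2, 1, 0),
     (2, 0, 1, 2), (2, 1, 2, 0), (2, 2, 0, 1)}"

lemma tetracode_mod3:
  fixes a b c d :: int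
  shows "3 dvd a - b + c \<and> 3 dvd a + b - d \<longleftrightarrow> (a mod 3, b mod 3, c mod 3, d mod 3) \<in> tetracode"
proof -
  have "(a - b + c) mod 3 = (a mod 3 - b mod 3 + c mod 3) mod 3" "(a + b - d) mod 3 = (a mod 3 + b mod 3 - d mod 3) mod 3"
    by (intro mod_add_cong mod_diff_cong; simp)+
  then have e: "3 dvd a - b + c \<longleftrightarrow> (a mod 3 - b mod 3 + c mod 3) mod 3 = 0" "3 dvd a + b - d \<longleftrightarrow> (a mod 3 + b mod 3 - d mod 3) mod 3 = 0"
    by (simp_all only: dvd_eq_mod_eq_0)
  have "(u - v + x) mod 3 = 0 \<and> (u + v - y) mod 3 = 0 \<longleftrightarrow> (u, v, x, y) \<in> tetracode"
    if "u \<in> {0, 1, 2}" "v \<in> {0, 1, 2}" "x \<in> {0, 1, 2}" "y \<in> {0, 1, 2}" for u v x y :: int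
    using that by (elim insertE emptyE) (simp_all add: tetracode_def)
  note k = this[OF three_classes three_classes three_classes three_classes]
  show ?thesis unfolding e k ..
qed

definition tetraset :: "((int \<times> int) \<times> (int \<times> int) \<times> (int \<times> int) \<times> (int \<times> int)) set" where
  "tetraset = {((a, a'), (b, b'), (c, c'), (d, d')).
     3 dvd (a - a') - (b - b') + (c - c') \<and> 3 dvd (a - a') + (b - b') - (d - d')}"

text \<open>The same lattice inside four copies of the dual of $A_2$, glued by the tetracode: the nine
  coordinates of $A_8 \<subseteq> E_8$, split into $5 + 4$ for the two copies of $A_4$, are split into $3 + 3 + 3$,
  and the fourth hexagonal component is formed by the three partial sums.\<close>

definition e8_hex :: "(int \<times> int \<times> int \<times> int) \<times> (int \<times> int \<times> int \<times> int) \<Rightarrow> (int \<times> int) \<times> (int \<times> int) \<times> (int \<times> int) \<times> (int \<times> int)" where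
  "e8_hex = (\<lambda>((a, b, c, d), (p, q, r, s)).
     ((2 * a + 2 * b + 2 * c + d + p + q + r + s, d + p), (a - b, b - c), (d, a + b + c + d + q + r + s), (q - r, r - s)))"

lemma e8_tetracode_glue: "bij_betw e8_hex UNIV tetraset"
proof (rule bij_betw_imageI)
  show "inj e8_hex" by (rule injI) (auto simp: e8_hex_def)
  have "v \<in> range e8_hex" if "v \<in> tetraset" for v
  proof -
    obtain a a' b b' c c' d d' where v: "v = ((a, a'), (b, b'), (c, c'), (d, d'))" by (metis surj_pair)
    have "3 dvd (a - a') - (b - b') + (c - c')" "3 dvd (a - a') + (b - b') - (d - d')"
      using that v by (simp_all add: tetraset_def)
    then obtain x y where xy: "(a - a') - (b - b') + (c - c') = 3 * x" "(a - a') + (b - b') - (d - d') = 3 * y"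
      by (elim dvdE)
    \<comment> \<open>For an image point the first check sum is three times its second coordinate,
      and the second is three times the sum of its first, third and seventh. So \<open>x\<close> has
      to be the second coordinate and \<open>y\<close> that sum, and the rest follows
      linearly.\<close>
    have "v = e8_hex ((x + b, x, x - b', c), (a' - c, y - 2 * x - b + b' + d, y - 2 * x - b + b', y - 2 * x - b + b' - d'))"
      unfolding v e8_hex_def prod.case prod.inject by (intro conjI; (use xy in algebra | simp))
    then show ?thesis by blast
  qed
  moreover have "e8_hex x \<in> tetraset" for x
  proof -
    obtain a b c d p q r s where x: "x = ((a, b, c, d), (p, q, r, s))" by (metis surj_pair)
    have "(2 * a + 2 * b + 2 * c + d + p + q + r + s - (d + p)) - (a - b - (b - c)) + (d - (a + b + c + d + q + r + s)) = 3 * b"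
      "(2 * a + 2 * b + 2 * c + d + p + q + r + s - (d + p)) + (a - b - (b - c)) - (q - r - (r - s)) = 3 * (a + c + r)"
      by simp_all
    note e = this
    show ?thesis unfolding x tetraset_def e8_hex_def prod.case mem_Collect_eq e by simp
  qed
  ultimately show "range e8_hex = tetraset" by blast
qed

lemma e8_hexagonal: "fps_stretch 3 e8_theta = hex_class 0 ^ 4 + 8 * hex_class 0 * hex_class 1 ^ 3"
proof -
  let ?N = "\<lambda>(x, v). hex_form x + (case v of (y, v) \<Rightarrow> hex_form y + (case v of (z, w) \<Rightarrow> hex_form z + hex_form w))"
  let ?S = "\<lambda>(i, j, k, l). hex_coset i \<times> hex_coset j \<times> hex_coset k \<times> hex_coset l"
  have fin: "finfib (hex_coset k) hex_form" for k by (rule finfib_subset[OF finfib_hex_form]) simp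
  have fin2: "finfib (hex_coset k \<times> hex_coset l) (\<lambda>(x, y). hex_form x + hex_form y)" for k l by (rule finfib_times[OF fin fin])
  have fin3: "finfib (hex_coset j \<times> hex_coset k \<times> hex_coset l) (\<lambda>(y, v). hex_form y + (case v of (z, w) \<Rightarrow> hex_form z + hex_form w))" for j k l
    by (rule finfib_times[OF fin fin2])
  have fin4: "finfib (hex_coset i \<times> hex_coset j \<times> hex_coset k \<times> hex_coset l) ?N" for i j k l
    by (rule finfib_times[OF fin fin3])
  have "fps_stretch 3 e8_theta = lcount UNIV (\<lambda>s. 3 * (nat \<circ> e8_form) s)"
    by (simp add: e8_theta_def lsum_stretch)
  also have "\<dots> = lcount tetraset ?N"
  proof (rule lcount_reindex[OF e8_tetracode_glue])
    fix x :: "(int \<times> int \<times> int \<times> int) \<times> (int \<times> int \<times> int \<times> int)"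
    obtain a b c d p q r s where x: "x = ((a, b, c, d), (p, q, r, s))" by (metis surj_pair)
    have "int (?N (e8_hex x)) = 3 * e8_form x"
      unfolding x by (simp add: e8_hex_def int_hex_form) (simp add: e8_form_def a4_form_def algebra_simps power2_eq_square)
    then show "?N (e8_hex x) = 3 * (nat \<circ> e8_form) x" by simp
  qed
  also have "tetraset = (\<Union>i\<in>tetracode. ?S i)"
    unfolding tetraset_def tetracode_mod3 by (fastforce simp: hex_coset_def)
  also have "lcount \<dots> ?N = (\<Sum>i\<in>tetracode. lcount (?S i) ?N)"
  proof (rule lsum_UNION)
    show "finite tetracode" by (simp add: tetracode_def)
    show "disjoint_family_on ?S tetracode"
      unfolding disjoint_family_on_def by (auto simp: hex_coset_def)
    show "finfib (?S i) ?N" for i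
      using fin4 by (cases i) (simp only: prod.case)
  qed
  also have "\<dots> = (\<Sum>(i, j, k, l)\<in>tetracode. hex_class i * (hex_class j * (hex_class k * hex_class l)))"
    unfolding hex_class_def lsum_mult[OF fin fin] lsum_mult[OF fin fin2] lsum_mult[OF fin fin3]
    by (intro sum.cong) (auto intro!: lsum_cong)
  also have "\<dots> = hex_class 0 ^ 4 + 8 * hex_class 0 * hex_class 1 ^ 3"
    unfolding tetracode_def by (simp add: hex_class_2 eval_nat_numeral algebra_simps)
  finally show ?thesis .
qed

section \<open>Dissections of the Euler product\<close>

definition fps_twist :: "'a::idom \<Rightarrow> 'a fps \<Rightarrow> 'a fps" where
  "fps_twist c f = f oo (fps_const c * fps_X)"

lemma fps_twist_nth: "fps_twist c f $ n = c ^ n * f $ n"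
  by (simp add: fps_twist_def)

lemma fps_twist_mult: "fps_twist c (f * g) = fps_twist c f * fps_twist c g"
  by (simp add: fps_twist_def fps_compose_mult_distrib)

lemma fps_twist_diff: "fps_twist c (f - g) = fps_twist c f - fps_twist c g"
  by (simp add: fps_twist_def fps_compose_sub_distrib)

lemma fps_twist_1 [simp]: "fps_twist c 1 = 1"
  by (simp add: fps_twist_def)

lemma fps_twist_prod: "fps_twist c (prod f A) = (\<Prod>x\<in>A. fps_twist c (f x))"
  by (simp add: fps_twist_def fps_compose_prod_distrib)

lemma fps_twist_power: "fps_twist c (f ^ n) = fps_twist c f ^ n"
  by (induction n) (simp_all add: fps_twist_mult)

lemma fps_twist_X_power: "fps_twist c (fps_X ^ n) = fps_const (c ^ n) * fps_X ^ n"
  by (rule fps_ext) (simp add: fps_twist_nth fps_X_power_iff)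

lemma fps_twist_iprod: "fps_twist c (fps_iprod f) = fps_iprod (\<lambda>n. fps_twist c (f n))"
  by (rule fps_ext) (simp add: fps_iprod_def fps_twist_nth fps_twist_prod[symmetric])

lemma fps_iprod_multiples:
  assumes "tame (\<lambda>n. if N dvd Suc n then g (Suc n) else 1)" "N > 0"
  shows "fps_iprod (\<lambda>n. if N dvd Suc n then g (Suc n) else 1) = fps_iprod (\<lambda>n. g (N * Suc n))"
proof -
  let ?f = "\<lambda>n. if N dvd Suc n then g (Suc n) else 1"
  have "N dvd Suc (N * n + j) \<longleftrightarrow> j = N - 1" if "j < N" for n j
  proof
    assume "N dvd Suc (N * n + j)"
    then have "N dvd Suc j" by (metis add_Suc_right dvd_add_right_iff dvd_triv_left)
    then have "N \<le> Suc j" by (rule dvd_imp_le) simp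
    then show "j = N - 1" using that by simp
  qed (use assms(2) in simp)
  then have f: "?f (N * n + j) = (if j = N - 1 then g (N * Suc n) else 1)" if "j < N" for n j
    using that assms(2) by (auto simp: add.commute)
  have "fps_iprod ?f = (\<Prod>j<N. fps_iprod (\<lambda>n. ?f (N * n + j)))"
    by (rule fps_iprod_residues[OF assms, symmetric])
  also have "\<dots> = (\<Prod>j<N. if j = N - 1 then fps_iprod (\<lambda>n. g (N * Suc n)) else 1)"
  proof (intro prod.cong refl)
    fix j assume "j \<in> {..<N}"
    then have "(\<lambda>n. ?f (N * n + j)) = (\<lambda>n. if j = N - 1 then g (N * Suc n) else 1)"
      by (intro ext f) simp
    then show "fps_iprod (\<lambda>n. ?f (N * n + j)) = (if j = N - 1 then fps_iprod (\<lambda>n. g (N * Suc n)) else 1)"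
      by (simp only: fps_iprod_1 if_True if_False split: if_split) simp
  qed
  also have "\<dots> = fps_iprod (\<lambda>n. g (N * Suc n))"
    using assms(2) by (simp add: prod.delta)
  finally show ?thesis .
qed

text \<open>The conjugates of the factor of index n multiply to 1 - q^(Nn) if \<open>N\<close> does
  not divide n, and to (1 - q^n)^N otherwise. The factor \<open>euler (N * N)\<close> restores the
  indices missing from the first kind.\<close>

lemma euler_norm:
  fixes z :: "'a::idom"
  assumes N: "N > 0" and zN: "z ^ N = 1"
    and P: "\<And>k (u :: 'a fps) v. \<not> N dvd k \<Longrightarrow> (\<Prod>j<N. u - fps_const (z ^ k) ^ j * v) = u ^ N - v ^ N"
  shows "euler (N * N) * (\<Prod>j<N. fps_twist (z ^ j) (euler 1)) = (euler N ^ (N + 1) :: 'a fps)"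
proof -
  let ?t = "\<lambda>j n. 1 - fps_const ((z ^ j) ^ Suc n) * fps_X ^ Suc n :: 'a fps"
  let ?A = "\<lambda>n. if N dvd Suc n then (1 - fps_X ^ Suc n) ^ N else 1 :: 'a fps"
  let ?B = "\<lambda>n. if N dvd Suc n then 1 - fps_X ^ (N * Suc n) else 1 :: 'a fps"
  have le: "n \<le> N * Suc n" for n using N by (cases N) auto
  have t1: "tame (\<lambda>n. 1 - fps_X ^ Suc n :: 'a fps)" and tN: "tame (\<lambda>n. 1 - fps_X ^ (N * Suc n) :: 'a fps)"
    using le by (intro tame_one_plus; simp)+
  have "tame (\<lambda>n. (1 - fps_X ^ Suc n) ^ N :: 'a fps)"
    using tame_prod[of "{..<N}" "\<lambda>_ n. 1 - fps_X ^ Suc n :: 'a fps"] t1 by simp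
  then have tA: "tame ?A" and tB: "tame ?B" using tN unfolding tame_def by auto
  have tt: "tame (?t j)" for j by (rule tame_one_plus) simp
  have "fps_twist (z ^ j) (euler 1) = fps_iprod (?t j)" for j
    unfolding euler_def fps_twist_iprod by (simp add: fps_twist_diff fps_twist_X_power del: power_Suc)
  then have "(\<Prod>j<N. fps_twist (z ^ j) (euler 1)) = fps_iprod (\<lambda>n. \<Prod>j<N. ?t j n)"
    by (simp only: fps_iprod_prod[OF finite_lessThan tt])
  then have "euler (N * N) * (\<Prod>j<N. fps_twist (z ^ j) (euler 1)) = fps_iprod ?B * fps_iprod (\<lambda>n. \<Prod>j<N. ?t j n)"
    using fps_iprod_multiples[OF tB N] by (simp add: euler_def mult.assoc del: mult_Suc_right power_Suc)
  also have "\<dots> = fps_iprod (\<lambda>n. ?B n * (\<Prod>j<N. ?t j n))"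
    by (intro fps_iprod_mult[symmetric] tB tame_prod tt)
  also have "(\<lambda>n. ?B n * (\<Prod>j<N. ?t j n)) = (\<lambda>n. (1 - fps_X ^ (N * Suc n)) * ?A n)"
  proof
    fix n
    show "?B n * (\<Prod>j<N. ?t j n) = (1 - fps_X ^ (N * Suc n)) * ?A n"
    proof (cases "N dvd Suc n")
      case True
      then obtain m where m: "Suc n = N * m" by (elim dvdE)
      have "(z ^ j) ^ Suc n = 1" for j
        unfolding m by (metis zN power_mult power_one mult.commute)
      then show ?thesis using True by (simp del: power_Suc mult_Suc_right)
    next
      case False
      have "(\<Prod>j<N. ?t j n) = (\<Prod>j<N. 1 - fps_const (z ^ Suc n) ^ j * fps_X ^ Suc n)"
        by (intro prod.cong refl) (simp add: power_mult[symmetric] mult.commute del: power_Suc mult_Suc_right)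
      also have "\<dots> = 1 - fps_X ^ (N * Suc n)"
        by (subst P[OF False]) (simp add: power_mult[symmetric] mult.commute del: power_Suc mult_Suc_right)
      finally show ?thesis using False by (simp del: power_Suc mult_Suc_right)
    qed
  qed
  also have "fps_iprod \<dots> = euler N * fps_iprod ?A"
    unfolding euler_def by (rule fps_iprod_mult[OF tN tA])
  also have "fps_iprod ?A = fps_iprod (\<lambda>n. (1 - fps_X ^ (N * Suc n)) ^ N)"
    by (rule fps_iprod_multiples[OF tA N])
  also have "\<dots> = euler N ^ N"
    using fps_iprod_prod[of "{..<N}" "\<lambda>_ n. 1 - fps_X ^ (N * Suc n) :: 'a fps"] tN by (simp add: euler_def)
  finally show ?thesis by simp
qed

lemma cube_root_power:
  fixes z :: "'a::field"
  assumes "1 + z + z\<^sup>2 = 0" "\<not> 3 dvd (k :: nat)"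
  shows "1 + z ^ k + (z ^ k)\<^sup>2 = 0"
proof -
  note c = cube_root_facts(1)[OF assms(1)]
  have "z ^ k = z ^ (3 * (k div 3) + k mod 3)" by simp
  also have "\<dots> = z ^ (k mod 3)" unfolding power_add power_mult c by simp
  finally have "z ^ k = z ^ (k mod 3)" .
  moreover have "k mod 3 = 1 \<or> k mod 3 = 2" using assms(2) by presburger
  moreover have "1 + z\<^sup>2 + (z\<^sup>2)\<^sup>2 = 0" using assms(1) c by algebra
  ultimately show ?thesis using assms(1) by auto
qed

lemma fifth_root_power:
  fixes z :: "'a::field"
  assumes "1 + z + z\<^sup>2 + z ^ 3 + z ^ 4 = 0" "\<not> 5 dvd (k :: nat)"
  shows "1 + z ^ k + (z ^ k)\<^sup>2 + (z ^ k) ^ 3 + (z ^ k) ^ 4 = 0"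
proof -
  note c = fifth_root_facts(1)[OF assms(1)]
  have "z ^ k = z ^ (5 * (k div 5) + k mod 5)" by simp
  also have "\<dots> = z ^ (k mod 5)" unfolding power_add power_mult c by simp
  finally have "z ^ k = z ^ (k mod 5)" .
  moreover have "k mod 5 = 1 \<or> k mod 5 = 2 \<or> k mod 5 = 3 \<or> k mod 5 = 4" using assms(2) by presburger
  moreover have "1 + z\<^sup>2 + (z\<^sup>2)\<^sup>2 + (z\<^sup>2) ^ 3 + (z\<^sup>2) ^ 4 = 0" using assms(1) c by algebra
  moreover have "1 + z ^ 3 + (z ^ 3)\<^sup>2 + (z ^ 3) ^ 3 + (z ^ 3) ^ 4 = 0" using assms(1) c by algebra
  moreover have "1 + z ^ 4 + (z ^ 4)\<^sup>2 + (z ^ 4) ^ 3 + (z ^ 4) ^ 4 = 0" using assms(1) c by algebra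
  ultimately show ?thesis using assms(1) by auto
qed

lemma const_rel:
  "1 + z + z\<^sup>2 = 0 \<Longrightarrow> 1 + fps_const z + (fps_const z)\<^sup>2 = 0"
  "1 + z + z\<^sup>2 + z ^ 3 + z ^ 4 = 0 \<Longrightarrow> 1 + fps_const z + (fps_const z)\<^sup>2 + (fps_const z) ^ 3 + (fps_const z) ^ 4 = 0"
  for z :: "'a::comm_ring_1"
  by (simp_all only: fps_const_power fps_const_add fps_const_1_eq_1[symmetric] fps_const_0_eq_0)

section \<open>Series supported on one residue class of exponents\<close>

definition fclass :: "nat \<Rightarrow> nat \<Rightarrow> 'a::zero fps \<Rightarrow> bool" where
  "fclass N i f \<longleftrightarrow> (\<forall>n. n mod N \<noteq> i \<longrightarrow> f $ n = 0)"

lemma fclass_mult: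
  fixes f g :: "'a::comm_ring_1 fps"
  assumes "fclass N i f" "fclass N j g" "(i + j) mod N = k"
  shows "fclass N k (f * g)"
  unfolding fclass_def
proof (intro allI impI)
  fix n assume "n mod N \<noteq> k"
  have "f $ l * g $ (n - l) = 0" if "l \<in> {0..n}" for l
  proof (cases "l mod N = i \<and> (n - l) mod N = j")
    case True
    have "n mod N = (l + (n - l)) mod N" using that by simp
    also have "\<dots> = k" using True assms(3) by (metis mod_add_eq)
    finally show ?thesis using \<open>n mod N \<noteq> k\<close> by simp
  next
    case False then show ?thesis using assms(1,2) by (auto simp: fclass_def)
  qed
  then show "(f * g) $ n = 0" unfolding fps_mult_nth by (intro sum.neutral) auto
qed

lemma fclass_add: "fclass N i f \<Longrightarrow> fclass N i g \<Longrightarrow> fclass N i (f + g :: 'a::comm_ring_1 fps)"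
  and fclass_diff: "fclass N i f \<Longrightarrow> fclass N i g \<Longrightarrow> fclass N i (f - g :: 'a::comm_ring_1 fps)"
  by (simp_all add: fclass_def)

lemma fclass_1: "N > 0 \<Longrightarrow> fclass N 0 (1 :: 'a::comm_ring_1 fps)"
  by (auto simp: fclass_def)

lemma fclass_power:
  fixes f :: "'a::comm_ring_1 fps"
  assumes "fclass N i f" "N > 0"
  shows "fclass N (i * m mod N) (f ^ m)"
proof (induction m)
  case 0 then show ?case using assms(2) by (simp add: fclass_1)
next
  case (Suc m)
  then show ?case using assms(1) by (auto intro!: fclass_mult[of N i f "i * m mod N"] simp: mod_add_right_eq)
qed

lemma fclass_stretch: "N > 0 \<Longrightarrow> M > 0 \<Longrightarrow> N dvd M \<Longrightarrow> fclass N 0 (fps_stretch M f)"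
  unfolding fclass_def using dvd_trans by (fastforce simp: fps_stretch_nth)

lemma fclass_X_power: "fclass N (k mod N) (fps_X ^ k :: 'a::comm_ring_1 fps)"
  by (auto simp: fclass_def fps_X_power_iff)

lemma fclass_twist:
  fixes f :: "'a::idom fps"
  assumes "fclass N i f" "z ^ N = 1"
  shows "fps_twist z f = fps_const (z ^ i) * f"
proof (rule fps_ext)
  fix n
  have "z ^ n = z ^ (N * (n div N) + n mod N)" by simp
  also have "\<dots> = z ^ (n mod N)" unfolding power_add power_mult assms(2) by simp
  finally show "fps_twist z f $ n = (fps_const (z ^ i) * f) $ n"
    using assms(1) by (cases "n mod N = i") (auto simp: fps_twist_nth fclass_def)
qed

text \<open>Exponents are kept rather than divided by \<open>N\<close>, so that sections can be
  compared directly with products of series of known class.\<close>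

definition fps_section :: "nat \<Rightarrow> nat \<Rightarrow> 'a::zero fps \<Rightarrow> 'a fps" where
  "fps_section N i f = Abs_fps (\<lambda>n. if n mod N = i then f $ n else 0)"

lemma fclass_section: "fclass N i (fps_section N i f)"
  by (simp add: fclass_def fps_section_def)

lemma section_three:
  fixes f :: "'a::comm_ring_1 fps"
  assumes "fclass 3 0 f0" "fclass 3 1 f1" "fclass 3 2 f2" "f = f0 + f1 + f2"
  shows "fps_section 3 0 f = f0" "fps_section 3 1 f = f1" "fps_section 3 2 f = f2"
  using assms by (auto simp: fclass_def fps_section_def fps_eq_iff)

lemma section_five:
  fixes f :: "'a::comm_ring_1 fps"
  assumes "fclass 5 0 f0" "fclass 5 1 f1" "fclass 5 2 f2" "fclass 5 3 f3" "fclass 5 4 f4"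
    "f = f0 + f1 + f2 + f3 + f4"
  shows "fps_section 5 0 f = f0" "fps_section 5 1 f = f1" "fps_section 5 2 f = f2"
    "fps_section 5 3 f = f3" "fps_section 5 4 f = f4"
  using assms by (auto simp: fclass_def fps_section_def fps_eq_iff)

lemma fclass_map: "fclass N i f \<Longrightarrow> h 0 = 0 \<Longrightarrow> fclass N i (fps_map h f)"
  by (auto simp: fclass_def)

lemma lsum_fclass:
  assumes "\<And>s. s \<in> S \<Longrightarrow> K s mod N = i"
  shows "fclass N i (lsum S K w)"
  unfolding fclass_def
proof (intro allI impI)
  fix n assume "n mod N \<noteq> i"
  then have "{s \<in> S. K s = n} = {}" using assms by auto
  then show "lsum S K w $ n = 0" by (simp only: lsum_def fps_nth_Abs_fps sum.empty)
qed

section \<open>The pentagonal number theorem and Jacobi's identity\<close>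

definition parity_sign :: "int \<Rightarrow> 'a::comm_ring_1" where "parity_sign k = (if even k then 1 else - 1)"

lemma isgn_add: "parity_sign (j + k) = parity_sign j * parity_sign k"
  by (auto simp: parity_sign_def)

lemma pentagonal: "euler 1 = lsum UNIV (jexp 3 1) (parity_sign :: int \<Rightarrow> 'a::comm_ring_1)"
proof -
  let ?f = "\<lambda>n. 1 - fps_X ^ (1 * Suc n) :: 'a fps"
  have tame: "tame (\<lambda>n. 1 + fps_const c * fps_X ^ (i + 3 * n) :: 'a fps)" for c i by (rule tame_one_plus) simp
  have "{..<3::nat} = {0, 1, 2}" by auto
  then have "euler 1 = fps_iprod (\<lambda>n. ?f (3 * n + 0)) * (fps_iprod (\<lambda>n. ?f (3 * n + 1)) * fps_iprod (\<lambda>n. ?f (3 * n + 2)))"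
    unfolding euler_def by (subst fps_iprod_residues[OF tame_euler, of 1 3, symmetric]) simp_all
  also have "\<dots> = euler 3 * fps_iprod (\<lambda>n. (1 + fps_const (parity_sign 1) * fps_X ^ (1 + 3 * n)) * (1 + fps_const (parity_sign (-1)) * fps_X ^ (2 + 3 * n)))"
    unfolding fps_iprod_mult[OF tame tame]
    by (simp add: euler_def parity_sign_def numeral_3_eq_3 numeral_2_eq_2 fps_const_neg[symmetric] ac_simps del: fps_const_neg)
  also have "\<dots> = lsum UNIV (jexp 3 1) parity_sign"
    by (rule jacobi_triple_product) (simp_all add: isgn_add, simp add: parity_sign_def)
  finally show ?thesis .
qed

lemma fps_iprod_Suc:
  assumes "tame f" "tame (\<lambda>n. f (Suc n))"
  shows "fps_iprod f = f 0 * fps_iprod (\<lambda>n. f (Suc n))"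
proof (rule fps_eqI_below)
  fix n
  have "fps_eq_below n (fps_iprod f) (\<Prod>k<Suc n. f k)"
    by (rule fps_iprod_below_lessThan[OF assms(1)]) simp
  also have "(\<Prod>k<Suc n. f k) = f 0 * (\<Prod>k<n. f (Suc k))" by (rule prod.lessThan_Suc_shift)
  also have "fps_eq_below n \<dots> (f 0 * fps_iprod (\<lambda>n. f (Suc n)))"
    by (intro fps_eq_below_mult fps_eq_below_refl fps_eq_below_sym[OF fps_iprod_below_lessThan[OF assms(2)]]) simp
  finally show "fps_eq_below n (fps_iprod f) (f 0 * fps_iprod (\<lambda>n. f (Suc n)))" .
qed

interpretation fps_nth_0_hom: cring_hom "\<lambda>f :: complex fps. f $ 0"
  by unfold_locales auto

text \<open>Jacobi's identity is the derivative of the triple product at $z = -1$; here $z = -(1 + \varepsilon)$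
  with $\varepsilon$ an inner formal variable.\<close>

lemma jacobi_cube: "euler 1 ^ 3 = lsum UNIV (jexp 1 1) (\<lambda>k. parity_sign k * k)"
proof -
  let ?w = "\<lambda>k. fps_const (parity_sign k) * fps_binomial (of_int k) :: complex fps"
  let ?A = "\<lambda>n. 1 + fps_const (?w 1) * fps_X ^ (1 + 1 * n)" and ?B = "\<lambda>n. 1 + fps_const (?w (-1)) * fps_X ^ (0 + 1 * n)"
  have tA: "tame ?A" and tB: "tame ?B" and tB': "tame (\<lambda>n. ?B (Suc n))" by (rule tame_one_plus; simp)+
  have add: "?w (j + k) = ?w j * ?w k" for j k
    by (simp add: isgn_add fps_binomial_add_mult fps_const_mult[symmetric] ac_simps del: fps_const_mult)
  have "lsum UNIV (jexp 1 1) ?w = euler 1 * fps_iprod (\<lambda>n. ?A n * ?B n)"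
    by (rule jacobi_triple_product[symmetric]) (simp_all only: add, simp_all add: parity_sign_def)
  also have "\<dots> = fps_const (1 + ?w (-1)) * (euler 1 * fps_iprod ?A * fps_iprod (\<lambda>n. ?B (Suc n)))"
    unfolding fps_iprod_mult[OF tA tB] fps_iprod_Suc[OF tB tB']
    by (simp add: fps_const_add[symmetric] ac_simps del: fps_const_add)
  finally have eq: "lsum UNIV (jexp 1 1) ?w = fps_const (1 + ?w (-1)) * (euler 1 * fps_iprod ?A * fps_iprod (\<lambda>n. ?B (Suc n)))" .
  have hA: "fps_map (\<lambda>f. f $ 0) (fps_iprod ?A) = euler 1"
    unfolding fps_nth_0_hom.map_iprod euler_def
    by (intro arg_cong[where f = fps_iprod] ext fps_ext) (simp add: parity_sign_def fps_X_power_iff)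
  have hB: "fps_map (\<lambda>f. f $ 0) (fps_iprod (\<lambda>n. ?B (Suc n))) = euler 1"
    unfolding fps_nth_0_hom.map_iprod euler_def
    by (intro arg_cong[where f = fps_iprod] ext fps_ext) (simp add: parity_sign_def fps_X_power_iff)
  \<comment> \<open>The detached factor is 1 - 1/(1 + \<epsilon>) = \<epsilon> - ..., so the
    \<epsilon>-coefficient of the whole product is the constant term of the cofactor. On the series
    side it is k, the linear coefficient of (1 + \<epsilon>)^k.\<close>
  have "fps_map (\<lambda>f. f $ 1) (lsum UNIV (jexp 1 1) ?w) = fps_map (\<lambda>f. f $ 0) (euler 1 * fps_iprod ?A * fps_iprod (\<lambda>n. ?B (Suc n)))"
    unfolding eq by (rule fps_ext) (simp add: fps_mult_nth_1 parity_sign_def)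
  also have "\<dots> = euler 1 ^ 3"
    unfolding fps_nth_0_hom.map_mult hA hB by (simp add: power3_eq_cube)
  also have "fps_map (\<lambda>f. f $ 1) (lsum UNIV (jexp 1 1) ?w) = lsum UNIV (jexp 1 1) (\<lambda>k. parity_sign k * of_int k)"
    by (rule fps_ext) (simp add: lsum_def fps_sum_nth)
  also have "\<dots> = fps_map of_int (lsum UNIV (jexp 1 1) (\<lambda>k. parity_sign k * k))"
    unfolding of_int_hom.map_lsum by (intro lsum_cong) (auto simp: parity_sign_def)
  finally have "fps_map (of_int :: int \<Rightarrow> complex) (euler 1 ^ 3) = fps_map of_int (lsum UNIV (jexp 1 1) (\<lambda>k. parity_sign k * k))"
    by (simp add: of_int_hom.map_power)
  then show ?thesis by (rule fps_map_of_int_inj)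
qed

lemma mod5_half:
  fixes e x :: int
  assumes "2 * e = x"
  shows "e mod 5 = 3 * (x mod 5) mod 5"
  by (rule mod_linear[where z = "- e"]) (simp add: assms[symmetric])

lemma pentagonal_mod5:
  "(k :: int) mod 5 = r \<Longrightarrow> int (jexp 3 1 k) mod 5 = 3 * ((3 * (r * r) - r) mod 5) mod 5"
proof -
  assume r: "k mod 5 = r"
  have "2 * int (jexp 3 1 k) = 3 * (k * k) - k"
    using two_tri[of k] by (simp add: int_jexp algebra_simps)
  then have "int (jexp 3 1 k) mod 5 = 3 * ((3 * (k * k) - k) mod 5) mod 5" by (rule mod5_half)
  also have "(3 * (k * k) - k) mod 5 = (3 * ((k mod 5) * (k mod 5)) - (k mod 5)) mod 5"
    by (intro mod_diff_cong mod_mult_cong) simp_all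
  finally show ?thesis by (simp add: r)
qed

lemma triangular_mod5:
  "(k :: int) mod 5 = r \<Longrightarrow> int (jexp 1 1 k) mod 5 = 3 * ((r * r + r) mod 5) mod 5"
proof -
  assume r: "k mod 5 = r"
  have "2 * int (jexp 1 1 k) = k * k + k"
    using two_tri[of k] by (simp add: int_jexp algebra_simps)
  then have "int (jexp 1 1 k) mod 5 = 3 * ((k * k + k) mod 5) mod 5" by (rule mod5_half)
  also have "(k * k + k) mod 5 = ((k mod 5) * (k mod 5) + (k mod 5)) mod 5"
    by (intro mod_add_cong mod_mult_cong) simp_all
  finally show ?thesis by (simp add: r)
qed

text \<open>Triangular numbers are 0, 1 or 3 modulo 5. This enters twice: in the relation A C = B^2
  of \<open>euler_dissection\<close> and in the final congruence.\<close>

lemma euler_cube_nth_eq_0: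
  assumes "n mod 5 = 2 \<or> n mod 5 = 4"
  shows "(euler 1 ^ 3 :: int fps) $ n = 0"
proof -
  have r: "3 * ((r * r + r) mod 5) mod 5 \<in> {0, 1, 3}" if "r \<in> {0, 1, 2, 3, 4}" for r :: int
    using that by (elim insertE emptyE) simp_all
  have A: "int (jexp 1 1 k) mod 5 \<in> {0, 1, 3}" for k
    unfolding triangular_mod5[OF refl] by (rule r[OF five_classes])
  have "int n mod 5 = int (n mod 5)" by (simp add: of_nat_mod)
  then have "int n mod 5 = 2 \<or> int n mod 5 = 4" using assms by auto
  then have "jexp 1 1 k \<noteq> n" for k using A[of k] by auto
  then have "{k \<in> UNIV. jexp 1 1 k = n} = {}" by simp
  then show ?thesis unfolding jacobi_cube lsum_def by (simp only: fps_nth_Abs_fps sum.empty)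
qed

lemma section_lsum:
  assumes "finfib S K"
  shows "fps_section N i (lsum S K w) = lsum {s \<in> S. K s mod N = i} K w"
proof (rule fps_ext)
  fix n
  have "{s \<in> {s \<in> S. K s mod N = i}. K s = n} = (if n mod N = i then {s \<in> S. K s = n} else {})" by auto
  then show "fps_section N i (lsum S K w) $ n = lsum {s \<in> S. K s mod N = i} K w $ n"
    by (simp add: fps_section_def lsum_def)
qed

lemma finfib_pentagonal: "finfib UNIV (jexp 3 1)"
  by (rule finfib_jexp) simp_all

lemma pentagonal_class: "jexp 3 1 k mod 5 = (if k mod 5 = 1 then 1 else if k mod 5 = 3 \<or> k mod 5 = 4 then 2 else 0)"
proof -
  have r: "3 * ((3 * (r * r) - r) mod 5) mod 5 = (if r = 1 then 1 else if r = 3 \<or> r = 4 then 2 else 0)"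
    if "r \<in> {0, 1, 2, 3, 4}" for r :: int
    using that by (elim insertE emptyE) simp_all
  have "int (jexp 3 1 k) mod 5 = (if k mod 5 = 1 then 1 else if k mod 5 = 3 \<or> k mod 5 = 4 then 2 else 0)"
    unfolding pentagonal_mod5[OF refl] by (rule r[OF five_classes])
  then have "int (jexp 3 1 k mod 5) = int (if k mod 5 = 1 then 1 else if k mod 5 = 3 \<or> k mod 5 = 4 then 2 else 0)"
    by (simp add: of_nat_mod)
  then show ?thesis by (simp only: of_nat_eq_iff)
qed

text \<open>For k = 1 - 5m the pentagonal exponent is 1 plus 25 times that of m and the parity
  flips, so this section is the whole series again, at q^25.\<close>

lemma euler_section_1: "fps_section 5 1 (euler 1) = - (fps_X * euler 25 :: int fps)"
proof -
  have "fps_section 5 1 (euler 1) = lsum {k. k mod 5 = 1} (jexp 3 1) (parity_sign :: int \<Rightarrow> int)"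
    unfolding pentagonal section_lsum[OF finfib_pentagonal] by (intro lsum_cong) (auto simp: pentagonal_class[simplified] split: if_splits)
  also have "\<dots> = lsum UNIV (\<lambda>m. 25 * jexp 3 1 m + 1) (\<lambda>m. (-1) * parity_sign m)"
  proof (rule sym, rule lsum_reindex[where h = "\<lambda>m. 1 - 5 * m"])
    show "bij_betw (\<lambda>m. 1 - 5 * m) UNIV {k :: int. k mod 5 = 1}"
      by (rule bij_betw_byWitness[where f' = "\<lambda>k. (1 - k) div 5"]; auto; presburger)
    fix m :: int
    have "int (jexp 3 1 (1 - 5 * m)) = int (25 * jexp 3 1 m + 1)"
      using two_tri[of "1 - 5 * m"] two_tri[of m] by (simp add: int_jexp algebra_simps)
    then show "jexp 3 1 (1 - 5 * m) = 25 * jexp 3 1 m + 1" by (simp only: of_nat_eq_iff)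
    show "parity_sign (1 - 5 * m) = (-1) * parity_sign m" by (simp add: parity_sign_def)
  qed
  also have "\<dots> = fps_const (-1) * (fps_X ^ 1 * fps_stretch 25 (lsum UNIV (jexp 3 1) parity_sign))"
    by (simp only: lsum_stretch lsum_shift lsum_cmult zero_less_numeral)
  also have "\<dots> = - (fps_X * euler 25)"
    unfolding pentagonal[symmetric] by (simp add: fps_stretch_euler fps_const_neg[symmetric] del: fps_const_neg)
  finally show ?thesis .
qed

lemma euler_section_34: "fps_section 5 3 (euler 1) = (0 :: int fps)" "fps_section 5 4 (euler 1) = (0 :: int fps)"
proof -
  have "{k \<in> UNIV. jexp 3 1 k mod 5 = 3} = {}" "{k \<in> UNIV. jexp 3 1 k mod 5 = 4} = {}"
    by (auto simp: pentagonal_class[simplified] split: if_splits)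
  then show "fps_section 5 3 (euler 1) = (0 :: int fps)" "fps_section 5 4 (euler 1) = (0 :: int fps)"
    unfolding pentagonal section_lsum[OF finfib_pentagonal] by (simp_all only: lsum_def, simp_all add: fps_eq_iff)
qed

lemma section_sum5: "f = fps_section 5 0 f + fps_section 5 1 f + fps_section 5 2 f + fps_section 5 3 f + fps_section 5 4 f"
  for f :: "'a::comm_ring_1 fps"
proof (rule fps_ext)
  fix n :: nat
  have "n mod 5 = 0 \<or> n mod 5 = 1 \<or> n mod 5 = 2 \<or> n mod 5 = 3 \<or> n mod 5 = 4" by presburger
  then show "f $ n = (fps_section 5 0 f + fps_section 5 1 f + fps_section 5 2 f + fps_section 5 3 f + fps_section 5 4 f) $ n"
    by (auto simp: fps_section_def)
qed

lemma fclass_cmult: "fclass N i f \<Longrightarrow> fclass N i (numeral k * f :: 'a::comm_ring_1 fps)"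
  by (auto simp: fclass_def numeral_fps_const)

text \<open>The class 2 section of E_1^3 is 3 A (B^2 - A C), and Jacobi's identity makes it vanish.
  Here B / A is the Rogers-Ramanujan continued fraction at q^5, and A C = B^2 stands in for its
  product formula.\<close>

lemma euler_dissection:
  obtains A B C :: "int fps" where "fclass 5 0 A" "fclass 5 1 B" "fclass 5 2 C" "B = fps_X * euler 25"
    "euler 1 = A - B - C" "A * C = B\<^sup>2" "A $ 0 = 1"
proof -
  define A :: "int fps" where "A = fps_section 5 0 (euler 1)"
  define B :: "int fps" where "B = fps_X * euler 25"
  define C :: "int fps" where "C = - fps_section 5 2 (euler 1)"
  have cA: "fclass 5 0 A" unfolding A_def by (rule fclass_section)
  have cB: "fclass 5 1 B"
    using fclass_section[of 5 1 "euler 1 :: int fps"] unfolding euler_section_1 B_def[symmetric] by (simp add: fclass_def)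
  have cC: "fclass 5 2 C"
    using fclass_section[of 5 2 "euler 1 :: int fps"] by (simp add: fclass_def C_def)
  have E: "euler 1 = A - B - C"
    using section_sum5[of "euler 1 :: int fps"] unfolding euler_section_1 euler_section_34 A_def B_def C_def by simp
  have A0: "A $ 0 = 1" by (simp add: fps_section_def A_def)
  note cls = fclass_mult[of 5, where 'a = int]
  have c2: "fclass 5 0 (A\<^sup>2)" "fclass 5 2 (B\<^sup>2)" "fclass 5 4 (C\<^sup>2)" "fclass 5 0 (A ^ 3)" "fclass 5 3 (B ^ 3)" "fclass 5 1 (C ^ 3)"
    using fclass_power[OF cA, of 2] fclass_power[OF cB, of 2] fclass_power[OF cC, of 2]
      fclass_power[OF cA, of 3] fclass_power[OF cB, of 3] fclass_power[OF cC, of 3] by simp_all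
  have bc: "fclass 5 3 (B * C)" by (rule fclass_mult[OF cB cC]) simp
  have "fps_section 5 2 (euler 1 ^ 3 :: int fps) = 3 * (A * B\<^sup>2) - 3 * (A\<^sup>2 * C)"
  proof (rule section_five(3))
    show "fclass 5 0 (A ^ 3 - 3 * (B * C\<^sup>2))"
      by (intro fclass_diff fclass_cmult c2 fclass_mult[OF cB c2(3)]) simp
    show "fclass 5 1 (0 - 3 * (A\<^sup>2 * B) - C ^ 3)"
      by (intro fclass_diff fclass_cmult c2 fclass_mult[OF c2(1) cB]) (simp_all add: fclass_def)
    show "fclass 5 2 (3 * (A * B\<^sup>2) - 3 * (A\<^sup>2 * C))"
      by (intro fclass_diff fclass_cmult fclass_mult[OF cA c2(2)] fclass_mult[OF c2(1) cC]) simp_all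
    show "fclass 5 3 (6 * (A * (B * C)) - B ^ 3)"
      by (intro fclass_diff fclass_cmult c2 fclass_mult[OF cA bc]) simp
    show "fclass 5 4 (3 * (A * C\<^sup>2) - 3 * (B\<^sup>2 * C))"
      by (intro fclass_diff fclass_cmult fclass_mult[OF cA c2(3)] fclass_mult[OF c2(2) cC]) simp_all
    show "euler 1 ^ 3 = (A ^ 3 - 3 * (B * C\<^sup>2)) + (0 - 3 * (A\<^sup>2 * B) - C ^ 3) + (3 * (A * B\<^sup>2) - 3 * (A\<^sup>2 * C))
        + (6 * (A * (B * C)) - B ^ 3) + (3 * (A * C\<^sup>2) - 3 * (B\<^sup>2 * C))"
      unfolding E by algebra
  qed
  moreover have "fps_section 5 2 (euler 1 ^ 3 :: int fps) = 0"
    using euler_cube_nth_eq_0 by (simp add: fps_section_def fps_eq_iff)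
  ultimately have "3 * A * (A * C - B\<^sup>2) = 0" by algebra
  moreover have "A \<noteq> 0" using A0 by auto
  ultimately have "A * C = B\<^sup>2" by simp
  with cA cB cC B_def E A0 show ?thesis using that by blast
qed

section \<open>Norms of the dissected products\<close>

lemma euler_nonzero: "N > 0 \<Longrightarrow> euler N \<noteq> (0 :: 'a::comm_ring_1 fps)"
  by (metis euler_nth_0 fps_zero_nth zero_neq_one)

lemma fclass_euler: "N > 0 \<Longrightarrow> fclass N 0 (euler N :: 'a::idom fps)"
  using fps_stretch_euler[of N 1, where 'a = 'a] fclass_stretch[of N N "euler 1 :: 'a fps"] by simp

lemma hex_class_fclass: "fclass 3 0 (hex_class 0)" "fclass 3 1 (hex_class 1)"
proof -
  show "fclass 3 0 (hex_class 0)" unfolding hex_class_0 by (rule fclass_stretch) simp_all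
  have "fclass 3 1 (fps_X :: int fps)" using fclass_X_power[of 3 1, where 'a = int] by simp
  moreover have "fclass 3 0 (fps_stretch 3 (lcount UNIV hex_shift_form))" by (rule fclass_stretch) simp_all
  ultimately show "fclass 3 1 (hex_class 1)" unfolding hex_class_1_hexg by (rule fclass_mult) simp
qed

text \<open>Only E_1^3, not E_1, has the dissection with the two terms H_0 =
  \<open>hex_class 0\<close> and H_1 = \<open>hex_class 1\<close>, so the product of conjugates of
  E_1 is cubed. The conjugates of H_0 - H_1 multiply to H_0^3 - H_1^3. The result is the Borweins'
  cubic identity at q^3.\<close>

lemma hex_norm: "euler 9 ^ 3 * (hex_class 0 ^ 3 - hex_class 1 ^ 3) = euler 3 ^ 9"
proof -
  obtain z :: complex where z: "1 + z + z\<^sup>2 = 0" by (rule exists_cube_root)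
  note f = cube_root_facts[OF z]
  let ?h = "fps_map (of_int :: int \<Rightarrow> complex)"
  define H0 where "H0 = ?h (hex_class 0)"
  define H1 where "H1 = ?h (hex_class 1)"
  have c0: "fclass 3 0 H0" unfolding H0_def by (rule fclass_map[OF hex_class_fclass(1)]) simp
  have c1: "fclass 3 1 H1" unfolding H1_def by (rule fclass_map[OF hex_class_fclass(2)]) simp
  let ?P = "\<Prod>j<3. fps_twist (z ^ j) (euler 1)"
  have norm: "euler (3 * 3) * ?P = (euler 3 ^ (3 + 1) :: complex fps)"
    by (rule euler_norm[OF _ f(1) prod_cube_roots[OF const_rel(1)[OF cube_root_power[OF z]]]]) simp_all
  have diff: "euler 3 * (H0 - H1) = euler 1 ^ 3"
    using arg_cong[OF hex_class_diff, of ?h]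
    by (simp add: H0_def H1_def of_int_hom.map_mult of_int_hom.map_minus of_int_hom.map_power)
  have tw: "fps_twist (z ^ j) (euler 1) ^ 3 = euler 3 * (H0 - fps_const z ^ j * H1)" for j
  proof -
    have y: "(z ^ j) ^ 3 = 1" by (metis f(1) mult.commute power_mult power_one)
    have "fps_twist (z ^ j) (euler 1) ^ 3 = fps_twist (z ^ j) (euler 3 * (H0 - H1))"
      unfolding diff by (simp add: fps_twist_power)
    also have "\<dots> = euler 3 * (H0 - fps_const (z ^ j) * H1)"
      using fclass_twist[OF fclass_euler y] fclass_twist[OF c0 y] fclass_twist[OF c1 y]
      by (simp add: fps_twist_mult fps_twist_diff)
    finally show ?thesis by (simp add: fps_const_power)
  qed
  have "?P ^ 3 = (\<Prod>j<3. euler 3 * (H0 - fps_const z ^ j * H1))"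
    unfolding prod_power_distrib tw ..
  also have "\<dots> = euler 3 ^ 3 * (\<Prod>j<3. H0 - fps_const z ^ j * H1)"
    by (simp add: prod.distrib)
  also have "(\<Prod>j<3. H0 - fps_const z ^ j * H1) = H0 ^ 3 - H1 ^ 3"
    by (rule prod_cube_roots[OF const_rel(1)[OF z]])
  finally have P3: "?P ^ 3 = euler 3 ^ 3 * (H0 ^ 3 - H1 ^ 3)" .
  have n: "euler 9 * ?P = (euler 3 ^ 4 :: complex fps)" using norm by simp
  have "euler 3 ^ 3 * (euler 9 ^ 3 * (H0 ^ 3 - H1 ^ 3)) = (euler 9 * ?P) ^ 3"
    unfolding power_mult_distrib P3 by (simp add: mult.left_commute)
  also have "\<dots> = euler 3 ^ 3 * euler 3 ^ 9" unfolding n by (simp flip: power_mult power_add)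
  finally have "euler 9 ^ 3 * (H0 ^ 3 - H1 ^ 3) = euler 3 ^ 9"
    by (subst (asm) mult_left_cancel) (simp_all add: euler_nonzero)
  then have "?h (euler 9 ^ 3 * (hex_class 0 ^ 3 - hex_class 1 ^ 3)) = ?h (euler 3 ^ 9)"
    by (simp add: H0_def H1_def of_int_hom.map_mult of_int_hom.map_minus of_int_hom.map_power)
  then show ?thesis by (rule fps_map_of_int_inj)
qed

text \<open>With $A C = B^2$ each conjugate $A - z B - z^2 C$ of $E_1$ splits, after multiplication by $A$,
  into factors linear in $A$ and $B$ whose constants are the roots of $x^2 = x + 1$.\<close>

lemma euler_norm_dissection:
  fixes A B C :: "int fps"
  assumes cls: "fclass 5 0 A" "fclass 5 1 B" "fclass 5 2 C" and E: "euler 1 = A - B - C"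
    and AC: "A * C = B\<^sup>2" and A0: "A $ 0 = 1"
  shows "(A ^ 5 - 11 * B ^ 5 - C ^ 5) * euler 25 = euler 5 ^ 6"
proof -
  obtain z :: complex where z: "1 + z + z\<^sup>2 + z ^ 3 + z ^ 4 = 0" by (rule exists_fifth_root)
  note f = fifth_root_facts[OF z]
  let ?h = "fps_map (of_int :: int \<Rightarrow> complex)"
  define a where "a = ?h A"
  define b where "b = ?h B"
  define c where "c = ?h C"
  have ca: "fclass 5 0 a" and cb: "fclass 5 1 b" and cc: "fclass 5 2 c"
    unfolding a_def b_def c_def by (rule fclass_map[OF cls(1)] fclass_map[OF cls(2)] fclass_map[OF cls(3)]; simp)+
  have e: "euler 1 = a - b - c"
    using arg_cong[OF E, of ?h] by (simp add: a_def b_def c_def of_int_hom.map_minus)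
  have ac: "a * c = b\<^sup>2"
    using arg_cong[OF AC, of ?h] by (simp add: a_def b_def c_def of_int_hom.map_mult of_int_hom.map_power)
  have a0: "a \<noteq> 0" using A0 unfolding a_def fps_eq_iff by (auto intro!: exI[of _ 0])
  let ?P = "\<Prod>j<5. fps_twist (z ^ j) (euler 1)"
  have norm: "euler (5 * 5) * ?P = (euler 5 ^ (5 + 1) :: complex fps)"
    by (rule euler_norm[OF _ f(1) prod_fifth_roots[OF const_rel(2)[OF fifth_root_power[OF z]]]]) simp_all
  define s where "s = fps_const (complex_of_real ((1 + sqrt 5) / 2))"
  define t where "t = fps_const (complex_of_real ((1 - sqrt 5) / 2))"
  have "(1 + sqrt 5) / 2 + (1 - sqrt 5) / 2 = 1" by (simp add: field_simps)
  then have st: "s + t = 1" unfolding s_def t_def fps_const_add of_real_add[symmetric] by simp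
  have "(1 + sqrt 5) / 2 * ((1 - sqrt 5) / 2) = - 1"
    by (simp add: algebra_simps)
  then have st': "s * t = - 1" unfolding s_def t_def fps_const_mult of_real_mult[symmetric] by simp
  have tw: "a * fps_twist (z ^ j) (euler 1) = (a - fps_const z ^ j * (s * b)) * (a - fps_const z ^ j * (t * b))" for j
  proof -
    have y: "(z ^ j) ^ 5 = 1" by (metis f(1) mult.commute power_mult power_one)
    have "fps_twist (z ^ j) (euler 1) = a - fps_const (z ^ j) * b - fps_const ((z ^ j)\<^sup>2) * c"
      unfolding e fps_twist_diff fclass_twist[OF ca y] fclass_twist[OF cb y] fclass_twist[OF cc y] by simp
    then have "fps_twist (z ^ j) (euler 1) = a - fps_const z ^ j * b - (fps_const z ^ j)\<^sup>2 * c"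
      by (simp add: fps_const_power)
    moreover have "a * (a - y * b - y\<^sup>2 * c) = (a - y * (s * b)) * (a - y * (t * b))" for y
      using ac st st' by algebra
    ultimately show ?thesis by (simp only:)
  qed
  have "a ^ 5 * ?P = (\<Prod>j<5. a * fps_twist (z ^ j) (euler 1))" by (simp add: prod.distrib)
  also have "\<dots> = (a ^ 5 - (s * b) ^ 5) * (a ^ 5 - (t * b) ^ 5)"
    unfolding tw prod.distrib prod_fifth_roots[OF const_rel(2)[OF z]] ..
  also have "\<dots> = a ^ 5 * (a ^ 5 - 11 * b ^ 5 - c ^ 5)"
  proof -
    have t: "t = 1 - s" using st by (simp add: algebra_simps)
    have s2: "s\<^sup>2 = s + 1" using st st' by algebra
    have s5: "s ^ 5 = 5 * s + 3" using s2 by algebra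
    have "t\<^sup>2 = t + 1" using st st' by algebra
    then have t5: "t ^ 5 = 5 * t + 3" by algebra
    have b10: "b ^ 10 = a ^ 5 * c ^ 5"
      using ac by (metis power_mult_distrib power_mult mult_numeral_1_right num_double numeral_times_numeral)
    \<comment> \<open>s and t are the golden ratio and its conjugate; their fifth powers have
      product -1 and sum 11, the fifth Lucas number, which is the origin of the 11.\<close>
    have "(5 * s + 3) * (5 * t + 3) = - 1" "(5 * s + 3) + (5 * t + 3) = 11" using st st' by algebra+
    then show ?thesis unfolding power_mult_distrib s5 t5 using b10 by algebra
  qed
  finally have "?P = a ^ 5 - 11 * b ^ 5 - c ^ 5" using a0 by simp
  then have "(a ^ 5 - 11 * b ^ 5 - c ^ 5) * euler 25 = euler 5 ^ 6" using norm by (simp add: mult.commute)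
  then have "?h ((A ^ 5 - 11 * B ^ 5 - C ^ 5) * euler 25) = ?h (euler 5 ^ 6)"
    by (simp add: a_def b_def c_def of_int_hom.map_mult of_int_hom.map_minus of_int_hom.map_power of_int_hom.map_numeral)
  then show ?thesis by (rule fps_map_of_int_inj)
qed

lemma dual_class_fclass: "fclass 5 0 (a4_dual_class 0)" "fclass 5 2 (a4_dual_class 1)" "fclass 5 3 (a4_dual_class 2)"
proof -
  have key: "int ((nat \<circ> a4_dual) v) mod 5 = 2 * (k * k) mod 5" if "v \<in> a4_dual_coset k" for v k
  proof -
    obtain p q r s where v: "v = (p, q, r, s)" by (cases v)
    have k: "(p + q + r + s) mod 5 = k" using that v by (simp add: a4_dual_coset_def)
    have "a4_dual v = 2 * ((p + q + r + s) * (p + q + r + s)) + 5 * (- (p * q + p * r + p * s + q * r + q * s + r * s))"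
      unfolding v by (simp add: a4_dual_def algebra_simps power2_eq_square)
    then have "a4_dual v mod 5 = 2 * ((p + q + r + s) * (p + q + r + s)) mod 5"
      by (simp only: mod_mult_self2)
    also have "\<dots> = 2 * (((p + q + r + s) mod 5) * ((p + q + r + s) mod 5)) mod 5"
      by (intro mod_mult_cong) simp_all
    finally show ?thesis using adual_nonneg[of v] by (simp add: k)
  qed
  have nat: "n mod 5 = i" if "int n mod 5 = int i" for n i :: nat
  proof -
    have "int (n mod 5) = int i" using that by (simp add: of_nat_mod)
    then show ?thesis by (simp only: of_nat_eq_iff)
  qed
  show "fclass 5 0 (a4_dual_class 0)" "fclass 5 2 (a4_dual_class 1)" "fclass 5 3 (a4_dual_class 2)"
    unfolding a4_dual_class_def using key[of _ 0] key[of _ 1] key[of _ 2]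
    by (auto intro!: lsum_fclass nat)
qed

text \<open>Write D_i for \<open>a4_dual_class i\<close>. The theta series of the dual is D_0 + 2
  D_1 + 2 D_2, already 5-dissected, and also E_1^5 / E_5 + 5 q E_5^5 / E_1. Dissecting the latter
  through A, B, C determines D_1 and D_2, and in their product only B and the norm M
  survive.\<close>

lemma dual_class_product:
  "euler 5 ^ 2 * (4 * a4_dual_class 1 * a4_dual_class 2) = 200 * fps_X ^ 5 * euler 25 ^ 4 * euler 5 ^ 6 + 2500 * fps_X ^ 10 * euler 25 ^ 10"
proof -
  obtain A B C :: "int fps" where cls: "fclass 5 0 A" "fclass 5 1 B" "fclass 5 2 C" and B: "B = fps_X * euler 25"
    and E: "euler 1 = A - B - C" and AC: "A * C = B\<^sup>2" and A0: "A $ 0 = 1"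
    by (rule euler_dissection)
  note norm = euler_norm_dissection[OF cls E AC A0]
  define M where "M = A ^ 5 - 11 * B ^ 5 - C ^ 5"
  \<comment> \<open>The quotient of \<open>M\<close> by E_1 = A - B - C modulo A C = B^2. It
    expresses q E_5^6 / E_1 as the polynomial \<open>B * N\<close>, whose residue classes can be
    read off.\<close>
  define N where "N = A ^ 4 + A ^ 3 * B + 2 * A\<^sup>2 * B\<^sup>2 + 3 * A * B ^ 3 + 5 * B ^ 4 - 3 * B ^ 3 * C + 2 * B\<^sup>2 * C\<^sup>2 - B * C ^ 3 + C ^ 4"
  have MN: "M = euler 1 * N" unfolding M_def N_def E using AC by algebra
  have M: "M * euler 25 = euler 5 ^ 6" using norm by (simp add: M_def)
  have "euler 1 * (euler 5 * a4_class 1) = euler 1 * (5 * B * N)"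
  proof -
    have "euler 1 * (euler 5 * a4_class 1) = 5 * fps_X * euler 5 ^ 6"
      using af_class_1 by algebra
    also have "\<dots> = 5 * B * (euler 1 * N)" unfolding M[symmetric] B MN[symmetric] by (simp add: ac_simps)
    finally show ?thesis by (simp add: ac_simps)
  qed
  then have s1: "euler 5 * a4_class 1 = 5 * B * N" using euler_nonzero[of 1, where 'a = int] by simp
  have T: "a4_class 0 = a4_dual_class 0 + 2 * a4_dual_class 1 + 2 * a4_dual_class 2"
    using dual_split af_class_0 by simp
  \<comment> \<open>Grouped by exponents modulo 5 into the classes 0, 2 and 3. The relation A C =
    B^2 makes the contributions of class 1 and 4 cancel.\<close>
  have s0: "euler 5 * a4_class 0 = (A ^ 5 + 14 * B ^ 5 - C ^ 5) + 10 * (A ^ 3 * B\<^sup>2 + 2 * (B ^ 3 * C\<^sup>2)) + 10 * (2 * (A\<^sup>2 * B ^ 3) - B\<^sup>2 * C ^ 3)"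
  proof -
    have "euler 5 * a4_class 0 = euler 1 ^ 5 + 5 * B * N" using af_class_diff s1 by algebra
    also have "\<dots> = (A ^ 5 + 14 * B ^ 5 - C ^ 5) + 10 * (A ^ 3 * B\<^sup>2 + 2 * (B ^ 3 * C\<^sup>2)) + 10 * (2 * (A\<^sup>2 * B ^ 3) - B\<^sup>2 * C ^ 3)"
      unfolding N_def E using AC by algebra
    finally show ?thesis .
  qed
  have p: "fclass 5 0 (A ^ 5)" "fclass 5 0 (B ^ 5)" "fclass 5 0 (C ^ 5)" "fclass 5 0 (A ^ 3)" "fclass 5 2 (B\<^sup>2)"
    "fclass 5 3 (B ^ 3)" "fclass 5 4 (C\<^sup>2)" "fclass 5 0 (A\<^sup>2)" "fclass 5 1 (C ^ 3)"
    using fclass_power[OF cls(1), of 5] fclass_power[OF cls(2), of 5] fclass_power[OF cls(3), of 5] fclass_power[OF cls(1), of 3]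
      fclass_power[OF cls(2), of 2] fclass_power[OF cls(2), of 3] fclass_power[OF cls(3), of 2] fclass_power[OF cls(1), of 2]
      fclass_power[OF cls(3), of 3] by simp_all
  have q: "fclass 5 2 (A ^ 3 * B\<^sup>2)" "fclass 5 2 (B ^ 3 * C\<^sup>2)" "fclass 5 3 (A\<^sup>2 * B ^ 3)" "fclass 5 3 (B\<^sup>2 * C ^ 3)"
    by (rule fclass_mult[OF p(4,5)] fclass_mult[OF p(6,7)] fclass_mult[OF p(8,6)] fclass_mult[OF p(5,9)]; simp)+
  have z: "fclass 5 1 (0 :: int fps)" "fclass 5 4 (0 :: int fps)" by (simp_all add: fclass_def)
  have f0: "fclass 5 0 (A ^ 5 + 14 * B ^ 5 - C ^ 5)" by (intro fclass_add fclass_diff fclass_cmult p)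
  have f2: "fclass 5 2 (10 * (A ^ 3 * B\<^sup>2 + 2 * (B ^ 3 * C\<^sup>2)))" by (intro fclass_add fclass_diff fclass_cmult q)
  have f3: "fclass 5 3 (10 * (2 * (A\<^sup>2 * B ^ 3) - B\<^sup>2 * C ^ 3))" by (intro fclass_add fclass_diff fclass_cmult q)
  have e5: "fclass 5 0 (euler 5 :: int fps)" by (rule fclass_euler) simp
  have g0: "fclass 5 0 (euler 5 * a4_dual_class 0)" by (rule fclass_mult[OF e5 dual_class_fclass(1)]) simp
  have g2: "fclass 5 2 (euler 5 * (2 * a4_dual_class 1))" by (rule fclass_mult[OF e5 fclass_cmult[OF dual_class_fclass(2)]]) simp
  have g3: "fclass 5 3 (euler 5 * (2 * a4_dual_class 2))" by (rule fclass_mult[OF e5 fclass_cmult[OF dual_class_fclass(3)]]) simp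
  have sf: "euler 5 * a4_class 0 = (A ^ 5 + 14 * B ^ 5 - C ^ 5) + 0 + 10 * (A ^ 3 * B\<^sup>2 + 2 * (B ^ 3 * C\<^sup>2)) + 10 * (2 * (A\<^sup>2 * B ^ 3) - B\<^sup>2 * C ^ 3) + 0"
    using s0 by simp
  have sg: "euler 5 * a4_class 0 = euler 5 * a4_dual_class 0 + 0 + euler 5 * (2 * a4_dual_class 1) + euler 5 * (2 * a4_dual_class 2) + 0"
    unfolding T by (simp add: distrib_left)
  have D1: "euler 5 * (2 * a4_dual_class 1) = 10 * (A ^ 3 * B\<^sup>2 + 2 * (B ^ 3 * C\<^sup>2))"
    using section_five(3)[OF f0 z(1) f2 f3 z(2) sf] section_five(3)[OF g0 z(1) g2 g3 z(2) sg] by simp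
  have D2: "euler 5 * (2 * a4_dual_class 2) = 10 * (2 * (A\<^sup>2 * B ^ 3) - B\<^sup>2 * C ^ 3)"
    using section_five(4)[OF f0 z(1) f2 f3 z(2) sf] section_five(4)[OF g0 z(1) g2 g3 z(2) sg] by simp
  have "euler 5 ^ 2 * (4 * a4_dual_class 1 * a4_dual_class 2) = (euler 5 * (2 * a4_dual_class 1)) * (euler 5 * (2 * a4_dual_class 2))"
    by (simp add: power2_eq_square)
  also have "\<dots> = 100 * (A ^ 3 * B\<^sup>2 + 2 * (B ^ 3 * C\<^sup>2)) * (2 * (A\<^sup>2 * B ^ 3) - B\<^sup>2 * C ^ 3)"
    unfolding D1 D2 by algebra
  also have "\<dots> = 100 * B ^ 5 * (2 * M + 25 * B ^ 5)" unfolding M_def using AC by algebra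
  also have "\<dots> = 200 * fps_X ^ 5 * euler 25 ^ 4 * (M * euler 25) + 2500 * fps_X ^ 10 * euler 25 ^ 10"
    unfolding B by algebra
  finally show ?thesis unfolding M .
qed

text \<open>The A_4 series is (B + 5 C) + 4 * 5 C = B + 25 C, and B C = q E_1^4 E_5^4 turns
  \<open>dual_class_product\<close> into 200 B C + 2500 C^2. Hence 250 = 50 + 200 and 3125 = 625 +
  2500.\<close>

lemma e8_theta_level5:
  obtains B C where "euler 5 * B = euler 1 ^ 5" "euler 1 * C = fps_X * euler 5 ^ 5" "e8_theta = B\<^sup>2 + 250 * B * C + 3125 * C\<^sup>2"
proof -
  define B where "B = a4_class 0 - a4_class 1"
  define C where "C = fps_X * lcount UNIV (\<lambda>(p, q, r, s). nat (5 * a4_form (p, q, r, s) + p + 2 * q + 3 * r + 4 * s))"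
  have s1: "a4_class 1 = 5 * C" using af_class_2_core by (simp add: C_def af_classes mult.assoc)
  have EB: "euler 5 * B = euler 1 ^ 5" using af_class_diff by (simp add: B_def)
  have EC: "euler 1 * C = fps_X * euler 5 ^ 5"
    using af_core[where 'a = int] unfolding C_def by (simp only: mult.left_commute)
  have D0: "a4_dual_class 0 = fps_stretch 5 (B + 25 * C)"
    unfolding dual_class_0 af_split B_def s1 by (simp add: add.commute)
  have "fps_stretch 5 (euler 1 ^ 2 * e8_theta) = euler 5 ^ 2 * (a4_dual_class 0 ^ 2 + 4 * a4_dual_class 1 * a4_dual_class 2)"
    by (simp add: fps_stretch_mult fps_stretch_power fps_stretch_euler e8_dual)
  also have "\<dots> = euler 5 ^ 2 * a4_dual_class 0 ^ 2 + (200 * fps_X ^ 5 * euler 25 ^ 4 * euler 5 ^ 6 + 2500 * fps_X ^ 10 * euler 25 ^ 10)"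
    unfolding distrib_left dual_class_product ..
  also have "\<dots> = fps_stretch 5 (euler 1 ^ 2 * (B + 25 * C) ^ 2 + (200 * fps_X * euler 5 ^ 4 * euler 1 ^ 6 + 2500 * fps_X ^ 2 * euler 5 ^ 10))"
    by (simp add: D0 fps_stretch_mult fps_stretch_add fps_stretch_power fps_stretch_euler fps_stretch_numeral fps_stretch_X power_mult[symmetric])
  finally have eq: "euler 1 ^ 2 * e8_theta = euler 1 ^ 2 * (B + 25 * C) ^ 2 + (200 * fps_X * euler 5 ^ 4 * euler 1 ^ 6 + 2500 * fps_X ^ 2 * euler 5 ^ 10)"
    by (rule fps_stretch_inj[rotated]) simp
  have "euler 1 * euler 5 * (euler 1 ^ 2 * (B * C)) = euler 1 * euler 5 * (fps_X * euler 5 ^ 4 * euler 1 ^ 6)"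
    using EB EC by algebra
  then have "euler 1 ^ 2 * (B * C) = fps_X * euler 5 ^ 4 * euler 1 ^ 6"
    by (subst (asm) mult_left_cancel) (simp_all add: euler_nonzero)
  moreover have "euler 1 ^ 2 * C ^ 2 = fps_X ^ 2 * euler 5 ^ 10" using EC by algebra
  ultimately have "euler 1 ^ 2 * e8_theta = euler 1 ^ 2 * (B\<^sup>2 + 250 * B * C + 3125 * C\<^sup>2)"
    using eq by algebra
  then have "e8_theta = B\<^sup>2 + 250 * B * C + 3125 * C\<^sup>2"
    by (subst (asm) mult_left_cancel) (simp_all add: euler_nonzero)
  with EB EC show ?thesis using that by blast
qed

text \<open>216 = 8 * 27, the 27 being the cube of the 3 in \<open>hex_class_1\<close>.\<close>

lemma e8_theta_level3:
  "euler 1 ^ 3 * e8_theta = hex_theta * (euler 1 ^ 3 * hex_theta ^ 3 + 216 * fps_X * euler 3 ^ 9)"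
proof -
  have "fps_stretch 3 (euler 1 ^ 3 * e8_theta) = euler 3 ^ 3 * (hex_class 0 ^ 4 + 8 * hex_class 0 * hex_class 1 ^ 3)"
    by (simp add: fps_stretch_mult fps_stretch_power fps_stretch_euler e8_hexagonal)
  also have "\<dots> = hex_class 0 * (euler 3 ^ 3 * hex_class 0 ^ 3 + 216 * fps_X ^ 3 * euler 9 ^ 9)"
    using hex_class_1 by algebra
  also have "\<dots> = fps_stretch 3 (hex_theta * (euler 1 ^ 3 * hex_theta ^ 3 + 216 * fps_X * euler 3 ^ 9))"
    by (simp add: hex_class_0 fps_stretch_mult fps_stretch_add fps_stretch_power fps_stretch_euler fps_stretch_numeral fps_stretch_X)
  finally show ?thesis by (rule fps_stretch_inj[rotated]) simp
qed

text \<open>After division by $E_1^3 E_3^3$ this is the cubic identity $a^3 = b^3 + c^3$ of the Borweins.\<close>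

lemma cubic_theta_identity:
  "euler 3 ^ 3 * euler 1 ^ 3 * hex_theta ^ 3 = euler 1 ^ 12 + 27 * fps_X * euler 3 ^ 12"
proof -
  have "euler 9 ^ 3 * (euler 3 ^ 3 * euler 1 ^ 3 * (hex_class 0 + 2 * hex_class 1) ^ 3) =
    euler 9 ^ 3 * (euler 1 ^ 12 + 27 * fps_X * euler 3 ^ 12)"
    using hex_class_1 hex_class_diff hex_norm by algebra
  then show ?thesis
    unfolding hex_theta_split by (subst (asm) mult_left_cancel) (simp_all add: euler_nonzero)
qed

text \<open>With a = H_0 + 2 H_1 and b = H_0 - H_1 one has H_0^4 + 8 H_0 H_1^3 = a (a^3 + 8 b^3) /
  9, and b^3 = a^3 - 27 q E_3^9 / E_1^3 turns this into the right side.\<close>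

lemma e8_theta_stretch3:
  "euler 1 ^ 3 * fps_stretch 3 e8_theta = hex_theta * (euler 1 ^ 3 * hex_theta ^ 3 - 24 * fps_X * euler 3 ^ 9)"
proof -
  have "euler 9 ^ 3 * (euler 3 * (euler 1 ^ 3 * (hex_class 0 ^ 4 + 8 * hex_class 0 * hex_class 1 ^ 3)))
    = euler 9 ^ 3 * (euler 3 * ((hex_class 0 + 2 * hex_class 1) * (euler 1 ^ 3 * (hex_class 0 + 2 * hex_class 1) ^ 3 - 24 * fps_X * euler 3 ^ 9)))"
    using hex_class_1 hex_class_diff hex_norm by algebra
  then show ?thesis
    unfolding hex_theta_split e8_hexagonal by (subst (asm) mult_left_cancel; simp add: euler_nonzero)+
qed

section \<open>Generating functions of the partition counts\<close>

lemma colored_row_iff: "colored_row k r \<longleftrightarrow> (\<forall>x\<in>set r. snd x < k) \<and> sorted_wrt (>) r"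
proof -
  have ge: "colored_ge x y \<longleftrightarrow> y \<le> x" for x y
    by (cases x; cases y) (auto simp: colored_ge_def less_eq_prod_def)
  have "sorted_wrt colored_ge r \<and> distinct_adj r \<longleftrightarrow> sorted_wrt (>) r"
  proof (induction r)
    case (Cons x r)
    show ?case
    proof (cases r)
      case (Cons y r')
      have "(\<forall>u\<in>set r. u \<le> x) \<and> x \<noteq> y \<longleftrightarrow> (\<forall>u\<in>set r. u < x)" if "sorted_wrt (>) r"
        using that unfolding Cons by (auto simp: order.strict_iff_order) 
      then show ?thesis using Cons.IH unfolding Cons by (auto simp: ge)
    qed simp
  qed simp
  then show ?thesis unfolding colored_row_def by blast
qed

lemma prod_one_plus:
  fixes f :: "'b \<Rightarrow> 'a::comm_ring_1"
  assumes "finite A"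
  shows "(\<Prod>x\<in>A. 1 + f x) = (\<Sum>S\<in>Pow A. prod f S)"
  using prod_add[OF assms, of f "\<lambda>_. 1"] by (simp add: add.commute)

lemma prod_monomials:
  "(\<Prod>x\<in>S. fps_const (fls_X_intpow d) * fps_X ^ h x :: int fls fps) = fps_const (fls_X_intpow (d * int (card S))) * fps_X ^ (\<Sum>x\<in>S. h x)"
  by (simp add: prod.distrib power_sum fps_const_power[symmetric] fls_X_intpow_power mult.commute)

text \<open>By \<open>colored_row_iff\<close> a row is strictly decreasing for the lexicographic
  order, hence the same as a finite set of entries. The 1 of each column is charged to the upper
  row.\<close>

definition fset_pairs :: "nat \<Rightarrow> nat \<Rightarrow> ((nat \<times> nat) set \<times> (nat \<times> nat) set) set" where
  "fset_pairs k n = {(S, T). finite S \<and> finite T \<and> snd ` S \<subseteq> {..<k} \<and> snd ` T \<subseteq> {..<k} \<and>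
     card S = card T \<and> (\<Sum>x\<in>S. fst x + 1) + (\<Sum>x\<in>T. fst x) = n}"

lemma row_weight:
  assumes "sorted_wrt (>) (a :: (nat \<times> nat) list)" "sorted_wrt (>) (b :: (nat \<times> nat) list)" "length a = length b"
  shows "(\<Sum>i<length a. fst (a ! i) + fst (b ! i) + 1) = (\<Sum>x\<in>set a. fst x + 1) + (\<Sum>x\<in>set b. fst x)"
proof -
  have s: "(\<Sum>i<length xs. g (xs ! i)) = (\<Sum>x\<in>set xs. g x)" if "sorted_wrt (>) xs" for xs :: "(nat \<times> nat) list" and g :: "nat \<times> nat \<Rightarrow> nat"
  proof -
    have "distinct xs"
      using that by (induction xs) auto
    then have "(\<Sum>x\<in>set xs. g x) = sum_list (map g xs)" by (simp add: sum_list_distinct_conv_sum_set)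
    then show ?thesis by (simp add: sum_list_sum_nth atLeast0LessThan)
  qed
  have "(\<Sum>i<length a. fst (a ! i) + fst (b ! i) + 1) = (\<Sum>i<length a. fst (a ! i) + 1) + (\<Sum>i<length b. fst (b ! i))"
    using assms(3) by (simp add: sum.distrib[symmetric])
  also have "\<dots> = (\<Sum>x\<in>set a. fst x + 1) + (\<Sum>x\<in>set b. fst x)"
    using s[OF assms(1), of "\<lambda>x. fst x + 1"] s[OF assms(2), of fst] by simp
  finally show ?thesis .
qed

lemma sorted_desc_unique: "sorted_wrt (>) xs \<Longrightarrow> sorted_wrt (>) ys \<Longrightarrow> set xs = set ys \<Longrightarrow> xs = ys"
  for xs ys :: "'a::linorder list"
  using strict_sorted_equal[of "rev xs" "rev ys"] by (simp add: sorted_wrt_rev)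

lemma cphi_fset_pairs: "cphi k n = card (fset_pairs k n)"
  unfolding cphi_def
proof (rule bij_betw_same_card[where f = "\<lambda>(a, b). (set a, set b)"], rule bij_betw_imageI)
  have d: "sorted_wrt (>) xs \<Longrightarrow> distinct xs" for xs :: "(nat \<times> nat) list"
    by (induction xs) auto
  show "inj_on (\<lambda>(a, b). (set a, set b)) (colored_frobenius_partitions k n)"
    by (rule inj_onI) (auto simp: colored_frobenius_partitions_def colored_row_iff intro: sorted_desc_unique)
  show "(\<lambda>(a, b). (set a, set b)) ` colored_frobenius_partitions k n = fset_pairs k n"
  proof (intro subset_antisym subsetI)
    fix p assume "p \<in> (\<lambda>(a, b). (set a, set b)) ` colored_frobenius_partitions k n"
    then obtain a b where p: "p = (set a, set b)" and len: "length a = length b"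
      and r: "colored_row k a" "colored_row k b" and n: "n = (\<Sum>i<length a. fst (a ! i) + fst (b ! i) + 1)"
      by (auto simp: colored_frobenius_partitions_def)
    from r have s: "sorted_wrt (>) a" "sorted_wrt (>) b" by (simp_all add: colored_row_iff)
    have "n = (\<Sum>x\<in>set a. fst x + 1) + (\<Sum>x\<in>set b. fst x)"
      unfolding n by (rule row_weight[OF s len])
    then show "p \<in> fset_pairs k n"
      using r len d[OF s(1)] d[OF s(2)] unfolding p fset_pairs_def
      by (auto simp: colored_row_iff distinct_card)
  next
    fix p assume "p \<in> fset_pairs k n"
    then obtain S T where p: "p = (S, T)" and f: "finite S" "finite T" and c: "snd ` S \<subseteq> {..<k}" "snd ` T \<subseteq> {..<k}" "card S = card T"
      and n: "(\<Sum>x\<in>S. fst x + 1) + (\<Sum>x\<in>T. fst x) = n" by (auto simp: fset_pairs_def)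
    let ?a = "rev (sorted_list_of_set S)" and ?b = "rev (sorted_list_of_set T)"
    have s: "sorted_wrt (>) ?a" "sorted_wrt (>) ?b" by (simp_all add: sorted_wrt_rev)
    have len: "length ?a = length ?b" using c(3) by simp
    have "(?a, ?b) \<in> colored_frobenius_partitions k n"
      using s len c f n row_weight[OF s len] by (auto simp: colored_frobenius_partitions_def colored_row_iff)
    moreover have "p = (\<lambda>(a, b). (set a, set b)) (?a, ?b)" using p f by simp
    ultimately show "p \<in> (\<lambda>(a, b). (set a, set b)) ` colored_frobenius_partitions k n" by (rule rev_image_eqI)
  qed
qed

text \<open>An entry of the upper row is charged z q^(size + 1), one of the lower row z^-1 q^size,
  so equal length of the rows means degree 0 in z. Three colours give the cube of \<open>?J\<close>;
  by the triple product \<open>?J\<close> is a theta series divided by E_1, and the constant term of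
  the cubed theta series runs over triples with sum 0.\<close>

theorem cphi_3_generating_function: "hex_theta = euler 1 ^ 3 * Abs_fps (\<lambda>n. int (cphi 3 n))"
proof -
  let ?Z = "fls_X_intpow :: int \<Rightarrow> int fls"
  let ?A = "\<lambda>n. 1 + fps_const (?Z 1) * fps_X ^ (n + 1)" and ?B = "\<lambda>n. 1 + fps_const (?Z (-1)) * fps_X ^ n"
  let ?t = "zsum UNIV (jexp 1 1) (\<lambda>k. 1 :: int) (\<lambda>k. k)"
  let ?J = "fps_iprod ?A * fps_iprod ?B"
  have tA: "tame ?A" and tB: "tame ?B" by (rule tame_one_plus; simp)+
  have t: "?t = euler 1 * ?J"
    using zsum_jacobi[where N = 1 and a = 1 and b = 0 and d = 1 and c = "\<lambda>k. 1 :: int"] by (simp add: ac_simps)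
  have "hex_theta = ztop (?t * (?t * ?t))"
    unfolding hex_theta_def by (subst ztop_prod3) (auto intro!: finfib_jexp lsum_cong simp: hex_form_jexp[simplified])
  also have "?t * (?t * ?t) = euler 1 ^ 3 * ?J ^ 3" unfolding t by (simp add: power3_eq_cube ac_simps)
  also have "ztop \<dots> = euler 1 ^ 3 * ztop (?J ^ 3)" by (rule ztop_euler_power_mult)
  also have "ztop (?J ^ 3) = Abs_fps (\<lambda>n. int (cphi 3 n))"
  proof (rule fps_ext)
    fix n :: nat
    \<comment> \<open>A part of size above \<open>n\<close> cannot occur in weight \<open>n\<close>,
      so finitely many factors suffice for coefficient \<open>n\<close>.\<close>
    let ?D = "{..n} \<times> {..<3::nat}"
    have J: "fps_eq_below (Suc n) ?J ((\<Prod>k\<le>n. ?A k) * (\<Prod>k\<le>n. ?B k))"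
      by (intro fps_eq_below_mult fps_iprod_below tA tB) simp_all
    have "fps_eq_below (Suc n) (?J ^ 3) (((\<Prod>k\<le>n. ?A k) * (\<Prod>k\<le>n. ?B k)) ^ 3)"
      unfolding power3_eq_cube by (intro fps_eq_below_mult J)
    also have "((\<Prod>k\<le>n. ?A k) * (\<Prod>k\<le>n. ?B k)) ^ 3 = (\<Prod>x\<in>?D. ?A (fst x)) * (\<Prod>x\<in>?D. ?B (fst x))"
    proof -
      have "(\<Prod>x\<in>?D. g (fst x)) = (\<Prod>k\<le>n. g k) ^ 3" for g :: "nat \<Rightarrow> int fls fps"
        using prod.cartesian_product[of "\<lambda>k _. g k" "{..<3::nat}" "{..n}"]
        by (simp add: case_prod_beta prod_power_distrib)
      note P = this
      show ?thesis unfolding power_mult_distrib P[of ?A] P[of ?B] ..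
    qed
    also have "\<dots> = (\<Sum>S\<in>Pow ?D. \<Sum>T\<in>Pow ?D. fps_const (?Z (int (card S) - int (card T))) * fps_X ^ ((\<Sum>x\<in>S. fst x + 1) + (\<Sum>x\<in>T. fst x)))"
    proof -
      have fin: "finite ?D" by simp
      have "(\<Prod>x\<in>?D. ?A (fst x)) = (\<Sum>S\<in>Pow ?D. fps_const (?Z (int (card S))) * fps_X ^ (\<Sum>x\<in>S. fst x + 1))"
        unfolding prod_one_plus[OF fin] by (intro sum.cong refl) (simp only: prod_monomials mult_1)
      moreover have "(\<Prod>x\<in>?D. ?B (fst x)) = (\<Sum>S\<in>Pow ?D. fps_const (?Z (- int (card S))) * fps_X ^ (\<Sum>x\<in>S. fst x))"
        unfolding prod_one_plus[OF fin] by (intro sum.cong refl) (simp only: prod_monomials mult_minus1)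
      moreover have "(fps_const (?Z i) * fps_X ^ k) * (fps_const (?Z (- j)) * fps_X ^ l) = fps_const (?Z (i - j)) * fps_X ^ (k + l)" for i j k l
      proof -
        have "(fps_const (?Z i) * fps_X ^ k) * (fps_const (?Z (- j)) * fps_X ^ l) = fps_const (?Z i * ?Z (- j)) * fps_X ^ (k + l)"
          by (simp add: power_add fps_const_mult[symmetric] ac_simps del: fps_const_mult)
        then show ?thesis by (simp only: fls_X_intpow_times_fls_X_intpow diff_conv_add_uminus)
      qed
      ultimately show ?thesis by (simp only: sum_product)
    qed
    finally have "(?J ^ 3) $ n = (\<Sum>S\<in>Pow ?D. \<Sum>T\<in>Pow ?D. if (\<Sum>x\<in>S. fst x + 1) + (\<Sum>x\<in>T. fst x) = n then ?Z (int (card S) - int (card T)) else 0)"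
      by (auto simp: fps_eq_below_def fps_sum_nth fps_X_power_iff intro!: sum.cong)
    then have "ztop (?J ^ 3) $ n = (\<Sum>S\<in>Pow ?D. \<Sum>T\<in>Pow ?D. if (\<Sum>x\<in>S. fst x + 1) + (\<Sum>x\<in>T. fst x) = n \<and> card S = card T then 1 else 0)"
      by (auto simp: ztop_def fls_nth_sum intro!: sum.cong)
    also have "\<dots> = (\<Sum>p\<in>Pow ?D \<times> Pow ?D. if p \<in> fset_pairs 3 n then 1 else 0)"
      unfolding sum.cartesian_product
      by (intro sum.cong) (auto simp: fset_pairs_def split: if_splits intro: finite_subset[of _ ?D])
    also have "\<dots> = int (card {p \<in> Pow ?D \<times> Pow ?D. p \<in> fset_pairs 3 n})"
      by (subst sum.inter_filter[symmetric]) auto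
    also have "{p \<in> Pow ?D \<times> Pow ?D. p \<in> fset_pairs 3 n} = fset_pairs 3 n"
    proof -
      have "S \<subseteq> ?D \<and> T \<subseteq> ?D" if "(S, T) \<in> fset_pairs 3 n" for S T
      proof -
        from that have f: "finite S" "finite T" "snd ` S \<subseteq> {..<3}" "snd ` T \<subseteq> {..<3}"
          and n: "(\<Sum>x\<in>S. fst x + 1) + (\<Sum>x\<in>T. fst x) = n" by (auto simp: fset_pairs_def)
        have "fst x \<le> n" if "x \<in> S" for x
          using member_le_sum[of x S "\<lambda>x. fst x + 1"] that f n by auto
        moreover have "fst x \<le> n" if "x \<in> T" for x
          using member_le_sum[of x T fst] that f n by auto
        ultimately show ?thesis using f by (auto simp: mem_Times_iff)
      qed
      then show ?thesis by auto
    qed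
    finally show "ztop (?J ^ 3) $ n = Abs_fps (\<lambda>n. int (cphi 3 n)) $ n" by (simp add: cphi_fset_pairs)
  qed
  finally show ?thesis .
qed

section \<open>The 3-dissections of the generating function\<close>

lemma section_stretch:
  assumes "i < N"
  shows "fps_section N i f = fps_X ^ i * fps_stretch N (Abs_fps (\<lambda>n. f $ (N * n + i)))"
proof (rule fps_ext)
  fix n
  have N: "N > 0" using assms by simp
  show "fps_section N i f $ n = (fps_X ^ i * fps_stretch N (Abs_fps (\<lambda>n. f $ (N * n + i)))) $ n"
  proof (cases "n mod N = i")
    case True
    then have n: "n = N * (n div N) + i" using mult_div_mod_eq[of N n] by simp
    then obtain m where "n = N * m + i" by blast
    then show ?thesis using N assms by (simp add: fps_section_def fps_X_power_mult_nth fps_stretch_nth)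
  next
    case False
    have "\<not> N dvd n - i" if "i \<le> n"
    proof
      assume "N dvd n - i"
      then obtain m where "n - i = N * m" by (elim dvdE)
      then have "n = N * m + i" using that by simp
      then show False using False assms by simp
    qed
    then show ?thesis using N False by (simp add: fps_section_def fps_X_power_mult_nth fps_stretch_nth)
  qed
qed

lemma section_mult_class_0:
  fixes f g :: "'a::comm_ring_1 fps"
  assumes "fclass N 0 g" "N > 0"
  shows "fps_section N i (g * f) = g * fps_section N i f"
proof (rule fps_ext)
  fix n
  have "g $ l * fps_section N i f $ (n - l) = (if n mod N = i then g $ l * f $ (n - l) else 0)" if "l \<le> n" for l
  proof (cases "l mod N = 0")
    case True
    then have "(n - l) mod N = n mod N"
      using that by (metis mod_0_imp_dvd mod_eq_dvd_iff_nat diff_diff_cancel diff_le_self)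
    then show ?thesis by (simp add: fps_section_def)
  next
    case False
    then show ?thesis using assms(1) by (simp add: fclass_def)
  qed
  then have "(g * fps_section N i f) $ n = (\<Sum>l=0..n. if n mod N = i then g $ l * f $ (n - l) else 0)"
    unfolding fps_mult_nth by (intro sum.cong) auto
  then show "fps_section N i (g * f) $ n = (g * fps_section N i f) $ n"
    by (simp add: fps_section_def fps_mult_nth)
qed

text \<open>The factor E_3 clears the denominators of the sections of a and of E_1^3 / E_3. What
  remains is polynomial algebra in P of class 0 and t of class 1.\<close>

lemma cubic_sections:
  obtains P t :: "int fps" where "P = euler 3 * fps_stretch 3 hex_theta" "t = 3 * fps_X * euler 9 ^ 3"
    "euler 1 ^ 3 = P - t" "euler 3 * hex_theta = P + 2 * t" "euler 9 ^ 3 * (P ^ 3 - t ^ 3) = euler 3 ^ 12"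
    "fclass 3 0 P" "fclass 3 1 t"
proof
  let ?P = "euler 3 * hex_class 0" and ?t = "euler 3 * hex_class 1"
  show "?P = euler 3 * fps_stretch 3 hex_theta" "?t = 3 * fps_X * euler 9 ^ 3"
    by (simp_all add: hex_class_0 hex_class_1)
  show "euler 1 ^ 3 = ?P - ?t" using hex_class_diff by (simp add: right_diff_distrib)
  show "euler 3 * hex_theta = ?P + 2 * ?t" unfolding hex_theta_split by algebra
  show "euler 9 ^ 3 * (?P ^ 3 - ?t ^ 3) = euler 3 ^ 12" using hex_norm by algebra
  have e3: "fclass 3 0 (euler 3 :: int fps)" by (rule fclass_euler) simp
  show "fclass 3 0 ?P" by (rule fclass_mult[OF e3 hex_class_fclass(1)]) simp
  show "fclass 3 1 ?t" by (rule fclass_mult[OF e3 hex_class_fclass(2)]) simp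
qed

text \<open>The denominator P - t is rationalised by P^2 + P t + t^2: it becomes P^3 - t^3, with
  exponents divisible by 3 only, and the numerator (P + 2 t) (P^2 + P t + t^2) has class 2 part 3 P
  t^2.\<close>

lemma cphi_3n_2:
  "euler 1 ^ 12 * Abs_fps (\<lambda>n. int (cphi 3 (3 * n + 2))) = 27 * hex_theta * euler 3 ^ 9"
proof -
  obtain P t :: "int fps" where P: "P = euler 3 * fps_stretch 3 hex_theta" and t: "t = 3 * fps_X * euler 9 ^ 3"
    and E: "euler 1 ^ 3 = P - t" and a: "euler 3 * hex_theta = P + 2 * t" and D: "euler 9 ^ 3 * (P ^ 3 - t ^ 3) = euler 3 ^ 12"
    and cP: "fclass 3 0 P" and ct: "fclass 3 1 t" by (rule cubic_sections)
  define f where "f = Abs_fps (\<lambda>n. int (cphi 3 n))"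
  define g where "g = Abs_fps (\<lambda>n. int (cphi 3 (3 * n + 2)))"
  have sec: "fps_section 3 2 f = fps_X ^ 2 * fps_stretch 3 g"
    by (subst section_stretch) (simp_all add: f_def g_def)
  have eq: "((P ^ 3 - t ^ 3) * euler 3) * f = (P ^ 3 + 2 * t ^ 3) + 3 * (P\<^sup>2 * t) + 3 * (P * t\<^sup>2)"
  proof -
    have "(P - t) * f = hex_theta" unfolding f_def E[symmetric] by (rule cphi_3_generating_function[symmetric])
    then have "euler 3 * ((P - t) * f) = P + 2 * t" using a by simp
    moreover have "((P ^ 3 - t ^ 3) * euler 3) * f = (P\<^sup>2 + P * t + t\<^sup>2) * (euler 3 * ((P - t) * f))" by algebra
    ultimately have "((P ^ 3 - t ^ 3) * euler 3) * f = (P\<^sup>2 + P * t + t\<^sup>2) * (P + 2 * t)" by (simp only:)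
    also have "\<dots> = (P ^ 3 + 2 * t ^ 3) + 3 * (P\<^sup>2 * t) + 3 * (P * t\<^sup>2)" by algebra
    finally show ?thesis .
  qed
  have e3: "fclass 3 0 (euler 3 :: int fps)" by (rule fclass_euler) simp
  have p: "fclass 3 0 (P ^ 3)" "fclass 3 0 (t ^ 3)" "fclass 3 0 (P\<^sup>2)" "fclass 3 2 (t\<^sup>2)"
    using fclass_power[OF cP, of 3] fclass_power[OF ct, of 3] fclass_power[OF cP, of 2] fclass_power[OF ct, of 2] by simp_all
  have c0: "fclass 3 0 (P ^ 3 + 2 * t ^ 3)" by (intro fclass_add fclass_cmult p)
  have c1: "fclass 3 1 (3 * (P\<^sup>2 * t))" by (intro fclass_cmult fclass_mult[OF p(3) ct]) simp
  have c2: "fclass 3 2 (3 * (P * t\<^sup>2))" by (intro fclass_cmult fclass_mult[OF cP p(4)]) simp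
  have cD: "fclass 3 0 ((P ^ 3 - t ^ 3) * euler 3)"
    by (rule fclass_mult[OF fclass_diff[OF p(1,2)] e3]) simp
  have "((P ^ 3 - t ^ 3) * euler 3) * (fps_X ^ 2 * fps_stretch 3 g) = 3 * (P * t\<^sup>2)"
    using section_three(3)[OF c0 c1 c2 eq] section_mult_class_0[OF cD, of 2 f] by (simp add: sec)
  then have "(euler 3 * fps_X ^ 2) * (euler 3 ^ 12 * fps_stretch 3 g) = (euler 3 * fps_X ^ 2) * (27 * fps_stretch 3 hex_theta * euler 9 ^ 9)"
    using P t D by algebra
  then have "euler 3 ^ 12 * fps_stretch 3 g = 27 * fps_stretch 3 hex_theta * euler 9 ^ 9"
    by (subst (asm) mult_left_cancel) (simp_all add: euler_nonzero)
  then have "fps_stretch 3 (euler 1 ^ 12 * g) = fps_stretch 3 (27 * hex_theta * euler 3 ^ 9)"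
    by (simp add: fps_stretch_mult fps_stretch_power fps_stretch_euler fps_stretch_numeral)
  then show ?thesis unfolding g_def by (rule fps_stretch_inj[rotated]) simp
qed

text \<open>The same rationalisation for the fourth power of P - t; the residue 3n + 2 with n = 3m +
  1 is 9m + 5.\<close>

lemma cphi_9n_5:
  "euler 1 ^ 38 * Abs_fps (\<lambda>n. int (cphi 3 (9 * n + 5))) = 243 * euler 3 ^ 15 * hex_theta\<^sup>2 *
     ((2 * euler 1 ^ 3 * hex_theta ^ 3 + 27 * fps_X * euler 3 ^ 9) * (euler 1 ^ 3 * hex_theta ^ 3 + 216 * fps_X * euler 3 ^ 9))"
proof -
  obtain P t :: "int fps" where P: "P = euler 3 * fps_stretch 3 hex_theta" and t: "t = 3 * fps_X * euler 9 ^ 3"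
    and E: "euler 1 ^ 3 = P - t" and a: "euler 3 * hex_theta = P + 2 * t" and D: "euler 9 ^ 3 * (P ^ 3 - t ^ 3) = euler 3 ^ 12"
    and cP: "fclass 3 0 P" and ct: "fclass 3 1 t" by (rule cubic_sections)
  define f where "f = Abs_fps (\<lambda>n. int (cphi 3 (3 * n + 2)))"
  define g where "g = Abs_fps (\<lambda>n. int (cphi 3 (9 * n + 5)))"
  have sec: "fps_section 3 1 f = fps_X * fps_stretch 3 g"
    by (subst section_stretch) (simp_all add: f_def g_def add.commute)
  define G where "G = (P ^ 3 - t ^ 3) ^ 4 * euler 3"
  let ?f0 = "27 * (euler 3 ^ 9 * (P ^ 9 + 36 * (P ^ 6 * t ^ 3) + 42 * (P ^ 3 * t ^ 6) + 2 * t ^ 9))"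
  \<comment> \<open>The last bracket factors as (2 P^3 + t^3) (P^3 + 8 t^3). With t^3 = 27 q^3 E_9^9
    these become the factors with 27 and 216, the second of which leads to the E_8 series.\<close>
  let ?f1 = "81 * (euler 3 ^ 9 * (t * (P\<^sup>2 * (2 * P ^ 6 + 17 * (P ^ 3 * t ^ 3) + 8 * t ^ 6))))"
  let ?f2 = "27 * (euler 3 ^ 9 * (t\<^sup>2 * (P * (18 * P ^ 6 + 54 * (P ^ 3 * t ^ 3) + 9 * t ^ 6))))"
  have eq: "G * f = ?f0 + ?f1 + ?f2"
  proof -
    have "(P - t) ^ 4 * f = 27 * hex_theta * euler 3 ^ 9"
      using cphi_3n_2 by (simp add: f_def E[symmetric] power_mult[symmetric])
    then have "euler 3 * (P - t) ^ 4 * f = 27 * (P + 2 * t) * euler 3 ^ 9" using a by algebra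
    moreover have "(P ^ 3 - t ^ 3) ^ 4 = (P - t) ^ 4 * (P\<^sup>2 + P * t + t\<^sup>2) ^ 4" by algebra
    moreover have "(P + 2 * t) * (P\<^sup>2 + P * t + t\<^sup>2) ^ 4 = (P ^ 9 + 36 * (P ^ 6 * t ^ 3) + 42 * (P ^ 3 * t ^ 6) + 2 * t ^ 9)
        + 3 * (t * (P\<^sup>2 * (2 * P ^ 6 + 17 * (P ^ 3 * t ^ 3) + 8 * t ^ 6))) + t\<^sup>2 * (P * (18 * P ^ 6 + 54 * (P ^ 3 * t ^ 3) + 9 * t ^ 6))"
      by algebra
    ultimately show ?thesis unfolding G_def by algebra
  qed
  have e3: "fclass 3 0 (euler 3 :: int fps)" by (rule fclass_euler) simp
  have p: "fclass 3 0 (P ^ 3)" "fclass 3 0 (t ^ 3)" "fclass 3 0 (P\<^sup>2)" "fclass 3 2 (t\<^sup>2)" "fclass 3 0 (P ^ 6)" "fclass 3 0 (t ^ 6)"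
    "fclass 3 0 (P ^ 9)" "fclass 3 0 (t ^ 9)" "fclass 3 0 (euler 3 ^ 9 :: int fps)"
    using fclass_power[OF cP, of 3] fclass_power[OF ct, of 3] fclass_power[OF cP, of 2] fclass_power[OF ct, of 2]
      fclass_power[OF cP, of 6] fclass_power[OF ct, of 6] fclass_power[OF cP, of 9] fclass_power[OF ct, of 9] fclass_power[OF e3, of 9]
    by simp_all
  have m0: "fclass 3 i x \<Longrightarrow> fclass 3 0 y \<Longrightarrow> i < 3 \<Longrightarrow> fclass 3 i (x * y)" for i and x y :: "int fps"
    by (rule fclass_mult[of 3 i x 0 y]) simp_all
  have c0: "fclass 3 0 ?f0" by (intro fclass_add fclass_cmult m0 p) simp_all
  have c1: "fclass 3 1 ?f1"
    by (intro fclass_cmult, rule fclass_mult[OF p(9), of 1]) (intro fclass_add fclass_cmult m0 p ct, simp_all)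
  have c2: "fclass 3 2 ?f2"
    by (intro fclass_cmult, rule fclass_mult[OF p(9), of 2]) (intro fclass_add fclass_cmult m0 p cP, simp_all)
  have cG: "fclass 3 0 G"
  proof -
    have "fclass 3 0 (P ^ 3 - t ^ 3)" by (intro fclass_diff p)
    from fclass_power[OF this, of 4] have "fclass 3 0 ((P ^ 3 - t ^ 3) ^ 4)" by simp
    then show ?thesis unfolding G_def by (rule fclass_mult[OF _ e3]) simp
  qed
  have g1: "G * (fps_X * fps_stretch 3 g) = ?f1"
    using section_three(2)[OF c0 c1 c2 eq] section_mult_class_0[OF cG, of 1 f] unfolding sec by simp
  have "euler 9 ^ 12 * G = euler 3 ^ 49"
  proof -
    have "euler 9 ^ 12 * G = (euler 9 ^ 3 * (P ^ 3 - t ^ 3)) ^ 4 * euler 3" unfolding G_def by algebra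
    also have "\<dots> = euler 3 ^ 49" unfolding D by algebra
    finally show ?thesis .
  qed
  then have g2: "euler 3 ^ 49 * (fps_X * fps_stretch 3 g) = euler 9 ^ 12 * ?f1" using g1 by algebra
  have "(euler 3 ^ 11 * fps_X) * (euler 3 ^ 38 * fps_stretch 3 g) = euler 3 ^ 49 * (fps_X * fps_stretch 3 g)" by algebra
  also have "\<dots> = (euler 3 ^ 11 * fps_X) * (243 * euler 9 ^ 15 * (fps_stretch 3 hex_theta)\<^sup>2 *
     ((2 * euler 3 ^ 3 * fps_stretch 3 hex_theta ^ 3 + 27 * fps_X ^ 3 * euler 9 ^ 9) * (euler 3 ^ 3 * fps_stretch 3 hex_theta ^ 3 + 216 * fps_X ^ 3 * euler 9 ^ 9)))"
    unfolding g2 P t by algebra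
  finally have "euler 3 ^ 38 * fps_stretch 3 g = 243 * euler 9 ^ 15 * (fps_stretch 3 hex_theta)\<^sup>2 *
     ((2 * euler 3 ^ 3 * fps_stretch 3 hex_theta ^ 3 + 27 * fps_X ^ 3 * euler 9 ^ 9) * (euler 3 ^ 3 * fps_stretch 3 hex_theta ^ 3 + 216 * fps_X ^ 3 * euler 9 ^ 9))"
    by (subst (asm) mult_left_cancel) (simp_all add: euler_nonzero)
  then have "fps_stretch 3 (euler 1 ^ 38 * g) = fps_stretch 3 (243 * euler 3 ^ 15 * hex_theta\<^sup>2 *
     ((2 * euler 1 ^ 3 * hex_theta ^ 3 + 27 * fps_X * euler 3 ^ 9) * (euler 1 ^ 3 * hex_theta ^ 3 + 216 * fps_X * euler 3 ^ 9)))"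
    by (simp add: fps_stretch_mult fps_stretch_add fps_stretch_power fps_stretch_euler fps_stretch_numeral fps_stretch_X)
  then show ?thesis unfolding g_def by (rule fps_stretch_inj[rotated]) simp
qed

text \<open>With v = q E_3^9 / E_1^3, the first factor 2 a^3 + 27 v is rewritten by 16 (2 a^3 + 27
  v) = 5 (a^3 + 216 v) + 27 (a^3 - 24 v); times a, the two brackets are X(q) and X(q^3).\<close>

lemma cphi_9n_5_e8:
  "16 * euler 1 ^ 32 * Abs_fps (\<lambda>n. int (cphi 3 (9 * n + 5))) =
     243 * euler 3 ^ 15 * e8_theta * (5 * e8_theta + 27 * fps_stretch 3 e8_theta)"
proof -
  have "euler 1 ^ 6 * (16 * euler 1 ^ 32 * Abs_fps (\<lambda>n. int (cphi 3 (9 * n + 5))))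
    = 16 * (euler 1 ^ 38 * Abs_fps (\<lambda>n. int (cphi 3 (9 * n + 5))))" by algebra
  also have "\<dots> = euler 1 ^ 6 * (243 * euler 3 ^ 15 * e8_theta * (5 * e8_theta + 27 * fps_stretch 3 e8_theta))"
    unfolding cphi_9n_5 using e8_theta_level3 e8_theta_stretch3 by algebra
  finally show ?thesis by (subst (asm) mult_left_cancel) (simp_all add: euler_nonzero)
qed

section \<open>The congruence modulo 625\<close>

lemma fps_dvd_iff: "fps_const c dvd f \<longleftrightarrow> (\<forall>n. c dvd f $ n)" for c :: int
proof
  assume "\<forall>n. c dvd f $ n"
  then obtain g where "\<And>n. f $ n = c * g n" unfolding dvd_def by metis
  then have "f = fps_const c * Abs_fps g" by (simp add: fps_eq_iff)
  then show "fps_const c dvd f" by simp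
qed (auto elim!: dvdE)

lemma dvd_prod_diff:
  fixes f g :: "'b \<Rightarrow> 'a::comm_ring_1"
  assumes "\<And>x. x \<in> A \<Longrightarrow> m dvd f x - g x"
  shows "m dvd prod f A - prod g A"
  using assms
proof (induction A rule: infinite_finite_induct)
  case (insert x A)
  have "prod f (insert x A) - prod g (insert x A) = (f x - g x) * prod f A + g x * (prod f A - prod g A)"
    using insert.hyps by (simp add: algebra_simps)
  then show ?case using insert by simp
qed auto

lemma euler_power_5: "(5 :: int fps) dvd euler 1 ^ 5 - euler 5"
proof -
  let ?u = "\<lambda>n. (1 - fps_X ^ Suc n) ^ 5 :: int fps" and ?v = "\<lambda>n. 1 - fps_X ^ (5 * Suc n) :: int fps"
  have t: "tame (\<lambda>n. 1 - fps_X ^ Suc n :: int fps)" by (rule tame_one_plus) simp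
  have u: "euler 1 ^ 5 = fps_iprod ?u"
    using fps_iprod_prod[of "{..<5::nat}" "\<lambda>_ n. 1 - fps_X ^ Suc n :: int fps"] t by (simp add: euler_def)
  have uv: "fps_const 5 dvd ?u n - ?v n" for n
  proof -
    let ?y = "fps_X ^ Suc n :: int fps"
    have v: "fps_X ^ (5 * Suc n) = ?y ^ 5" by (metis mult.commute power_mult)
    have "?u n - ?v n = 5 * (- ?y + 2 * ?y\<^sup>2 - 2 * ?y ^ 3 + ?y ^ 4)" unfolding v by algebra
    then show ?thesis by (simp only: numeral_fps_const[symmetric] dvd_triv_left)
  qed
  have "fps_const 5 dvd (\<Prod>k\<le>n. ?u k) - (\<Prod>k\<le>n. ?v k)" for n by (intro dvd_prod_diff uv)
  then have "5 dvd (fps_iprod ?u - fps_iprod ?v) $ n" for n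
    unfolding fps_dvd_iff by (simp add: fps_iprod_def)
  then show ?thesis unfolding u euler_def[of 5] by (simp only: numeral_fps_const fps_dvd_iff simp_thms)
qed

lemma fps_unit:
  fixes f :: "'a::comm_ring_1 fps"
  assumes "f $ 0 = 1"
  obtains g where "f * g = 1"
  using fps_right_inverse[of f 1] assms by auto

definition fcong :: "'a::comm_ring_1 \<Rightarrow> 'a \<Rightarrow> 'a \<Rightarrow> bool" where
  "fcong m x y \<longleftrightarrow> m dvd x - y"

lemma fcong_refl [simp, intro]: "fcong m x x"
  by (simp add: fcong_def)

lemma fcong_trans [trans]: "fcong m x y \<Longrightarrow> fcong m y z \<Longrightarrow> fcong m x z"
  unfolding fcong_def using dvd_add[of m "x - y" "y - z"] by simp

lemma fcong_add: "fcong m x x' \<Longrightarrow> fcong m y y' \<Longrightarrow> fcong m (x + y) (x' + y')"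
  unfolding fcong_def using dvd_add[of m "x - x'" "y - y'"] by (simp add: algebra_simps)

lemma fcong_diff: "fcong m x x' \<Longrightarrow> fcong m y y' \<Longrightarrow> fcong m (x - y) (x' - y')"
  unfolding fcong_def using dvd_diff[of m "x - x'" "y - y'"] by (simp add: algebra_simps)

lemma fcong_mult: "fcong m x x' \<Longrightarrow> fcong m y y' \<Longrightarrow> fcong m (x * y) (x' * y')"
proof -
  assume "fcong m x x'" "fcong m y y'"
  moreover have "x * y - x' * y' = (x - x') * y + x' * (y - y')" by (simp add: algebra_simps)
  ultimately show ?thesis unfolding fcong_def by simp
qed

lemma fcong_power: "fcong m x y \<Longrightarrow> fcong m (x ^ k) (y ^ k)"
  by (induction k) (auto intro: fcong_mult)

lemma fcongI: "x - y = m * k \<Longrightarrow> fcong m x y"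
  by (simp add: fcong_def)

lemmas fcong_intros = fcong_add fcong_diff fcong_mult fcong_power

text \<open>Modulo 5 one has $B \equiv B_3 \equiv 1$, $B_3 = B + 5 d$ with
  $d \equiv Y$, and the two corrections of first order, coming from $d$ and from $C, C_3$, cancel.\<close>

lemma congruence_core:
  fixes B B3 C C3 X X3 Y d :: "'a::idom"
  assumes X: "X = B\<^sup>2 + 250 * B * C + 3125 * C\<^sup>2" and X3: "X3 = B3\<^sup>2 + 250 * B3 * C3 + 3125 * C3\<^sup>2"
    and B: "fcong 5 B 1" and d: "B3 = B + 5 * d" "fcong 5 d Y"
    and CC: "fcong 5 (C + C3) (Y + 2 * Y\<^sup>2)"
  shows "fcong 625 (B3 ^ 3 * X * (5 * X + 27 * X3)) (32 * B ^ 7)"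
proof -
  have x: "fcong 625 X (B\<^sup>2 + 250 * B * C)" by (rule fcongI[where k = "5 * C\<^sup>2"]) (simp add: X)
  have x3: "fcong 625 X3 (B3\<^sup>2 + 250 * B3 * C3)" by (rule fcongI[where k = "5 * C3\<^sup>2"]) (simp add: X3)
  \<comment> \<open>\<open>125 * W\<close> collects the deviations not yet visibly divisible by 625.
    Expanding in d, the linear coefficient is 5 (3 * 5 + 5 * 27) = 750 = 6 * 125 and the quadratic
    one 25 (3 * 5 + 10 * 27) = 7125 = 57 * 125; the terms with C and C3 come from 250 = 2 *
    125.\<close>
  define W where "W = B\<^sup>2 * (6 * B ^ 4 * d + 57 * B ^ 3 * d\<^sup>2) + 2 * B3 ^ 3 * B * C * (5 * B\<^sup>2 + 27 * B3\<^sup>2) + 54 * B3 ^ 4 * B\<^sup>2 * C3"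
  have B3: "fcong 5 B3 1"
  proof -
    have "fcong 5 B3 B" by (rule fcongI[where k = d]) (simp add: d)
    then show ?thesis using B by (rule fcong_trans)
  qed
  have "fcong 5 W (1\<^sup>2 * (6 * 1 ^ 4 * Y + 57 * 1 ^ 3 * Y\<^sup>2) + 2 * 1 ^ 3 * 1 * C * (5 * 1\<^sup>2 + 27 * 1\<^sup>2) + 54 * 1 ^ 4 * 1\<^sup>2 * C3)"
    unfolding W_def by (intro fcong_intros B B3 d(2) fcong_refl)
  also have "fcong 5 \<dots> (Y + 2 * Y\<^sup>2 + 4 * (C + C3))"
    by (rule fcongI[where k = "Y + 11 * Y\<^sup>2 + 12 * C + 10 * C3"]) (simp add: algebra_simps)
  also have "fcong 5 \<dots> (Y + 2 * Y\<^sup>2 + 4 * (Y + 2 * Y\<^sup>2))"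
    by (intro fcong_intros CC fcong_refl)
  also have "fcong 5 \<dots> 0" by (rule fcongI[where k = "Y + 2 * Y\<^sup>2"]) (simp add: algebra_simps)
  finally obtain h where h: "W = 5 * h" unfolding fcong_def by (auto elim: dvdE)
  have "fcong 625 (B3 ^ 3 * X * (5 * X + 27 * X3)) (B3 ^ 3 * (B\<^sup>2 + 250 * B * C) * (5 * (B\<^sup>2 + 250 * B * C) + 27 * (B3\<^sup>2 + 250 * B3 * C3)))"
    by (intro fcong_intros x x3 fcong_refl)
  \<comment> \<open>The witness is the polynomial difference of the two sides, after B3 = B + 5 d,
    divided by 625.\<close>
  also have "fcong 625 \<dots> (32 * B ^ 7 + 125 * W)"
    by (rule fcongI[where k = "2 * B ^ 6 * C + 500 * B ^ 5 * C ^ 2 + 30 * B ^ 5 * d * C + 150 * B ^ 4 * d ^ 2 * C + 2700 * B ^ 5 * C * C3 + 54000 * B ^ 4 * d * C * C3 + 55 * B ^ 4 * d ^ 3 + 7500 * B ^ 4 * d * C ^ 2 + 250 * B ^ 3 * d ^ 3 * C + 405000 * B ^ 3 * d ^ 2 * C * C3 + 135 * B ^ 3 * d ^ 4 + 37500 * B ^ 3 * d ^ 2 * C ^ 2 + 1350000 * B ^ 2 * d ^ 3 * C * C3 + 135 * B ^ 2 * d ^ 5 + 62500 * B ^ 2 * d ^ 3 * C ^ 2 + 1687500 * B * d ^ 4 * C * C3"])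
      (unfold W_def d(1), algebra)
  also have "fcong 625 \<dots> (32 * B ^ 7)" by (rule fcongI[where k = h]) (simp add: h)
  finally show ?thesis .
qed

lemma cphi_9n_5_mod_625:
  obtains S :: "int fps" where "fclass 5 0 S" "fcong 625 (16 * Abs_fps (\<lambda>n. int (cphi 3 (9 * n + 5)))) (S * euler 1 ^ 3)"
proof -
  obtain B C where EB: "euler 5 * B = euler 1 ^ 5" and EC: "euler 1 * C = fps_X * euler 5 ^ 5"
    and X: "e8_theta = B\<^sup>2 + 250 * B * C + 3125 * C\<^sup>2" by (rule e8_theta_level5)
  define f where "f = Abs_fps (\<lambda>n. int (cphi 3 (9 * n + 5)))"
  define B3 where "B3 = fps_stretch 3 B"
  define C3 where "C3 = fps_stretch 3 C"
  define a where "a = hex_theta"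
  obtain i1 :: "int fps" where i1: "euler 1 * i1 = 1" using fps_unit[of "euler 1 :: int fps"] by auto
  define i3 where "i3 = fps_stretch 3 i1"
  define i5 where "i5 = fps_stretch 5 i1"
  have i3: "euler 3 * i3 = 1"
    using arg_cong[OF i1, of "fps_stretch 3"] by (simp add: i3_def fps_stretch_mult fps_stretch_euler)
  have i5: "euler 5 * i5 = 1"
    using arg_cong[OF i1, of "fps_stretch 5"] by (simp add: i5_def fps_stretch_mult fps_stretch_euler)
  have E3B: "euler 15 * B3 = euler 3 ^ 5" and E3C: "euler 3 * C3 = fps_X ^ 3 * euler 15 ^ 5"
    and X3: "fps_stretch 3 e8_theta = B3\<^sup>2 + 250 * B3 * C3 + 3125 * C3\<^sup>2"
    using arg_cong[OF EB, of "fps_stretch 3"] arg_cong[OF EC, of "fps_stretch 3"] arg_cong[OF X, of "fps_stretch 3"]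
    by (simp_all add: B3_def C3_def fps_stretch_mult fps_stretch_add fps_stretch_power fps_stretch_euler fps_stretch_numeral fps_stretch_X)
  obtain g :: "int fps" where "euler 1 ^ 5 - euler 5 = 5 * g"
    using euler_power_5 by (elim dvdE)
  then have g: "euler 1 ^ 5 = euler 5 + 5 * g" by (simp add: diff_eq_eq add.commute)
  have g3: "euler 3 ^ 5 = euler 15 + 5 * fps_stretch 3 g"
    using arg_cong[OF g, of "fps_stretch 3"]
    by (simp add: fps_stretch_mult fps_stretch_add fps_stretch_power fps_stretch_euler fps_stretch_numeral)
  have "B = (euler 5 * i5) * B" unfolding i5 by simp
  also have "\<dots> = i5 * (euler 5 + 5 * g)" unfolding g[symmetric] EB[symmetric] by (simp add: ac_simps)
  also have "\<dots> = euler 5 * i5 + 5 * (g * i5)" by algebra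
  finally have "B = 1 + 5 * (g * i5)" unfolding i5 .
  then obtain b where b: "B = 1 + 5 * b" by blast
  have b3: "B3 = 1 + 5 * fps_stretch 3 b"
    by (simp add: B3_def b fps_stretch_mult fps_stretch_add fps_stretch_numeral)
  have Bcong: "fcong 5 B 1" by (rule fcongI[where k = b]) (simp add: b)
  \<comment> \<open>In the Borweins' notation \<open>v\<close> is c^3 / 27 and \<open>w\<close>
    below is b = E_1^3 / E_3, so \<open>cubic\<close> is a^3 = b^3 + c^3.\<close>
  define v where "v = fps_X * euler 3 ^ 9 * i1 ^ 3"
  have Xa: "e8_theta = a ^ 4 + 216 * (a * v)" and X3a: "fps_stretch 3 e8_theta = a ^ 4 - 24 * (a * v)"
  proof -
    have "euler 1 ^ 3 * v = fps_X * euler 3 ^ 9 * (euler 1 * i1) ^ 3" unfolding v_def by algebra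
    then have v: "euler 1 ^ 3 * v = fps_X * euler 3 ^ 9" unfolding i1 by simp
    have "euler 1 ^ 3 * (a ^ 4 + 216 * (a * v)) = a * (euler 1 ^ 3 * a ^ 3 + 216 * (euler 1 ^ 3 * v))"
      "euler 1 ^ 3 * (a ^ 4 - 24 * (a * v)) = a * (euler 1 ^ 3 * a ^ 3 - 24 * (euler 1 ^ 3 * v))"
      by algebra+
    then have "euler 1 ^ 3 * e8_theta = euler 1 ^ 3 * (a ^ 4 + 216 * (a * v))"
      "euler 1 ^ 3 * fps_stretch 3 e8_theta = euler 1 ^ 3 * (a ^ 4 - 24 * (a * v))"
      unfolding v a_def by (simp_all only: e8_theta_level3 e8_theta_stretch3 mult.assoc)
    then show "e8_theta = a ^ 4 + 216 * (a * v)" "fps_stretch 3 e8_theta = a ^ 4 - 24 * (a * v)"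
      by (simp_all add: euler_nonzero)
  qed
  define w where "w = euler 1 ^ 3 * i3"
  have cubic: "a ^ 3 = w ^ 3 + 27 * v"
  proof -
    have "(i3 ^ 3 * i1 ^ 3) * (euler 3 ^ 3 * euler 1 ^ 3 * a ^ 3) = (euler 3 * i3) ^ 3 * (euler 1 * i1) ^ 3 * a ^ 3" by algebra
    then have "a ^ 3 = (i3 ^ 3 * i1 ^ 3) * (euler 3 ^ 3 * euler 1 ^ 3 * a ^ 3)" unfolding i1 i3 by simp
    also have "\<dots> = (i3 ^ 3 * i1 ^ 3) * (euler 1 ^ 12 + 27 * fps_X * euler 3 ^ 12)"
      unfolding a_def cubic_theta_identity ..
    also have "\<dots> = (euler 1 * i1) ^ 3 * w ^ 3 + 27 * ((euler 3 * i3) ^ 3 * v)" unfolding w_def v_def by algebra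
    also have "\<dots> = w ^ 3 + 27 * v" unfolding i1 i3 by simp
    finally show ?thesis .
  qed
  define Y where "Y = a * v"
  define d where "d = fps_stretch 3 b - b"
  have B3B: "B3 = B + 5 * d" unfolding b3 b d_def by (simp add: algebra_simps)
  have dY: "fcong 5 d Y"
  proof -
    have "fps_stretch 3 e8_theta - e8_theta = - 240 * Y"
      unfolding X3a Y_def by (subst Xa) simp
    then have "B3\<^sup>2 + 250 * B3 * C3 + 3125 * C3\<^sup>2 - (B\<^sup>2 + 250 * B * C + 3125 * C\<^sup>2) = - 240 * Y"
      unfolding X3[symmetric] X[symmetric] .
    then have "5 * (2 * d + 5 * (2 * b * d + d\<^sup>2) + 50 * (B3 * C3 - B * C) + 625 * (C3\<^sup>2 - C\<^sup>2) + 48 * Y) = 0"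
      unfolding B3B b by algebra
    then have "2 * d + 5 * (2 * b * d + d\<^sup>2) + 50 * (B3 * C3 - B * C) + 625 * (C3\<^sup>2 - C\<^sup>2) + 48 * Y = 0"
      by (simp only: mult_eq_0_iff numeral_neq_zero simp_thms)
    \<comment> \<open>Three times the previous equation: 3 inverts 2 modulo 5, and 3 * 48 = 144 is
      -1.\<close>
    then have "d - Y = 5 * (- 29 * Y - 3 * (2 * b * d + d\<^sup>2) - 30 * (B3 * C3 - B * C) - 375 * (C3\<^sup>2 - C\<^sup>2) - d)"
      by algebra
    then show ?thesis by (rule fcongI)
  qed
  have CC: "fcong 5 (C + C3) (Y + 2 * Y\<^sup>2)"
  proof -
    have e5: "fcong 5 (euler 5 :: int fps) (euler 1 ^ 5)" by (rule fcongI[where k = "- g"]) (unfold g, simp)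
    have e15: "fcong 5 (euler 15 :: int fps) (euler 3 ^ 5)" by (rule fcongI[where k = "- fps_stretch 3 g"]) (unfold g3, simp)
    have "C = (euler 1 * i1) * C" unfolding i1 by simp
    also have "\<dots> = i1 * (fps_X * euler 5 ^ 5)" unfolding EC[symmetric] by (simp only: ac_simps)
    also have "fcong 5 \<dots> (i1 * (fps_X * (euler 1 ^ 5) ^ 5))" by (intro fcong_intros e5 fcong_refl)
    \<comment> \<open>Modulo 5, C becomes q E_1^24, the discriminant form, and C3 the same at q^3.
      Both are monomials in w^3 and v, hence by \<open>cubic\<close> polynomials in a^3 and
      v.\<close>
    also have "i1 * (fps_X * (euler 1 ^ 5) ^ 5) = (w ^ 3) ^ 3 * v"
    proof -
      have "i1 * (fps_X * (euler 1 ^ 5) ^ 5) = fps_X * euler 1 ^ 24 * (euler 1 * i1)"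
        "(w ^ 3) ^ 3 * v = fps_X * euler 1 ^ 24 * ((euler 1 * i1) ^ 3 * (euler 3 * i3) ^ 9)"
        unfolding w_def v_def by algebra+
      then show ?thesis unfolding i1 i3 by simp
    qed
    finally have C: "fcong 5 C ((w ^ 3) ^ 3 * v)" .
    have "C3 = (euler 3 * i3) * C3" unfolding i3 by simp
    also have "\<dots> = i3 * (fps_X ^ 3 * euler 15 ^ 5)" unfolding E3C[symmetric] by (simp only: ac_simps)
    also have "fcong 5 \<dots> (i3 * (fps_X ^ 3 * (euler 3 ^ 5) ^ 5))" by (intro fcong_intros e15 fcong_refl)
    also have "i3 * (fps_X ^ 3 * (euler 3 ^ 5) ^ 5) = w ^ 3 * v ^ 3"
    proof -
      have "i3 * (fps_X ^ 3 * (euler 3 ^ 5) ^ 5) = fps_X ^ 3 * euler 3 ^ 24 * (euler 3 * i3)"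
        "w ^ 3 * v ^ 3 = fps_X ^ 3 * euler 3 ^ 24 * ((euler 1 * i1) ^ 9 * (euler 3 * i3) ^ 3)"
        unfolding w_def v_def by algebra+
      then show ?thesis unfolding i1 i3 by simp
    qed
    finally have C3: "fcong 5 C3 (w ^ 3 * v ^ 3)" .
    \<comment> \<open>X is B^2, hence 1, modulo 5, and 216 is 1 modulo 5.\<close>
    have a4: "fcong 5 (a ^ 4) (1 - Y)"
    proof -
      have "a ^ 4 = e8_theta - 216 * Y" unfolding Y_def by (subst Xa) simp
      then have "a ^ 4 = B\<^sup>2 + 250 * B * C + 3125 * C\<^sup>2 - 216 * Y" unfolding X .
      then have "a ^ 4 - (1 - Y) = 5 * (2 * b + 5 * b\<^sup>2 + 50 * B * C + 625 * C\<^sup>2 - 43 * Y)" unfolding b by algebra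
      then show ?thesis by (rule fcongI)
    qed
    have "fcong 5 (C + C3) ((w ^ 3) ^ 3 * v + w ^ 3 * v ^ 3)" by (rule fcong_add[OF C C3])
    also have "\<dots> = (a ^ 4) ^ 2 * Y - 81 * (a ^ 4 * Y\<^sup>2) + 2188 * Y ^ 3 - 19710 * v ^ 4"
      unfolding Y_def using cubic by algebra
    also have "fcong 5 \<dots> ((1 - Y) ^ 2 * Y - 81 * ((1 - Y) * Y\<^sup>2) + 2188 * Y ^ 3 - 19710 * v ^ 4)"
      by (intro fcong_intros a4 fcong_refl)
    also have "fcong 5 \<dots> (Y + 2 * Y\<^sup>2)"
    proof (rule fcongI[where k = "- 17 * Y\<^sup>2 + 454 * Y ^ 3 - 3942 * v ^ 4"])
      show "(1 - Y) ^ 2 * Y - 81 * ((1 - Y) * Y\<^sup>2) + 2188 * Y ^ 3 - 19710 * v ^ 4 - (Y + 2 * Y\<^sup>2) = 5 * (- 17 * Y\<^sup>2 + 454 * Y ^ 3 - 3942 * v ^ 4)"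
        by algebra
    qed
    finally show ?thesis .
  qed
  have core: "fcong 625 (B3 ^ 3 * e8_theta * (5 * e8_theta + 27 * fps_stretch 3 e8_theta)) (32 * B ^ 7)"
    by (rule congruence_core[OF X X3 Bcong B3B dY CC])
  obtain ib where ib: "B * ib = 1"
  proof (rule fps_unit)
    have "(euler 5 * B) $ 0 = 1" unfolding EB by (simp add: fps_power_zeroth)
    then show "B $ 0 = 1" by simp
  qed
  have u: "(i5 * ib) * euler 1 ^ 5 = 1"
  proof -
    have "(i5 * ib) * (euler 5 * B) = (euler 5 * i5) * (B * ib)" by algebra
    then show ?thesis unfolding EB i5 ib by simp
  qed
  \<comment> \<open>\<open>i5 * ib\<close> inverts E_1^5. Its seventh power overshoots E_1^32 by
    exactly the E_1^3 to which Jacobi's identity applies.\<close>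
  have "(i5 * ib) ^ 7 * euler 1 ^ 3 * (16 * euler 1 ^ 32 * f) = ((i5 * ib) * euler 1 ^ 5) ^ 7 * (16 * f)" by algebra
  then have "16 * f = (i5 * ib) ^ 7 * euler 1 ^ 3 * (16 * euler 1 ^ 32 * f)" unfolding u by simp
  also have "16 * euler 1 ^ 32 * f = 243 * (euler 3 ^ 5) ^ 3 * e8_theta * (5 * e8_theta + 27 * fps_stretch 3 e8_theta)"
    unfolding f_def cphi_9n_5_e8 by (simp flip: power_mult)
  also have "\<dots> = 243 * euler 15 ^ 3 * (B3 ^ 3 * e8_theta * (5 * e8_theta + 27 * fps_stretch 3 e8_theta))"
    unfolding E3B[symmetric] by (simp only: power_mult_distrib mult.assoc)
  also have "fcong 625 ((i5 * ib) ^ 7 * euler 1 ^ 3 * (243 * euler 15 ^ 3 * (B3 ^ 3 * e8_theta * (5 * e8_theta + 27 * fps_stretch 3 e8_theta))))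
      ((i5 * ib) ^ 7 * euler 1 ^ 3 * (243 * euler 15 ^ 3 * (32 * B ^ 7)))"
    by (intro fcong_mult core fcong_refl)
  also have "(i5 * ib) ^ 7 * euler 1 ^ 3 * (243 * euler 15 ^ 3 * (32 * B ^ 7)) = (7776 * euler 15 ^ 3 * i5 ^ 7) * euler 1 ^ 3 * (B * ib) ^ 7"
    by algebra
  also have "\<dots> = (7776 * euler 15 ^ 3 * i5 ^ 7) * euler 1 ^ 3" unfolding ib by simp
  finally have main: "fcong 625 (16 * f) ((7776 * euler 15 ^ 3 * i5 ^ 7) * euler 1 ^ 3)" .
  have e15: "fclass 5 0 (euler 15 :: int fps)"
    using fclass_stretch[of 5 5 "euler 3 :: int fps"] by (simp add: fps_stretch_euler)
  have ci5: "fclass 5 0 i5" unfolding i5_def by (rule fclass_stretch) simp_all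
  have "fclass 5 0 (euler 15 ^ 3 :: int fps)" "fclass 5 0 (i5 ^ 7)"
    using fclass_power[OF e15, of 3] fclass_power[OF ci5, of 7] by simp_all
  then have "fclass 5 0 (7776 * euler 15 ^ 3 * i5 ^ 7)"
    by (intro fclass_mult[of 5 0 _ 0] fclass_cmult) simp_all
  with main show ?thesis using that unfolding f_def by blast
qed

lemma cphi_9n_5_dvd:
  assumes "n mod 5 = 2 \<or> n mod 5 = 4"
  shows "625 dvd cphi 3 (9 * n + 5)"
proof -
  obtain S :: "int fps" where S: "fclass 5 0 S" and c: "fcong 625 (16 * Abs_fps (\<lambda>n. int (cphi 3 (9 * n + 5)))) (S * euler 1 ^ 3)"
    by (rule cphi_9n_5_mod_625)
  have "S $ l * (euler 1 ^ 3 :: int fps) $ (n - l) = 0" if "l \<le> n" for l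
  proof (cases "l mod 5 = 0")
    case True
    then obtain m where "l = 5 * m" by auto
    then have "n = (n - l) + 5 * m" using that by simp
    then have "n mod 5 = (n - l) mod 5" by (metis mod_mult_self2)
    then show ?thesis using assms euler_cube_nth_eq_0[of "n - l"] by simp
  next
    case False
    then show ?thesis using S by (simp add: fclass_def)
  qed
  then have "(S * euler 1 ^ 3) $ n = 0" unfolding fps_mult_nth by (intro sum.neutral) auto
  moreover have "fps_const 625 dvd 16 * Abs_fps (\<lambda>n. int (cphi 3 (9 * n + 5))) - S * euler 1 ^ 3"
    using c by (simp add: fcong_def numeral_fps_const)
  then have "625 dvd (16 * Abs_fps (\<lambda>n. int (cphi 3 (9 * n + 5))) - S * euler 1 ^ 3) $ n"
    unfolding fps_dvd_iff by blast
  ultimately have "625 dvd 16 * int (cphi 3 (9 * n + 5))"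
    by (simp add: numeral_fps_const)
  then obtain y where "16 * int (cphi 3 (9 * n + 5)) = 625 * y" by (elim dvdE)
  \<comment> \<open>16 is a unit modulo 625: 16 * 586 = 15 * 625 + 1.\<close>
  then have "int (cphi 3 (9 * n + 5)) = 625 * (586 * y - 15 * int (cphi 3 (9 * n + 5)))" by simp
  then have "int 625 dvd int (cphi 3 (9 * n + 5))" by (metis dvd_triv_left of_nat_numeral)
  then show ?thesis by (simp only: int_dvd_int_iff)
qed

theorem theorem1p1:
  fixes n :: nat
  shows "[cphi 3 (45 * n + 23) = 0] (mod 625) \<and> [cphi 3 (45 * n + 41) = 0] (mod 625)"
proof -
  have "(5 * n + 2) mod 5 = 2" "(5 * n + 4) mod 5 = 4" by presburger+
  then have "625 dvd cphi 3 (9 * (5 * n + 2) + 5)" "625 dvd cphi 3 (9 * (5 * n + 4) + 5)"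
    using cphi_9n_5_dvd[of "5 * n + 2"] cphi_9n_5_dvd[of "5 * n + 4"] by (simp_all only: simp_thms)
  moreover have "9 * (5 * n + 2) + 5 = 45 * n + 23" "9 * (5 * n + 4) + 5 = 45 * n + 41" by simp_all
  ultimately have "625 dvd cphi 3 (45 * n + 23)" "625 dvd cphi 3 (45 * n + 41)" by (simp_all only:)
  then show ?thesis by (simp add: cong_0_iff)
qed

end
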